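(* Let $P=-\frac{d^2}{dx^2}+V(x)$ on $L^2(\mathbb{R})$, where the real potential $V$ has the form \[ V(x)=\sum_{j=1}^{J}s_j(x)W_j(x), \] with $J\in\mathbb{N}$, each $s_j\in C(\mathbb{R};\mathbb{R})$ periodic with period $\pi$ and having an absolutely convergent Fourier series, and each $W_j\in C^\infty(\mathbb{R};\mathbb{R})$ admitting an analytic continuation to the region $\{z=x+iy\mid |x|>R_0,\ |y|<K|x|\}$ for some $R_0>0$ and $K>0$, with the bound $|W_j(z)|\le C|z|^{-\mu}$ in this region for some $\mu>0$ and $C>0$. Let $\mathcal{T}=\{n^2\mid n\in\mathbb{N}\cup\{0\}\}$ and, for $\mathrm{Im}\,z>0$, let $R_+(z)=(z-P)^{-1}$. Then there exists a complex neighborhood $\Omega\subset\mathbb{C}$ of $[0,\infty)\setminus\mathcal{T}$ such that for any $f,g\in L^2_{\mathrm{comp}}(\mathbb{R})$, the function $z\mapsto (f,R_+(z)g)$, defined for $\mathrm{Im}\,z>0$, has a meromorphic continuation to $\Omega$.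
   Context: $L^2_{\mathrm{comp}}(\mathbb{R})$ denotes the space of compactly supported $L^2$ functions on $\mathbb{R}$; $(\cdot,\cdot)$ is the $L^2(\mathbb{R})$ inner product. The continuation is from the upper half plane $\{\mathrm{Im}\,z>0\}$ across $[0,\infty)\setminus\mathcal{T}$. *)

theory Defs
  imports "HOL-Complex_Analysis.Complex_Analysis"
begin

definition fourier_coeff_pi :: "(real \<Rightarrow> real) \<Rightarrow> int \<Rightarrow> complex" where
  "fourier_coeff_pi s n =
     complex_of_real (1 / pi) *
     integral {0..pi} (\<lambda>x. complex_of_real (s x) * exp (- (2 * of_int n * of_real x) * \<i>))"

definition periodic_factor :: "(real \<Rightarrow> real) \<Rightarrow> bool" where
  "periodic_factor s \<longleftrightarrow> continuous_on UNIV s \<and> (\<forall>x. s (x + pi) = s x) \<and>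
     (\<lambda>n. norm (fourier_coeff_pi s n)) summable_on (UNIV :: int set)"

definition smooth_real :: "(real \<Rightarrow> real) \<Rightarrow> bool" where
  "smooth_real W \<longleftrightarrow> (\<forall>k x. ((deriv ^^ k) W) field_differentiable (at x))"

definition sector_region :: "real \<Rightarrow> real \<Rightarrow> complex set" where
  "sector_region R0 K = {z. \<bar>Re z\<bar> > R0 \<and> \<bar>Im z\<bar> < K * \<bar>Re z\<bar>}"

definition decaying_factor :: "(real \<Rightarrow> real) \<Rightarrow> bool" where
  "decaying_factor W \<longleftrightarrow> smooth_real W \<and>
     (\<exists>R0 K \<mu> C Wc. R0 > 0 \<and> K > 0 \<and> \<mu> > 0 \<and> C > 0 \<and>
        Wc holomorphic_on sector_region R0 K \<and>
        (\<forall>x. \<bar>x\<bar> > R0 \<longrightarrow> Wc (complex_of_real x) = complex_of_real (W x)) \<and>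
        (\<forall>z\<in>sector_region R0 K. norm (Wc z) \<le> C * norm z powr (- \<mu>)))"

definition L2_comp :: "(real \<Rightarrow> complex) \<Rightarrow> bool" where
  "L2_comp f \<longleftrightarrow> f \<in> borel_measurable lborel \<and>
     integrable lborel (\<lambda>x. (norm (f x))\<^sup>2) \<and>
     (\<exists>r. AE x in lborel. \<bar>x\<bar> > r \<longrightarrow> f x = 0)"

definition L2 :: "(real \<Rightarrow> complex) \<Rightarrow> bool" where
  "L2 f \<longleftrightarrow> f \<in> borel_measurable lborel \<and> integrable lborel (\<lambda>x. (norm (f x))\<^sup>2)"

definition test_fun :: "(real \<Rightarrow> real) \<Rightarrow> bool" where
  "test_fun \<phi> \<longleftrightarrow> smooth_real \<phi> \<and> (\<exists>r. \<forall>x. \<bar>x\<bar> > r \<longrightarrow> \<phi> x = 0)"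

text \<open>u in L^2 solves (z - P) u = g, P = -d^2/dx^2 + V, in the distributional sense:
  z u + u'' - V u = g tested against test functions.\<close>
definition resolvent_sol :: "(real \<Rightarrow> real) \<Rightarrow> complex \<Rightarrow> (real \<Rightarrow> complex) \<Rightarrow> (real \<Rightarrow> complex) \<Rightarrow> bool" where
  "resolvent_sol V z g u \<longleftrightarrow> L2 u \<and>
     (\<forall>\<phi>. test_fun \<phi> \<longrightarrow>
        (\<integral>x. u x * (z * of_real (\<phi> x) + of_real ((deriv ^^ 2) \<phi> x) - of_real (V x * \<phi> x)) \<partial>lborel)
        = (\<integral>x. g x * of_real (\<phi> x) \<partial>lborel))"

text \<open>(f, R_+(z) g) = int conj(f) * (z - P)^{-1} g, for Im z > 0 (the L^2 solution is unique a.e.).\<close>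
definition resolvent_pairing :: "(real \<Rightarrow> real) \<Rightarrow> complex \<Rightarrow> (real \<Rightarrow> complex) \<Rightarrow> (real \<Rightarrow> complex) \<Rightarrow> complex" where
  "resolvent_pairing V z f g =
     (THE c. \<exists>u. resolvent_sol V z g u \<and> c = (\<integral>x. cnj (f x) * u x \<partial>lborel))"

definition thresholds :: "real set" where
  "thresholds = {real (n^2) | n. True}"

end

theory Submission
  imports Defs
begin

text \<open>Write \<open>z = k\<^sup>2\<close>. In one dimension \<open>R\<^sub>+(z)\<close> has the kernel
  \<open>y\<^sub>+(max x y) y\<^sub>-(min x y) / W\<close>, where \<open>y\<^sub>\<plusminus>\<close> solve \<open>- y'' + V y = z y\<close> and are square integrable
  at \<open>\<plusminus>\<infinity>\<close>, and \<open>W\<close> is their Wronskian; hence the pairing is a quotient of holomorphic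
  functions on every domain in which the Cauchy data of \<open>y\<^sub>\<plusminus>\<close> at \<open>0\<close> can be chosen holomorphically.
  In the upper half plane these are Weyl solutions, obtained by a normal families argument.
  Near \<open>k\<^sub>0 > 0\<close> with \<open>k\<^sub>0 \<notin> \<int>\<close> they are continued as follows. Near infinity
  \<open>V(x) = \<Sum>\<^sub>n V\<^sub>n(x) e\<^bsup>2inx\<^esup>\<close> with \<open>V\<^sub>n\<close> analytic and decaying in a sector. Put \<open>y'/y = ik + w\<close>
  with \<open>w = \<Sum>\<^sub>n w\<^sub>n(x) e\<^bsup>2inx\<^esup>\<close>. Then the Riccati equation reads
  \<open>w\<^sub>n' + 2i(n + k) w\<^sub>n = V\<^sub>n - (w * w)\<^sub>n\<close>, and each of these equations is integrated from infinity along a ray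
  tilted up or down according to the sign of \<open>n + k\<^sub>0\<close>, on which the oscillating
  factor decays exponentially for all complex \<open>k\<close> near \<open>k\<^sub>0\<close>, uniformly in \<open>n\<close> because \<open>k\<^sub>0 \<notin> \<int>\<close>. This is a
  contraction in \<open>\<ell>\<^sup>1\<close> far out in the sector.\<close>

section \<open>Integrals depending holomorphically on a parameter\<close>

text \<open>The decay exponent \<mu> may be arbitrarily small, so \<open>V\<close> need not be
  integrable at infinity and a solution asymptotic to exp(ikx) need not exist. The logarithmic
  derivative avoids this: the linear part 2i(n + k) turns mere smallness of \<open>V\<close> far out
  into smallness of \<open>w\<close>, and the possibly divergent integral of \<open>w\<close>
  appears only in the exponent of \<open>y\<close>. Only the factors W_j continue analytically, not
  the s_j; this is why modes are separated before the real axis is left. The thresholds are the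
  energies at which some n + k vanishes. The bound |w| \<le> eps yields square integrability only
  for Im k > eps. Near a real energy the local quotient is therefore identified with the pairing
  only in the upper part of a disc, eps being made small relative to the disc by going further out;
  the identity theorem does the rest. The pairing is defined by description from distributional
  solutions, so their uniqueness has to be proved for a potential that need not be smooth. Its
  holomorphy in the upper half plane is not given either; the Weyl solutions supply it.\<close>

lemma norm_integral_le_integral:
  fixes f :: "'a \<Rightarrow> 'b::{banach,second_countable_topology}"
  assumes "integrable M f" "integrable M g" "\<And>x. x \<in> space M \<Longrightarrow> norm (f x) \<le> g x"
  shows "norm (\<integral>x. f x \<partial>M) \<le> (\<integral>x. g x \<partial>M)"
  by (rule order_trans[OF integral_norm_bound integral_mono]) (use assms in auto)

text \<open>Cauchy's estimate on circles of radius r/4 about points of the half disc bounds the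
  derivative by 4B/r. The resulting Lipschitz bound dominates the difference quotients in the next
  lemma.\<close>

lemma holomorphic_bounded_diff_le:
  fixes f :: "complex \<Rightarrow> complex"
  assumes "f holomorphic_on ball z0 r" "r > 0" "\<And>z. z \<in> ball z0 r \<Longrightarrow> norm (f z) \<le> B"
    "w \<in> ball z0 (r/2)"
  shows "norm (f w - f z0) \<le> 4 * B / r * norm (w - z0)"
proof -
  have d: "norm (deriv f z) \<le> 4 * B / r" if z: "z \<in> ball z0 (r/2)" for z
  proof -
    have sub: "cball z (r/4) \<subseteq> ball z0 r"
    proof
      fix y assume "y \<in> cball z (r/4)"
      then have "dist z0 y \<le> dist z0 z + r/4" using dist_triangle[of z0 y z] by simp
      then show "y \<in> ball z0 r" using z assms(2) by simp
    qed
    have h: "f holomorphic_on cball z (r/4)" using assms(1) sub holomorphic_on_subset by blast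
    have "norm ((deriv ^^ 1) f z) \<le> fact 1 * B / (r/4) ^ 1"
    proof (rule Cauchy_inequality)
      show "f holomorphic_on ball z (r/4)" using h holomorphic_on_subset ball_subset_cball by blast
      show "continuous_on (cball z (r/4)) f" using h holomorphic_on_imp_continuous_on by blast
      show "0 < r/4" using assms by simp
      fix x assume "norm (z - x) = r/4"
      then have "x \<in> cball z (r/4)" by (simp add: dist_norm)
      then show "norm (f x) \<le> B" using sub assms(3) by blast
    qed
    then show ?thesis by (simp add: field_simps)
  qed
  show ?thesis
  proof (rule field_differentiable_bound[of "ball z0 (r/2)"])
    show "(f has_field_derivative deriv f z) (at z within ball z0 (r/2))" if "z \<in> ball z0 (r/2)" for z
    proof -
      have "z \<in> ball z0 r" using that assms(2) by auto
      then have "(f has_field_derivative deriv f z) (at z)"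
        using assms(1) holomorphic_derivI[OF assms(1) open_ball] by blast
      then show ?thesis by (rule has_field_derivative_at_within)
    qed
  qed (use assms d in auto)
qed

text \<open>Difference quotients converge pointwise and are dominated by \<open>4 * B t / r\<close>,
  so dominated convergence differentiates under the integral. It is applied along arbitrary
  sequences tending to 0, and the same limit makes the derivative measurable in
  \<open>t\<close>.\<close>

lemma holomorphic_on_lebesgue_integral:
  fixes f :: "complex \<Rightarrow> 'a \<Rightarrow> complex"
  assumes S: "open S" and meas: "\<And>z. z \<in> S \<Longrightarrow> f z \<in> borel_measurable M"
    and hol: "\<And>t. t \<in> space M \<Longrightarrow> (\<lambda>z. f z t) holomorphic_on S"
    and bound: "\<And>z t. z \<in> S \<Longrightarrow> t \<in> space M \<Longrightarrow> norm (f z t) \<le> B t" and B: "integrable M B"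
  shows "(\<lambda>z. \<integral>t. f z t \<partial>M) holomorphic_on S"
proof -
  have int: "integrable M (f z)" if "z \<in> S" for z
    by (rule Bochner_Integration.integrable_bound[OF B meas[OF that]])
       (auto intro!: AE_I2 order_trans[OF bound[OF that]])
  have "(\<lambda>z. \<integral>t. f z t \<partial>M) field_differentiable (at z0)" if z0: "z0 \<in> S" for z0
  proof -
    obtain r where r: "r > 0" "ball z0 r \<subseteq> S" using S z0 open_contains_ball by blast
    define D where "D t = deriv (\<lambda>z. f z t) z0" for t
    have holb: "(\<lambda>z. f z t) holomorphic_on ball z0 r" if "t \<in> space M" for t
      using hol[OF that] r holomorphic_on_subset by blast
    have Dt: "((\<lambda>z. f z t) has_field_derivative D t) (at z0)" if "t \<in> space M" for t
      unfolding D_def by (rule holomorphic_derivI[OF holb[OF that] open_ball]) (use r in auto)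
    have "((\<lambda>h. ((\<integral>t. f (z0 + h) t \<partial>M) - (\<integral>t. f z0 t \<partial>M)) / h) \<longlongrightarrow> (\<integral>t. D t \<partial>M)) (at 0)"
      unfolding tendsto_at_iff_sequentially
    proof (intro allI impI)
      fix X :: "nat \<Rightarrow> complex" assume X0: "\<forall>i. X i \<in> UNIV - {0}" and X: "X \<longlonglongrightarrow> 0"
      have "\<forall>\<^sub>F n in sequentially. dist (X n) 0 < r/2" using X r(1) by (intro tendstoD) auto
      then obtain N where N: "\<And>n. n \<ge> N \<Longrightarrow> norm (X n) < r/2"
        unfolding eventually_sequentially by auto
      define Y where "Y n = X (n + N)" for n
      have Yb: "z0 + Y n \<in> ball z0 (r/2)" for n using N[of "n + N"] by (simp add: Y_def dist_norm)
      have YS: "z0 + Y n \<in> S" for n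
        using Yb[of n] r by (auto simp: dist_norm intro!: subsetD[OF r(2)])
      have Y0: "Y n \<noteq> 0" for n using X0 by (auto simp: Y_def)
      have Y: "Y \<longlonglongrightarrow> 0" unfolding Y_def using X by (rule LIMSEQ_ignore_initial_segment)
      have lim: "(\<lambda>n. (f (z0 + Y n) t - f z0 t) / Y n) \<longlonglongrightarrow> D t" if t: "t \<in> space M" for t
      proof -
        have "((\<lambda>h. (f (z0 + h) t - f z0 t) / h) \<longlongrightarrow> D t) (at 0)"
          using Dt[OF t] by (simp add: DERIV_def)
        then show ?thesis unfolding tendsto_at_iff_sequentially comp_def using Y Y0 by auto
      qed
      have mq: "(\<lambda>t. (f (z0 + Y n) t - f z0 t) / Y n) \<in> borel_measurable M" for n
        using meas[OF YS] meas[OF z0] by measurable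
      have "(\<lambda>n. \<integral>t. (f (z0 + Y n) t - f z0 t) / Y n \<partial>M) \<longlonglongrightarrow> (\<integral>t. D t \<partial>M)"
      proof (rule integral_dominated_convergence)
        show "D \<in> borel_measurable M"
          by (rule borel_measurable_LIMSEQ_metric[OF mq lim])
        show "integrable M (\<lambda>t. 4 * B t / r)" using B by simp
        show "AE t in M. norm ((f (z0 + Y n) t - f z0 t) / Y n) \<le> 4 * B t / r" for n
        proof (rule AE_I2)
          fix t assume t: "t \<in> space M"
          have "norm (f (z0 + Y n) t - f z0 t) \<le> 4 * B t / r * norm (z0 + Y n - z0)"
            by (rule holomorphic_bounded_diff_le[OF holb[OF t] r(1) _ Yb]) (use bound t r in blast)
          then show "norm ((f (z0 + Y n) t - f z0 t) / Y n) \<le> 4 * B t / r"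
            using Y0[of n] r(1) by (simp add: norm_divide field_simps)
        qed
      qed (use mq lim in auto)
      moreover have "(\<lambda>n. \<integral>t. (f (z0 + Y n) t - f z0 t) / Y n \<partial>M)
          = (\<lambda>n. ((\<integral>t. f (z0 + Y n) t \<partial>M) - (\<integral>t. f z0 t \<partial>M)) / Y n)"
        using int[OF YS] int[OF z0] by simp
      ultimately have "(\<lambda>n. ((\<integral>t. f (z0 + Y n) t \<partial>M) - (\<integral>t. f z0 t \<partial>M)) / Y n) \<longlonglongrightarrow> (\<integral>t. D t \<partial>M)"
        by (rule subst[rotated])
      then have "(\<lambda>n. ((\<integral>t. f (z0 + X (n+N)) t \<partial>M) - (\<integral>t. f z0 t \<partial>M)) / X (n+N)) \<longlonglongrightarrow> (\<integral>t. D t \<partial>M)"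
        unfolding Y_def .
      then show "((\<lambda>h. ((\<integral>t. f (z0 + h) t \<partial>M) - (\<integral>t. f z0 t \<partial>M)) / h) \<circ> X) \<longlonglongrightarrow> (\<integral>t. D t \<partial>M)"
        by (simp only: comp_def) (rule LIMSEQ_offset[of _ N])
    qed
    then show ?thesis unfolding field_differentiable_def DERIV_def by blast
  qed
  then show ?thesis using S by (simp add: holomorphic_on_open field_differentiable_def)
qed

text \<open>Holomorphy is local, so the dominating function may change with the centre; on an
  unbounded domain such as the half plane no single one has to serve.\<close>

lemma holomorphic_on_lebesgue_integral_local:
  fixes f :: "complex \<Rightarrow> 'a \<Rightarrow> complex"
  assumes S: "open S" and meas: "\<And>z. z \<in> S \<Longrightarrow> f z \<in> borel_measurable M"
    and hol: "\<And>t. t \<in> space M \<Longrightarrow> (\<lambda>z. f z t) holomorphic_on S"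
    and bound: "\<And>z0. z0 \<in> S \<Longrightarrow> \<exists>r>0. \<exists>B. integrable M B \<and>
      (\<forall>z\<in>ball z0 r \<inter> S. \<forall>t\<in>space M. norm (f z t) \<le> B t)"
  shows "(\<lambda>z. \<integral>t. f z t \<partial>M) holomorphic_on S"
proof -
  have "(\<lambda>z. \<integral>t. f z t \<partial>M) field_differentiable (at z0)" if z0: "z0 \<in> S" for z0
  proof -
    obtain r B where r: "r > 0" "integrable M B"
      "\<And>z t. z \<in> ball z0 r \<inter> S \<Longrightarrow> t \<in> space M \<Longrightarrow> norm (f z t) \<le> B t" using bound[OF z0] by blast
    have "(\<lambda>z. \<integral>t. f z t \<partial>M) holomorphic_on ball z0 r \<inter> S"
    proof (rule holomorphic_on_lebesgue_integral[where B = B])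
      show "(\<lambda>z. f z t) holomorphic_on ball z0 r \<inter> S" if "t \<in> space M" for t
        using hol[OF that] holomorphic_on_subset by blast
    qed (use r S meas in auto)
    then show ?thesis
      by (rule holomorphic_on_imp_differentiable_at) (use S r z0 in auto)
  qed
  then show ?thesis using S by (simp add: holomorphic_on_open field_differentiable_def)
qed

text \<open>The integral of \<open>h\<close> from 0 to \<open>x\<close>, scaled to the fixed
  interval [0,1]. This treats both signs of \<open>x\<close> at once and lets holomorphy in a
  parameter follow from integration against a fixed measure.\<close>

definition antider :: "(real \<Rightarrow> complex) \<Rightarrow> real \<Rightarrow> complex" where
  "antider h x = of_real x * (\<integral>t. indicator {0..1} t *\<^sub>R h (x * t) \<partial>lborel)"

lemma antider_0 [simp]: "antider h 0 = 0"
  by (simp add: antider_def)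

lemma antider_eq:
  assumes "continuous_on UNIV h"
  shows "antider h x = of_real x * integral {0..1} (\<lambda>t. h (x * t))"
proof -
  have c: "continuous_on {0..1} (\<lambda>t. h (x * t))"
    by (rule continuous_on_compose2[OF assms]) (auto intro!: continuous_intros)
  have "set_integrable lborel {0..1} (\<lambda>t. h (x * t))"
    by (rule borel_integrable_atLeastAtMost'[OF c])
  from set_borel_integral_eq_integral(2)[OF this] show ?thesis
    unfolding antider_def set_lebesgue_integral_def by simp
qed

text \<open>An abstract primitive \<open>F\<close> exists by continuity; the fundamental theorem for
  t -> F(xt) identifies \<open>antider h\<close> with F - F(0).\<close>

lemma has_vector_derivative_antider:
  assumes h: "continuous_on UNIV h"
  shows "(antider h has_vector_derivative h x) (at x)"
proof -
  have "\<exists>F. \<forall>x. -\<infinity> < ereal x \<longrightarrow> ereal x < \<infinity> \<longrightarrow> (F has_vector_derivative h x) (at x)"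
    by (rule einterval_antiderivative) (use h in \<open>auto simp: continuous_on_eq_continuous_at\<close>)
  then obtain F where F: "\<And>x. (F has_vector_derivative h x) (at x)" by auto
  have "antider h y = F y - F 0" for y
  proof -
    have "((\<lambda>t. y *\<^sub>R h (y * t)) has_integral F (y * 1) - F (y * 0)) {0..1}"
    proof (rule fundamental_theorem_of_calculus)
      fix t :: real
      have "((F \<circ> (\<lambda>t. y * t)) has_vector_derivative y *\<^sub>R h (y * t)) (at t)"
        by (rule vector_diff_chain_at) (auto intro!: F derivative_eq_intros simp: has_real_derivative_iff_has_vector_derivative[symmetric])
      then show "((\<lambda>t. F (y * t)) has_vector_derivative y *\<^sub>R h (y * t)) (at t within {0..1})"
        by (auto simp: comp_def intro: has_vector_derivative_at_within)
    qed simp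
    then have "integral {0..1} (\<lambda>t. y *\<^sub>R h (y * t)) = F (y * 1) - F (y * 0)" by (rule integral_unique)
    then have "y *\<^sub>R integral {0..1} (\<lambda>t. h (y * t)) = F y - F 0" by simp
    then show ?thesis unfolding antider_eq[OF h] by (simp only: scaleR_conv_of_real)
  qed
  then have "antider h = (\<lambda>y. F y - F 0)" by auto
  then show ?thesis using F[of x] by (auto intro!: derivative_eq_intros)
qed

lemma continuous_on_antider:
  assumes "continuous_on UNIV h"
  shows "continuous_on S (antider h)"
  by (intro continuous_at_imp_continuous_on ballI
      has_vector_derivative_continuous[OF has_vector_derivative_antider[OF assms]])

text \<open>The divisor \<open>Suc n\<close> gained per integration is the source of the factorials
  in the Picard bounds.\<close>

lemma norm_antider_le:
  assumes h: "continuous_on UNIV h" and b: "\<And>y. \<bar>y\<bar> \<le> X \<Longrightarrow> norm (h y) \<le> B * \<bar>y\<bar> ^ n" and x: "\<bar>x\<bar> \<le> X"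
  shows "norm (antider h x) \<le> B * \<bar>x\<bar> ^ Suc n / real (Suc n)"
proof -
  have I: "((\<lambda>t::real. t ^ n) has_integral (1 ^ Suc n / real (Suc n) - 0 ^ Suc n / real (Suc n))) {0..1}"
  proof (rule fundamental_theorem_of_calculus)
    show "((\<lambda>t. t ^ Suc n / real (Suc n)) has_vector_derivative t ^ n) (at t within {0..1})" for t :: real
      using DERIV_cdivide[OF DERIV_pow[of "Suc n" t "{0..1}"], of "real (Suc n)"]
      by (simp flip: has_real_derivative_iff_has_vector_derivative del: power_Suc)
  qed simp
  then have I': "((\<lambda>t::real. B * \<bar>x\<bar> ^ n * t ^ n) has_integral B * \<bar>x\<bar> ^ n * (1 / real (Suc n))) {0..1}"
    by (intro has_integral_mult_right) simp
  have c: "continuous_on {0..1} (\<lambda>t. h (x * t))"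
    by (rule continuous_on_compose2[OF h]) (auto intro!: continuous_intros)
  have "norm (integral {0..1} (\<lambda>t. h (x * t))) \<le> integral {0..1} (\<lambda>t. B * \<bar>x\<bar> ^ n * t ^ n)"
  proof (rule integral_norm_bound_integral)
    show "(\<lambda>t. h (x * t)) integrable_on {0..1}" by (rule integrable_continuous_real[OF c])
    show "(\<lambda>t::real. B * \<bar>x\<bar> ^ n * t ^ n) integrable_on {0..1}" using I' by blast
    fix t :: real assume t: "t \<in> {0..1}"
    have "\<bar>x\<bar> * t \<le> \<bar>x\<bar> * 1" by (rule mult_left_mono) (use t in auto)
    then have "\<bar>x * t\<bar> \<le> X" using t x by (simp add: abs_mult)
    from b[OF this] show "norm (h (x * t)) \<le> B * \<bar>x\<bar> ^ n * t ^ n"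
      using t by (simp add: abs_mult power_mult_distrib mult.assoc)
  qed
  also have "\<dots> = B * \<bar>x\<bar> ^ n * (1 / real (Suc n))" using I' by (rule integral_unique)
  finally have "\<bar>x\<bar> * norm (integral {0..1} (\<lambda>t. h (x * t))) \<le> \<bar>x\<bar> * (B * \<bar>x\<bar> ^ n * (1 / real (Suc n)))"
    by (rule mult_left_mono) simp
  then show ?thesis unfolding antider_eq[OF h] by (simp add: norm_mult mult_ac)
qed

lemma holomorphic_on_antider:
  assumes S: "open S" and c: "\<And>z. z \<in> S \<Longrightarrow> continuous_on UNIV (h z)"
    and hol: "\<And>y. (\<lambda>z. h z y) holomorphic_on S"
    and b: "\<And>z y. z \<in> S \<Longrightarrow> \<bar>y\<bar> \<le> \<bar>x\<bar> \<Longrightarrow> norm (h z y) \<le> B"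
  shows "(\<lambda>z. antider (h z) x) holomorphic_on S"
  unfolding antider_def
proof (rule holomorphic_on_mult[OF holomorphic_on_const],
    rule holomorphic_on_lebesgue_integral[where f = "\<lambda>z t. indicator {0..1} t *\<^sub>R h z (x * t)"
      and B = "\<lambda>t. indicator {0..1} t *\<^sub>R B"])
  fix z assume z: "z \<in> S"
  have "continuous_on UNIV (\<lambda>t. h z (x * t))"
    by (rule continuous_on_compose2[OF c[OF z]]) (auto intro!: continuous_intros)
  then have "(\<lambda>t. h z (x * t)) \<in> borel_measurable borel" by (rule borel_measurable_continuous_onI)
  then show "(\<lambda>t. indicator {0..1} t *\<^sub>R h z (x * t)) \<in> borel_measurable lborel" by measurable
  fix t :: real
  show "norm (indicator {0..1} t *\<^sub>R h z (x * t)) \<le> indicator {0..1} t *\<^sub>R B"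
    using b[OF z, of "x * t"] by (auto simp: indicator_def abs_mult mult_left_le)
next
  show "(\<lambda>z. indicator {0..1} t *\<^sub>R h z (x * t)) holomorphic_on S" for t
    unfolding scaleR_conv_of_real by (intro holomorphic_intros hol)
  show "integrable lborel (\<lambda>t::real. indicator {0..1} t *\<^sub>R B)" by simp
qed (use S in auto)

text \<open>The Weierstrass test makes the differentiated series converge uniformly on
  \<open>S\<close>. Series indexed by integers are enumerated before this is applied to
  them.\<close>

lemma has_vector_derivative_suminf:
  fixes f f' :: "nat \<Rightarrow> real \<Rightarrow> complex"
  assumes S: "open S" "convex S"
    and d: "\<And>n x. x \<in> S \<Longrightarrow> (f n has_vector_derivative f' n x) (at x)"
    and b: "\<And>n x. x \<in> S \<Longrightarrow> norm (f' n x) \<le> b n" "summable b"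
    and s: "\<And>x. x \<in> S \<Longrightarrow> summable (\<lambda>n. f n x)" and x: "x \<in> S"
  shows "((\<lambda>x. \<Sum>n. f n x) has_vector_derivative (\<Sum>n. f' n x)) (at x)"
proof -
  have ul: "uniform_limit S (\<lambda>n x. \<Sum>i<n. f' i x) (\<lambda>x. \<Sum>i. f' i x) sequentially"
    by (rule Weierstrass_m_test[where M = b]) (use b in auto)
  have 1: "(f n has_derivative (\<lambda>h. h *\<^sub>R f' n x)) (at x within S)" if "x \<in> S" for n x
    using d[OF that, of n] unfolding has_vector_derivative_def by (rule has_derivative_at_withinI)
  have 2: "\<forall>\<^sub>F n in sequentially. \<forall>x\<in>S. \<forall>h. norm ((\<Sum>i<n. h *\<^sub>R f' i x) - h *\<^sub>R (\<Sum>i. f' i x)) \<le> e * norm h"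
    if e: "e > 0" for e
    using uniform_limitD[OF ul e]
  proof (rule eventually_mono, intro ballI allI)
    fix n x and h :: real assume *: "\<forall>x\<in>S. dist (\<Sum>i<n. f' i x) (\<Sum>i. f' i x) < e" "x \<in> S"
    have "norm ((\<Sum>i<n. f' i x) - (\<Sum>i. f' i x)) \<le> e" using *(1)[rule_format, OF *(2)] by (simp add: dist_norm)
    then have **: "\<bar>h\<bar> * norm ((\<Sum>i<n. f' i x) - (\<Sum>i. f' i x)) \<le> \<bar>h\<bar> * e" by (rule mult_left_mono) simp
    have eq: "(\<Sum>i<n. h *\<^sub>R f' i x) - h *\<^sub>R (\<Sum>i. f' i x) = h *\<^sub>R ((\<Sum>i<n. f' i x) - (\<Sum>i. f' i x))"
      by (simp only: scaleR_sum_right scaleR_diff_right)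
    show "norm ((\<Sum>i<n. h *\<^sub>R f' i x) - h *\<^sub>R (\<Sum>i. f' i x)) \<le> e * norm h"
      unfolding eq norm_scaleR real_norm_def mult.commute[of e] by (rule **)
  qed
  obtain g where "\<forall>x\<in>S. (\<lambda>n. f n x) sums g x \<and> (g has_derivative (\<lambda>h. h *\<^sub>R (\<Sum>i. f' i x))) (at x within S)"
    using has_derivative_series[of S f "\<lambda>n x h. h *\<^sub>R f' n x" "\<lambda>x h. h *\<^sub>R (\<Sum>i. f' i x)" x, OF S(2) 1 2 x summable_sums[OF s[OF x]]]
    by blast
  then have g: "\<And>x. x \<in> S \<Longrightarrow> (\<lambda>n. f n x) sums g x"
    "\<And>x. x \<in> S \<Longrightarrow> (g has_derivative (\<lambda>h. h *\<^sub>R (\<Sum>i. f' i x))) (at x within S)" by simp_all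
  have "(g has_derivative (\<lambda>h. h *\<^sub>R (\<Sum>i. f' i x))) (at x)"
    using g(2)[OF x] unfolding at_within_open[OF x S(1)] .
  then have 3: "(g has_vector_derivative (\<Sum>i. f' i x)) (at x)"
    unfolding has_vector_derivative_def .
  have 4: "g y = (\<Sum>n. f n y)" if "y \<in> S" for y
    using sums_unique[OF g(1)[OF that]] .
  show ?thesis
    using has_vector_derivative_transform_within_open[where f = g and g = "\<lambda>x. \<Sum>n. f n x" and S = S, OF 3 S(1) x 4] .
qed

section \<open>Solutions of the Schroedinger equation\<close>

definition schr_sol :: "(real \<Rightarrow> real) \<Rightarrow> complex \<Rightarrow> (real \<Rightarrow> complex) \<Rightarrow> (real \<Rightarrow> complex) \<Rightarrow> bool" where
  "schr_sol V z y y' \<longleftrightarrow> (\<forall>x. (y has_vector_derivative y' x) (at x) \<and>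
     (y' has_vector_derivative (of_real (V x) - z) * y x) (at x))"

text \<open>These are the terms of the Picard series, not its partial sums: term n+1 has zero Cauchy
  data at 0 and second derivative \<open>(V - z)\<close> times term n. The second component of each
  pair is the derivative of the first.\<close>

primrec picard :: "(real \<Rightarrow> real) \<Rightarrow> complex \<Rightarrow> complex \<Rightarrow> complex \<Rightarrow> nat \<Rightarrow> (real \<Rightarrow> complex) \<times> (real \<Rightarrow> complex)" where
  "picard V a b z 0 = ((\<lambda>x. a + b * of_real x), (\<lambda>x. b))"
| "picard V a b z (Suc n) = (let d = antider (\<lambda>x. (of_real (V x) - z) * fst (picard V a b z n) x) in (antider d, d))"

definition ivp :: "(real \<Rightarrow> real) \<Rightarrow> complex \<Rightarrow> complex \<Rightarrow> complex \<Rightarrow> real \<Rightarrow> complex" where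
  "ivp V a b z x = (\<Sum>n. fst (picard V a b z n) x)"

definition ivp' :: "(real \<Rightarrow> real) \<Rightarrow> complex \<Rightarrow> complex \<Rightarrow> complex \<Rightarrow> real \<Rightarrow> complex" where
  "ivp' V a b z x = (\<Sum>n. snd (picard V a b z n) x)"

context
  fixes V :: "real \<Rightarrow> real"
  assumes V: "continuous_on UNIV V"
begin

end

context
  fixes V :: "real \<Rightarrow> real"
  assumes V: "continuous_on UNIV V"
begin

lemma picard_continuous:
  "continuous_on UNIV (fst (picard V a b z n))" "continuous_on UNIV (snd (picard V a b z n))"
proof (induction n)
  case (Suc n)
  { case 1
    show ?case using Suc by (auto simp: Let_def intro!: continuous_on_antider continuous_intros V) }
  { case 2
    show ?case using Suc by (auto simp: Let_def intro!: continuous_on_antider continuous_intros V) }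
qed (auto intro!: continuous_intros)

lemma picard_deriv:
  "(fst (picard V a b z n) has_vector_derivative snd (picard V a b z n) x) (at x)"
  "(snd (picard V a b z n) has_vector_derivative
     (case n of 0 \<Rightarrow> 0 | Suc m \<Rightarrow> (of_real (V x) - z) * fst (picard V a b z m) x)) (at x)"
proof -
  have c: "continuous_on UNIV (\<lambda>x. (of_real (V x) - z) * fst (picard V a b z m) x)" for m
    by (intro continuous_intros V picard_continuous)
  show "(fst (picard V a b z n) has_vector_derivative snd (picard V a b z n) x) (at x)"
    by (cases n) (auto simp: Let_def has_vector_derivative_def scaleR_conv_of_real mult.commute
       intro!: derivative_eq_intros
       has_vector_derivative_antider[unfolded has_vector_derivative_def scaleR_conv_of_real, OF continuous_on_antider, OF c, THEN has_derivative_eq_rhs])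
  show "(snd (picard V a b z n) has_vector_derivative
     (case n of 0 \<Rightarrow> 0 | Suc m \<Rightarrow> (of_real (V x) - z) * fst (picard V a b z m) x)) (at x)"
    by (cases n) (use has_vector_derivative_antider[OF c] in \<open>auto simp: Let_def\<close>)
qed

text \<open>Two integrations per step would allow a factor 1/(2n)!; the second is bounded crudely by
  \<open>X\<close>, since 1/n! already gives convergence. With \<open>X \<ge> 1\<close> one bound
  serves both the value and the derivative.\<close>

lemma picard_bound:
  assumes M: "\<And>x. \<bar>x\<bar> \<le> X \<Longrightarrow> norm (of_real (V x) - z) \<le> M" "M \<ge> 0" and X: "X \<ge> 1" and x: "\<bar>x\<bar> \<le> X"
  shows "norm (fst (picard V a b z n) x) \<le> (norm a + norm b * X) * ((M * X) ^ n * \<bar>x\<bar> ^ n / fact n)"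
    and "norm (snd (picard V a b z n) x) \<le> (norm a + norm b * X) * ((M * X) ^ n * \<bar>x\<bar> ^ n / fact n)"
proof -
  let ?B = "norm a + norm b * X"
  have "norm (fst (picard V a b z n) y) \<le> ?B * ((M * X) ^ n * \<bar>y\<bar> ^ n / fact n) \<and>
        norm (snd (picard V a b z n) y) \<le> ?B * ((M * X) ^ n * \<bar>y\<bar> ^ n / fact n)" if "\<bar>y\<bar> \<le> X" for y
    using that
  proof (induction n arbitrary: y)
    case 0
    have 1: "norm (a + b * of_real y) \<le> norm a + norm b * \<bar>y\<bar>"
      by (rule order_trans[OF norm_triangle_ineq]) (simp add: norm_mult)
    moreover have "norm b * \<bar>y\<bar> \<le> norm b * X" using 0 by (intro mult_left_mono) auto
    moreover have "norm b * 1 \<le> norm b * X" using X by (intro mult_left_mono) auto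
    ultimately show ?case by simp (smt (verit) norm_ge_zero)
  next
    case (Suc n)
    let ?h = "\<lambda>x. (of_real (V x) - z) * fst (picard V a b z n) x"
    let ?C = "?B * M * (M * X) ^ n / fact n"
    have B0: "?B \<ge> 0" using X by auto
    have c: "continuous_on UNIV ?h" by (intro continuous_intros V picard_continuous)
    have h: "norm (?h w) \<le> ?C * \<bar>w\<bar> ^ n" if "\<bar>w\<bar> \<le> X" for w
    proof -
      have "norm (?h w) \<le> M * (?B * ((M * X) ^ n * \<bar>w\<bar> ^ n / fact n))"
        unfolding norm_mult by (intro mult_mono M that conjunct1[OF Suc.IH]) (use M in auto)
      then show ?thesis by (simp add: mult_ac)
    qed
    have d: "norm (antider ?h w) \<le> ?C * \<bar>w\<bar> ^ Suc n / real (Suc n)" if "\<bar>w\<bar> \<le> X" for w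
      by (rule norm_antider_le[OF c h that])
    have d': "norm (antider ?h w) \<le> (?C / real (Suc n)) * \<bar>w\<bar> ^ Suc n" if "\<bar>w\<bar> \<le> X" for w
      using d[OF that] by (simp add: mult_ac)
    have e: "norm (antider (antider ?h) y) \<le> (?C / real (Suc n)) * \<bar>y\<bar> ^ Suc (Suc n) / real (Suc (Suc n))"
      by (rule norm_antider_le[OF continuous_on_antider[OF c] d' Suc.prems])
    have C0: "?C / real (Suc n) \<ge> 0" using B0 M X by (intro divide_nonneg_nonneg mult_nonneg_nonneg) auto
    have eq: "?B * ((M * X) ^ Suc n * \<bar>y\<bar> ^ Suc n / fact (Suc n)) = (?C / real (Suc n)) * \<bar>y\<bar> ^ Suc n * X"
      by (simp add: field_simps)
    have P0: "(?C / real (Suc n)) * \<bar>y\<bar> ^ Suc n \<ge> 0" by (rule mult_nonneg_nonneg[OF C0]) simp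
    have "(?C / real (Suc n)) * \<bar>y\<bar> ^ Suc n * (\<bar>y\<bar> / real (Suc (Suc n))) \<le> (?C / real (Suc n)) * \<bar>y\<bar> ^ Suc n * X"
    proof (rule mult_left_mono[OF _ P0])
      have "\<bar>y\<bar> / real (Suc (Suc n)) \<le> \<bar>y\<bar> / 1" by (rule divide_left_mono) auto
      then show "\<bar>y\<bar> / real (Suc (Suc n)) \<le> X" using Suc.prems by simp
    qed
    with e have 1: "norm (antider (antider ?h) y) \<le> ?B * ((M * X) ^ Suc n * \<bar>y\<bar> ^ Suc n / fact (Suc n))"
      unfolding eq by (simp add: mult_ac)
    have "(?C / real (Suc n)) * \<bar>y\<bar> ^ Suc n * 1 \<le> (?C / real (Suc n)) * \<bar>y\<bar> ^ Suc n * X"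
      by (rule mult_left_mono[OF X P0])
    with d'[OF Suc.prems] have 2: "norm (antider ?h y) \<le> ?B * ((M * X) ^ Suc n * \<bar>y\<bar> ^ Suc n / fact (Suc n))"
      unfolding eq by simp
    show ?case using 1 2 by (simp add: Let_def)
  qed
  from this[OF x] show "norm (fst (picard V a b z n) x) \<le> ?B * ((M * X) ^ n * \<bar>x\<bar> ^ n / fact n)"
    "norm (snd (picard V a b z n) x) \<le> ?B * ((M * X) ^ n * \<bar>x\<bar> ^ n / fact n)" by auto
qed

lemma picard_bound_uniform:
  assumes Z: "Z \<ge> 0" "X \<ge> 1"
  obtains c where "summable c" "\<And>n x z. \<bar>x\<bar> \<le> X \<Longrightarrow> norm z \<le> Z \<Longrightarrow> norm (fst (picard V a b z n) x) \<le> c n"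
    "\<And>n x z. \<bar>x\<bar> \<le> X \<Longrightarrow> norm z \<le> Z \<Longrightarrow> norm (snd (picard V a b z n) x) \<le> c n"
    "\<And>x z::complex. \<bar>x\<bar> \<le> X \<Longrightarrow> norm z \<le> Z \<Longrightarrow> norm (of_real (V x) - z) \<le> c 0"
proof -
  have "compact (V ` {-X..X})" by (intro compact_continuous_image continuous_on_subset[OF V]) auto
  then obtain A where A: "\<And>x. x \<in> {-X..X} \<Longrightarrow> \<bar>V x\<bar> \<le> A"
    unfolding bounded_iff[THEN iffD1, OF compact_imp_bounded] by (force dest!: compact_imp_bounded simp: bounded_iff)
  have A0: "A \<ge> 0" using A[of 0] Z by force
  define M where "M = A + Z"
  have M: "norm (of_real (V x) - z) \<le> M" if "\<bar>x\<bar> \<le> X" "norm z \<le> Z" for x and z :: complex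
  proof -
    have "norm (of_real (V x) - z) \<le> \<bar>V x\<bar> + norm z" using norm_triangle_ineq4[of "of_real (V x)" z] by simp
    moreover have "\<bar>V x\<bar> \<le> A" by (rule A) (use that in auto)
    ultimately show ?thesis using that by (simp add: M_def)
  qed
  have M0: "M \<ge> 0" using A0 Z by (simp add: M_def)
  \<comment> \<open>The extra summand \<open>M\<close> makes \<open>c 0 \<ge> M\<close>, so the same
    sequence also bounds the coefficient \<open>V - z\<close>.\<close>
  let ?B = "norm a + norm b * X + M"
  define c where "c n = ?B * ((M * X * X) ^ n / fact n)" for n
  have "summable (\<lambda>n. (M * X * X) ^ n /\<^sub>R fact n)" by (rule summable_exp_generic)
  then have sc: "summable c" unfolding c_def by (intro summable_mult) (simp add: divide_inverse mult.commute)
  have le: "(norm a + norm b * X) * ((M * X) ^ n * \<bar>x\<bar> ^ n / fact n) \<le> c n" if "\<bar>x\<bar> \<le> X" for n x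
  proof -
    have "(norm a + norm b * X) * ((M * X) ^ n * \<bar>x\<bar> ^ n / fact n) \<le> ?B * ((M * X) ^ n * X ^ n / fact n)"
      using that Z M0 by (intro mult_mono divide_right_mono power_mono) auto
    then show ?thesis by (simp add: c_def power_mult_distrib)
  qed
  have MX: "c 0 \<ge> M" using Z by (simp add: c_def)
  show ?thesis
  proof (rule that[OF sc])
    fix n x and z :: complex assume xz: "\<bar>x\<bar> \<le> X" "norm z \<le> Z"
    note pb = picard_bound[OF M[OF _ xz(2)] M0 Z(2) xz(1)]
    show "norm (fst (picard V a b z n) x) \<le> c n" by (rule order_trans[OF pb(1) le[OF xz(1)]])
    show "norm (snd (picard V a b z n) x) \<le> c n" by (rule order_trans[OF pb(2) le[OF xz(1)]])
    show "norm (of_real (V x) - z) \<le> c 0" by (rule order_trans[OF M[OF xz] MX])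
  qed
qed

lemma ivp_solves: "schr_sol V z (ivp V a b z) (ivp' V a b z)"
  unfolding schr_sol_def
proof (intro allI)
  fix x :: real
  define X where "X = \<bar>x\<bar> + 1"
  have X: "X \<ge> 1" "x \<in> {-X<..<X}" by (auto simp: X_def)
  obtain c where c: "summable c" "\<And>n x. \<bar>x\<bar> \<le> X \<Longrightarrow> norm (fst (picard V a b z n) x) \<le> c n"
    "\<And>n x. \<bar>x\<bar> \<le> X \<Longrightarrow> norm (snd (picard V a b z n) x) \<le> c n"
    "\<And>x. \<bar>x\<bar> \<le> X \<Longrightarrow> norm (of_real (V x) - z) \<le> c 0"
    using picard_bound_uniform[OF norm_ge_zero[of z] X(1), of a b] by (metis order_refl)
  have s1: "summable (\<lambda>n. fst (picard V a b z n) y)" if "\<bar>y\<bar> \<le> X" for y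
    by (rule summable_comparison_test'[OF c(1)]) (use c(2) that in auto)
  have s2: "summable (\<lambda>n. snd (picard V a b z n) y)" if "\<bar>y\<bar> \<le> X" for y
    by (rule summable_comparison_test'[OF c(1)]) (use c(3) that in auto)
  \<comment> \<open>Term n has second derivative \<open>(V - z)\<close> times term n - 1, and 0 for
    the affine initial term; \<open>suminf_split_head\<close> removes this shift below.\<close>
  let ?q = "\<lambda>n y. case n of 0 \<Rightarrow> 0 | Suc m \<Rightarrow> (of_real (V y) - z) * fst (picard V a b z m) y"
  have 1: "((\<lambda>x. \<Sum>n. fst (picard V a b z n) x) has_vector_derivative (\<Sum>n. snd (picard V a b z n) x)) (at x)"
    by (rule has_vector_derivative_suminf[of "{-X<..<X}", OF _ _ _ _ c(1)])
       (use c(3) s1 X picard_deriv in auto)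
  have c0: "c 0 \<ge> 0" using c(4)[of 0] X by (simp add: order_trans[OF norm_ge_zero])
  have sq: "summable (\<lambda>n. case n of 0 \<Rightarrow> 0 | Suc m \<Rightarrow> c 0 * c m)"
    by (subst summable_Suc_iff[symmetric]) (simp add: summable_mult c)
  have 2: "((\<lambda>x. \<Sum>n. snd (picard V a b z n) x) has_vector_derivative (\<Sum>n. ?q n x)) (at x)"
  proof (rule has_vector_derivative_suminf[of "{-X<..<X}", OF _ _ _ _ sq])
    show "norm (?q n y) \<le> (case n of 0 \<Rightarrow> 0 | Suc m \<Rightarrow> c 0 * c m)" if "y \<in> {-X<..<X}" for n y
      using that by (auto split: nat.split simp: norm_mult intro!: mult_mono c c0)
  qed (use s2 X picard_deriv in auto)
  have xX: "\<bar>x\<bar> \<le> X" using X by auto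
  have "summable (\<lambda>n. ?q n x)"
    by (subst summable_Suc_iff[symmetric]) (use s1[OF xX] in \<open>auto intro!: summable_mult\<close>)
  from suminf_split_head[OF this]
  have "(\<Sum>n. ?q n x) = (\<Sum>n. (of_real (V x) - z) * fst (picard V a b z n) x)" by simp
  also have "\<dots> = (of_real (V x) - z) * (\<Sum>n. fst (picard V a b z n) x)"
    by (rule suminf_mult[OF s1[OF xX]])
  finally show "(ivp V a b z has_vector_derivative ivp' V a b z x) (at x) \<and>
      (ivp' V a b z has_vector_derivative (of_real (V x) - z) * ivp V a b z x) (at x)"
    using 1 2 by (simp add: ivp_def[abs_def] ivp'_def[abs_def])
qed

lemma suminf_eq_if0: "(\<Sum>n. if n = 0 then a else 0) = (a :: complex)" for a
  using sums_unique[OF sums_single[of 0 "\<lambda>_. a"]] by simp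

lemma ivp_0: "ivp V a b z 0 = a" "ivp' V a b z 0 = b"
proof -
  have "(\<lambda>n. fst (picard V a b z n) 0) = (\<lambda>n. if n = 0 then a else 0)"
    by (rule ext) (rename_tac n, case_tac n; simp add: Let_def)
  then show "ivp V a b z 0 = a" unfolding ivp_def by (simp add: suminf_eq_if0)
  have "(\<lambda>n. snd (picard V a b z n) 0) = (\<lambda>n. if n = 0 then b else 0)"
    by (rule ext) (rename_tac n, case_tac n; simp add: Let_def)
  then show "ivp' V a b z 0 = b" unfolding ivp'_def by (simp add: suminf_eq_if0)
qed

text \<open>The induction hypothesis is needed at every real point, because the next term integrates
  the previous one from 0 to \<open>x\<close>.\<close>

lemma picard_holomorphic:
  assumes "Z > 0"
  shows "(\<lambda>z. fst (picard V a b z n) x) holomorphic_on ball 0 Z \<and>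
    (\<lambda>z. snd (picard V a b z n) x) holomorphic_on ball 0 Z"
proof (induction n arbitrary: x)
  case (Suc n)
  let ?h = "\<lambda>z x. (of_real (V x) - z) * fst (picard V a b z n) x"
  have hol_h: "(\<lambda>z. ?h z y) holomorphic_on ball 0 Z" for y
    using Suc by (intro holomorphic_intros) auto
  have ch: "continuous_on UNIV (?h z)" for z by (intro continuous_intros V picard_continuous)
  have bd: "\<exists>B. \<forall>(z::complex) y. z \<in> ball 0 Z \<longrightarrow> \<bar>y\<bar> \<le> \<bar>x\<bar> \<longrightarrow> norm (?h z y) \<le> B \<and> norm (antider (?h z) y) \<le> B" for x
  proof -
    have "max \<bar>x\<bar> 1 \<ge> 1" by simp
    from picard_bound_uniform[OF less_imp_le[OF assms] this, of a b]
    obtain c where c: "\<And>n y z. \<bar>y\<bar> \<le> max \<bar>x\<bar> 1 \<Longrightarrow> norm z \<le> Z \<Longrightarrow> norm (fst (picard V a b z n) y) \<le> c n"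
      "\<And>n y z. \<bar>y\<bar> \<le> max \<bar>x\<bar> 1 \<Longrightarrow> norm z \<le> Z \<Longrightarrow> norm (snd (picard V a b z n) y) \<le> c n"
      "\<And>y z. \<bar>y\<bar> \<le> max \<bar>x\<bar> 1 \<Longrightarrow> norm (z::complex) \<le> Z \<Longrightarrow> norm (of_real (V y) - z) \<le> c 0" by metis
    show ?thesis
    proof (intro exI[of _ "max (c 0 * c n) (c (Suc n))"] allI impI conjI)
      fix z :: complex and y assume zy: "z \<in> ball 0 Z" "\<bar>y\<bar> \<le> \<bar>x\<bar>"
      have "norm (?h z y) \<le> c 0 * c n" unfolding norm_mult
      proof (rule mult_mono)
        show n1: "norm (of_real (V y) - z) \<le> c 0" using c(3)[of y z] zy by auto
        show "norm (fst (picard V a b z n) y) \<le> c n" using c(1)[of y z] zy by auto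
        show "0 \<le> c 0" using n1 norm_ge_zero order_trans by blast
      qed simp
      then show "norm (?h z y) \<le> max (c 0 * c n) (c (Suc n))" by simp
      have "norm (antider (?h z) y) \<le> c (Suc n)" using c(2)[of y z "Suc n"] zy by (auto simp: Let_def)
      then show "norm (antider (?h z) y) \<le> max (c 0 * c n) (c (Suc n))" by simp
    qed
  qed
  obtain B where B: "\<And>(z::complex) y. z \<in> ball 0 Z \<Longrightarrow> \<bar>y\<bar> \<le> \<bar>x\<bar> \<Longrightarrow> norm (?h z y) \<le> B \<and> norm (antider (?h z) y) \<le> B"
    using bd[of x] by blast
  have 1: "(\<lambda>z. antider (?h z) y) holomorphic_on ball 0 Z" for y
  proof -
    obtain B where B: "\<And>(z::complex) w. z \<in> ball 0 Z \<Longrightarrow> \<bar>w\<bar> \<le> \<bar>y\<bar> \<Longrightarrow> norm (?h z w) \<le> B \<and> norm (antider (?h z) w) \<le> B"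
      using bd[of y] by blast
    show ?thesis by (rule holomorphic_on_antider[where B = B]) (use ch hol_h B in auto)
  qed
  have "(\<lambda>z. antider (antider (?h z)) x) holomorphic_on ball 0 Z"
    by (rule holomorphic_on_antider[where B = B]) (use continuous_on_antider[OF ch] 1 B in auto)
  with 1 show ?case by (simp add: Let_def)
qed (auto intro!: holomorphic_intros)

lemma ivp_holomorphic:
  "(\<lambda>z. ivp V a b z x) holomorphic_on UNIV" "(\<lambda>z. ivp' V a b z x) holomorphic_on UNIV"
proof -
  have *: "(\<lambda>z. ivp V a b z x) holomorphic_on ball 0 Z \<and> (\<lambda>z. ivp' V a b z x) holomorphic_on ball 0 Z"
    if Z: "Z > 0" for Z
  proof -
    have "max \<bar>x\<bar> 1 \<ge> 1" by simp
    from picard_bound_uniform[OF less_imp_le[OF Z] this, of a b]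
    obtain c where sc: "summable c"
      and c: "\<And>n y z. \<bar>y\<bar> \<le> max \<bar>x\<bar> 1 \<Longrightarrow> norm z \<le> Z \<Longrightarrow> norm (fst (picard V a b z n) y) \<le> c n"
      "\<And>n y z. \<bar>y\<bar> \<le> max \<bar>x\<bar> 1 \<Longrightarrow> norm z \<le> Z \<Longrightarrow> norm (snd (picard V a b z n) y) \<le> c n" by metis
    have lim: "f holomorphic_on ball 0 Z"
      if h: "\<And>n. (\<lambda>z. g z n) holomorphic_on ball 0 Z" and g: "\<And>n (z::complex). norm z \<le> Z \<Longrightarrow> norm (g z n) \<le> c n"
        and f: "\<And>z. f z = (\<Sum>n. g z n)"
      for f :: "complex \<Rightarrow> complex" and g :: "complex \<Rightarrow> nat \<Rightarrow> complex"
    proof (rule holomorphic_uniform_sequence[OF open_ball])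
      show "(\<lambda>z. \<Sum>i<n. g z i) holomorphic_on ball 0 Z" for n by (intro holomorphic_intros h)
      fix w :: complex assume "w \<in> ball 0 Z"
      then obtain d where d: "d > 0" "cball w d \<subseteq> ball 0 Z" using open_contains_cball[of "ball 0 Z"] by blast
      have "uniform_limit (cball w d) (\<lambda>n z. \<Sum>i<n. g z i) (\<lambda>z. \<Sum>i. g z i) sequentially"
      proof (rule Weierstrass_m_test[where M = c])
        fix n and z :: complex assume "z \<in> cball w d"
        then have "z \<in> ball 0 Z" using d by blast
        then show "norm (g z n) \<le> c n" using g by simp
      qed (rule sc)
      then show "\<exists>d>0. cball w d \<subseteq> ball 0 Z \<and> uniform_limit (cball w d) (\<lambda>n z. \<Sum>i<n. g z i) f sequentially"
        using d unfolding f[symmetric] by blast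
    qed
    show ?thesis
    proof
      show "(\<lambda>z. ivp V a b z x) holomorphic_on ball 0 Z"
        by (rule lim[where g = "\<lambda>z n. fst (picard V a b z n) x"]) (use picard_holomorphic[OF Z] c in \<open>auto simp: ivp_def\<close>)
      show "(\<lambda>z. ivp' V a b z x) holomorphic_on ball 0 Z"
        by (rule lim[where g = "\<lambda>z n. snd (picard V a b z n) x"]) (use picard_holomorphic[OF Z] c in \<open>auto simp: ivp'_def\<close>)
    qed
  qed
  have U: "(UNIV :: complex set) = (\<Union>Z\<in>{0<..}. ball 0 Z)"
  proof -
    have "z \<in> (\<Union>Z\<in>{0<..}. ball 0 Z)" for z :: complex
      by (rule UN_I[of "norm z + 1"]) (auto simp: add_nonneg_pos)
    then show ?thesis by blast
  qed
  show "(\<lambda>z. ivp V a b z x) holomorphic_on UNIV" "(\<lambda>z. ivp' V a b z x) holomorphic_on UNIV"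
    unfolding U by (rule holomorphic_on_UN_open; use * in auto)+
qed

lemma ivp_bounded: "\<exists>B. \<forall>x z. \<bar>x\<bar> \<le> X \<longrightarrow> norm z \<le> Z \<longrightarrow> norm (ivp V a b z x) \<le> B"
proof -
  obtain c where sc: "summable c"
    and c: "\<And>n y z. \<bar>y\<bar> \<le> max X 1 \<Longrightarrow> norm z \<le> max Z 0 \<Longrightarrow> norm (fst (picard V a b z n) y) \<le> c n"
    using picard_bound_uniform[of "max Z 0" "max X 1" a b] by (metis max.cobounded2)
  have "norm (ivp V a b z x) \<le> suminf c" if "\<bar>x\<bar> \<le> X" "norm z \<le> Z" for x z
    unfolding ivp_def by (rule norm_suminf_le[OF _ sc]) (use c that in auto)
  then show ?thesis by blast
qed

end

section \<open>Wronskians and solutions with given Cauchy data at 0\<close>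

lemma schr_sol_lincomb:
  assumes "schr_sol V z y y'" "schr_sol V z w w'"
  shows "schr_sol V z (\<lambda>x. a * y x + b * w x) (\<lambda>x. a * y' x + b * w' x)"
  using assms unfolding schr_sol_def
  by (auto intro!: has_vector_derivative_eq_rhs[OF has_vector_derivative_add[OF has_vector_derivative_mult_right has_vector_derivative_mult_right]] simp: algebra_simps)

lemma wronskian_const:
  assumes "schr_sol V z y y'" "schr_sol V z w w'"
  shows "y x * w' x - y' x * w x = y 0 * w' 0 - y' 0 * w 0"
proof -
  have d: "((\<lambda>x. y x * w' x - y' x * w x) has_vector_derivative 0) (at x)" for x
    using assms unfolding schr_sol_def
    by (auto intro!: has_vector_derivative_eq_rhs[OF has_vector_derivative_diff[OF has_vector_derivative_mult has_vector_derivative_mult]] simp: algebra_simps)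
  obtain c where "\<And>x. x \<in> UNIV \<Longrightarrow> y x * w' x - y' x * w x = c"
    by (rule has_vector_derivative_zero_constant[OF convex_UNIV]) (use d in auto)
  then show ?thesis by simp
qed

text \<open>The solution with Cauchy data \<open>(a, b)\<close> at 0, written in a fixed fundamental
  system: \<open>a\<close> and \<open>b\<close> may then themselves be holomorphic functions of
  \<open>z\<close>.\<close>

definition csol :: "(real \<Rightarrow> real) \<Rightarrow> complex \<Rightarrow> complex \<Rightarrow> complex \<Rightarrow> real \<Rightarrow> complex" where
  "csol V a b z x = a * ivp V 1 0 z x + b * ivp V 0 1 z x"

definition csol' :: "(real \<Rightarrow> real) \<Rightarrow> complex \<Rightarrow> complex \<Rightarrow> complex \<Rightarrow> real \<Rightarrow> complex" where
  "csol' V a b z x = a * ivp' V 1 0 z x + b * ivp' V 0 1 z x"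

text \<open>Square integrability at \<open>+\<infinity>\<close> only. The left end is treated by
  applying this to the reflected function.\<close>

definition L2_right :: "(real \<Rightarrow> complex) \<Rightarrow> bool" where
  "L2_right y \<longleftrightarrow> integrable lborel (\<lambda>x. indicator {0..} x * (norm (y x))\<^sup>2)"

lemma schr_sol_continuous:
  assumes "schr_sol V z y y'"
  shows "continuous_on S y" "continuous_on S y'"
  using assms unfolding schr_sol_def
  by (meson continuous_at_imp_continuous_on has_vector_derivative_continuous)+

lemma schr_sol_csol:
  assumes "continuous_on UNIV V"
  shows "schr_sol V z (csol V a b z) (csol' V a b z)"
  using schr_sol_lincomb[OF ivp_solves[OF assms] ivp_solves[OF assms]]
  unfolding csol_def[abs_def] csol'_def[abs_def] .

lemma csol_0:
  assumes "continuous_on UNIV V"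
  shows "csol V a b z 0 = a" "csol' V a b z 0 = b"
  using ivp_0[OF assms] by (auto simp: csol_def csol'_def)

lemma ivp_wronskian:
  assumes "continuous_on UNIV V"
  shows "ivp V 1 0 z x * ivp' V 0 1 z x - ivp' V 1 0 z x * ivp V 0 1 z x = 1"
  using wronskian_const[OF ivp_solves[OF assms, of z 1 0] ivp_solves[OF assms, of z 0 1], of x] ivp_0[OF assms] by simp

text \<open>As \<open>V\<close> is real, \<open>(V - z) |y|^2\<close> has imaginary part
  \<open>- Im z |y|^2\<close>, and \<open>y' cnj y'\<close> is real. For Im z > 0 the quantity is
  therefore monotone along every solution.\<close>

lemma energy_deriv:
  assumes "schr_sol V z y y'"
  shows "((\<lambda>x. - Im (y' x * cnj (y x))) has_real_derivative Im z * (norm (y x))\<^sup>2) (at x)"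
proof -
  have y: "(y has_vector_derivative y' x) (at x)" "(y' has_vector_derivative (of_real (V x) - z) * y x) (at x)"
    using assms by (auto simp: schr_sol_def)
  have "((\<lambda>x. y' x * cnj (y x)) has_vector_derivative
      y' x * cnj (y' x) + (of_real (V x) - z) * y x * cnj (y x)) (at x)"
    by (rule has_vector_derivative_mult[OF y(2) bounded_linear.has_vector_derivative[OF bounded_linear_cnj y(1)]])
  from has_vector_derivative_minus[OF bounded_linear.has_vector_derivative[OF bounded_linear_Im this]]
  have "((\<lambda>x. - Im (y' x * cnj (y x))) has_vector_derivative
      - Im (y' x * cnj (y' x) + (of_real (V x) - z) * y x * cnj (y x))) (at x)" .
  moreover have "- Im (y' x * cnj (y' x) + (of_real (V x) - z) * y x * cnj (y x)) = Im z * (norm (y x))\<^sup>2"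
  proof -
    have "y' x * cnj (y' x) = of_real ((norm (y' x))\<^sup>2)" "y x * cnj (y x) = of_real ((norm (y x))\<^sup>2)"
      by (simp_all only: complex_norm_square)
    then show ?thesis by (simp only: mult.assoc) simp
  qed
  ultimately show ?thesis by (simp add: has_real_derivative_iff_has_vector_derivative)
qed

lemma nn_integral_energy:
  assumes y: "schr_sol V z y y'" and z: "Im z \<ge> 0" and ab: "a \<le> b"
  shows "(\<integral>\<^sup>+x. ennreal (Im z * (norm (y x))\<^sup>2) * indicator {a..b} x \<partial>lborel)
    = ennreal (Im (y' a * cnj (y a)) - Im (y' b * cnj (y b)))"
proof -
  have "continuous_on UNIV (\<lambda>x. Im z * (norm (y x))\<^sup>2)"
    by (intro continuous_intros schr_sol_continuous[OF y])
  then have m: "(\<lambda>x. Im z * (norm (y x))\<^sup>2) \<in> borel_measurable borel" by (rule borel_measurable_continuous_onI)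
  have "(\<integral>\<^sup>+x. ennreal (Im z * (norm (y x))\<^sup>2) * indicator {a..b} x \<partial>lborel)
    = ennreal (- Im (y' b * cnj (y b)) - - Im (y' a * cnj (y a)))"
    by (rule nn_integral_FTC_Icc[OF m energy_deriv[OF y] _ ab]) (use z in auto)
  then show ?thesis by (simp add: algebra_simps)
qed

text \<open>The solution with \<open>y'(n) = \<i> y(n)\<close> has Cauchy data \<open>(P\<^sub>n, Q\<^sub>n)\<close> at \<open>0\<close>. The energy identity puts
  \<open>Q\<^sub>n / P\<^sub>n\<close> into the upper half plane, so its Cayley transform \<open>c\<^sub>n\<close> is bounded by \<open>1\<close>, and the
  Weyl solution is a locally uniform limit of a subsequence (Montel).\<close>

lemma weyl_solution:
  assumes V: "continuous_on UNIV V"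
  obtains p q where "p holomorphic_on {z. Im z > 0}" "q holomorphic_on {z. Im z > 0}"
    "\<And>z. Im z > 0 \<Longrightarrow> p z \<noteq> 0 \<or> q z \<noteq> 0"
    "\<And>z. Im z > 0 \<Longrightarrow> L2_right (csol V (p z) (q z) z)"
proof -
  let ?H = "{z. Im z > 0}"
  \<comment> \<open>Cramer's rule for a fundamental matrix of determinant 1: these are the data at 0
    of the solution with value 1 and derivative \<i> at \<open>n\<close>.\<close>
  define P where "P n z = ivp' V 0 1 z (real n) - \<i> * ivp V 0 1 z (real n)" for n z
  define Q where "Q n z = \<i> * ivp V 1 0 z (real n) - ivp' V 1 0 z (real n)" for n z
  define c where "c n z = (Q n z - \<i> * P n z) / (Q n z + \<i> * P n z)" for n z
  have endpt: "csol V (P n z) (Q n z) z (real n) = 1" "csol' V (P n z) (Q n z) z (real n) = \<i>" for n z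
    using ivp_wronskian[OF V, of z "real n"] by (auto simp: csol_def csol'_def P_def Q_def algebra_simps)
  \<comment> \<open>At \<open>n\<close> the quantity Im (y' cnj y) equals 1, and by the energy
    identity it can only grow on the way back to 0.\<close>
  have QP: "Im (Q n z * cnj (P n z)) \<ge> 1" if z: "z \<in> ?H" for n z
  proof -
    show ?thesis
    proof (rule ccontr)
      assume neg: "\<not> ?thesis"
      define F where "F x = - Im (csol' V (P n z) (Q n z) z x * cnj (csol V (P n z) (Q n z) z x))" for x
      have "F 0 \<le> F (real n)"
      proof (rule DERIV_nonneg_imp_nondecreasing[where f = F and a = 0 and b = "real n"])
        show "\<exists>D. (F has_real_derivative D) (at x) \<and> 0 \<le> D" for x
          using energy_deriv[OF schr_sol_csol[OF V, of z "P n z" "Q n z"], of x] z unfolding F_def[abs_def]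
          by (auto intro!: exI[of _ "Im z * (norm (csol V (P n z) (Q n z) z x))\<^sup>2"])
      qed simp
      then show False using neg by (simp add: F_def csol_0[OF V] endpt)
    qed
  qed
  have nsq: "(norm (Q n z + \<i> * P n z))\<^sup>2 - (norm (Q n z - \<i> * P n z))\<^sup>2 = 4 * Im (Q n z * cnj (P n z))" for n z
    unfolding cmod_power2 by (simp add: power2_eq_square algebra_simps)
  have den: "Q n z + \<i> * P n z \<noteq> 0" if z: "z \<in> ?H" for n z
  proof
    assume "Q n z + \<i> * P n z = 0"
    then have "0 \<ge> 4 * Im (Q n z * cnj (P n z))" using nsq[of n z] by (smt (verit) norm_zero power2_less_eq_zero_iff zero_le_power2 zero_power2)
    with QP[OF z, of n] show False by simp
  qed
  have c1: "norm (c n z) \<le> 1" if z: "z \<in> ?H" for n z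
  proof -
    have "(norm (Q n z - \<i> * P n z))\<^sup>2 \<le> (norm (Q n z + \<i> * P n z))\<^sup>2"
      using nsq[of n z] QP[OF z, of n] by linarith
    then have "norm (Q n z - \<i> * P n z) \<le> norm (Q n z + \<i> * P n z)" by (simp add: power2_le_iff_abs_le)
    then show ?thesis using den[OF z, of n] by (simp add: c_def norm_divide)
  qed
  have holc: "c n holomorphic_on ?H" for n
    unfolding c_def[abs_def] P_def Q_def
    by (intro holomorphic_intros holomorphic_on_subset[OF ivp_holomorphic(1)[OF V]] holomorphic_on_subset[OF ivp_holomorphic(2)[OF V]])
       (use den in \<open>auto simp: P_def Q_def\<close>)
  obtain g r where g: "g holomorphic_on ?H" "strict_mono r" "\<And>z. z \<in> ?H \<Longrightarrow> (\<lambda>n. c (r n) z) \<longlonglongrightarrow> g z"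
  proof (rule Montel[of ?H "range c" c])
    show "open ?H" by (rule open_halfspace_Im_gt)
    show "\<exists>B. \<forall>h\<in>range c. \<forall>z\<in>K. cmod (h z) \<le> B" if "compact K" "K \<subseteq> ?H" for K
      using c1 that by (intro exI[of _ 1]) blast
  qed (use holc in auto)
  \<comment> \<open>Inverse Cayley transform, normalised so that
    \<open>q z + \<i> * p z = 1\<close>; hence the limiting data cannot vanish
    simultaneously.\<close>
  define p q where "p z = (1 - g z) / (2 * \<i>)" and "q z = (1 + g z) / 2" for z
  define pn qn where "pn n z = (1 - c n z) / (2 * \<i>)" and "qn n z = (1 + c n z) / 2" for n z
  have pn_eq: "pn n z = P n z / (Q n z + \<i> * P n z)" "qn n z = Q n z / (Q n z + \<i> * P n z)" if "z \<in> ?H" for n z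
  proof -
    define d where "d = Q n z + \<i> * P n z"
    have d0: "d \<noteq> 0" using den[OF that, of n] by (simp add: d_def)
    have Q: "Q n z = d - \<i> * P n z" by (simp add: d_def)
    have c: "c n z = 1 - 2 * \<i> * (P n z / d)" using d0 by (simp add: c_def Q diff_divide_distrib)
    have "pn n z = P n z / d" by (simp add: pn_def c)
    moreover have "qn n z = Q n z / d" using d0 by (simp add: qn_def c Q diff_divide_distrib)
    ultimately show "pn n z = P n z / (Q n z + \<i> * P n z)" "qn n z = Q n z / (Q n z + \<i> * P n z)"
      by (simp_all only: d_def)
  qed
  show ?thesis
  proof
    show "p holomorphic_on ?H" "q holomorphic_on ?H" unfolding p_def q_def by (auto intro!: holomorphic_intros g)
    show "p z \<noteq> 0 \<or> q z \<noteq> 0" for z by (auto simp: p_def q_def)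
    fix z assume z: "Im z > 0"
    then have zH: "z \<in> ?H" by simp
    let ?yn = "\<lambda>n. csol V (pn (r n) z) (qn (r n) z) z" and ?y = "csol V (p z) (q z) z"
    have lim: "(\<lambda>n. ?yn n x) \<longlonglongrightarrow> ?y x" for x
      unfolding csol_def pn_def qn_def p_def q_def by (intro tendsto_intros g(3)[OF zH]) auto
    \<comment> \<open>The energy over \<open>{0..real (r n)}\<close> is at most the boundary term Im
      (q cnj p) at 0, which is bounded by 1 whatever \<open>n\<close> is. Fatou's lemma then carries
      the bound to the limit.\<close>
    have bn: "(\<integral>\<^sup>+x. ennreal (Im z * (norm (?yn n x))\<^sup>2) * indicator {0..real (r n)} x \<partial>lborel) \<le> ennreal 1" for n
    proof -
      let ?d = "Q (r n) z + \<i> * P (r n) z"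
      have e: "csol V (pn (r n) z) (qn (r n) z) z (real (r n)) = 1 / ?d"
        "csol' V (pn (r n) z) (qn (r n) z) z (real (r n)) = \<i> / ?d"
        using endpt[of "r n" z] unfolding pn_eq[OF zH] csol_def csol'_def
        by (simp_all only: times_divide_eq_left add_divide_distrib[symmetric])
      have "\<i> / ?d * cnj (1 / ?d) = \<i> * of_real ((norm (1 / ?d))\<^sup>2)"
        by (simp only: complex_norm_square) simp
      then have i1: "Im (\<i> / ?d * cnj (1 / ?d)) = (norm (1 / ?d))\<^sup>2"
        by (simp only:) simp
      have "norm (pn (r n) z) \<le> 1" "norm (qn (r n) z) \<le> 1"
        using c1[OF zH, of "r n"] norm_triangle_ineq4[of 1 "c (r n) z"] norm_triangle_ineq[of 1 "c (r n) z"]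
        by (auto simp: pn_def qn_def norm_divide norm_mult)
      then have "norm (qn (r n) z * cnj (pn (r n) z)) \<le> 1"
        by (simp add: norm_mult mult_le_one)
      then have i2: "Im (qn (r n) z * cnj (pn (r n) z)) \<le> 1"
        using abs_Im_le_cmod order_trans abs_le_D1 by blast
      have "(\<integral>\<^sup>+x. ennreal (Im z * (norm (?yn n x))\<^sup>2) * indicator {0..real (r n)} x \<partial>lborel)
        = ennreal (Im (qn (r n) z * cnj (pn (r n) z)) - Im (\<i> / ?d * cnj (1 / ?d)))"
        using nn_integral_energy[OF schr_sol_csol[OF V, of z "pn (r n) z" "qn (r n) z"], of 0 "real (r n)"] z
        unfolding csol_0[OF V] e by simp
      also have "\<dots> \<le> ennreal 1" unfolding i1 using i2 by (intro ennreal_leI) (smt (verit) zero_le_power2)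
      finally show ?thesis .
    qed
    have cy: "continuous_on UNIV (csol V a b z)" for a b by (rule schr_sol_continuous[OF schr_sol_csol[OF V]])
    have my[measurable]: "csol V a b z \<in> borel_measurable borel" for a b
      by (rule borel_measurable_continuous_onI[OF cy])
    have pw: "(\<lambda>n. ennreal (Im z * (norm (?yn n x))\<^sup>2) * indicator {0..real (r n)} x)
        \<longlonglongrightarrow> ennreal (Im z * (norm (?y x))\<^sup>2) * indicator {0..} x" for x
    proof (cases "x \<ge> 0")
      case True
      have "filterlim r at_top sequentially" by (rule filterlim_subseq[OF g(2)])
      then have "filterlim (\<lambda>n. real (r n)) at_top sequentially"
        by (rule filterlim_compose[OF filterlim_real_sequentially])
      then have "\<forall>\<^sub>F n in sequentially. x \<le> real (r n)" by (simp add: filterlim_at_top)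
      then have ev: "\<forall>\<^sub>F n in sequentially. ennreal (Im z * (norm (?yn n x))\<^sup>2) * indicator {0..real (r n)} x
          = ennreal (Im z * (norm (?yn n x))\<^sup>2)"
        by eventually_elim (use True in auto)
      have "(\<lambda>n. ennreal (Im z * (norm (?yn n x))\<^sup>2)) \<longlonglongrightarrow> ennreal (Im z * (norm (?y x))\<^sup>2)"
        by (intro tendsto_intros lim tendsto_ennrealI)
      then show ?thesis using True by (simp add: tendsto_cong[OF ev])
    qed simp
    have "(\<integral>\<^sup>+x. ennreal (Im z * (norm (?y x))\<^sup>2) * indicator {0..} x \<partial>lborel)
       = (\<integral>\<^sup>+x. liminf (\<lambda>n. ennreal (Im z * (norm (?yn n x))\<^sup>2) * indicator {0..real (r n)} x) \<partial>lborel)"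
      using lim_imp_Liminf[OF _ pw] by (simp add: sequentially_bot)
    also have "\<dots> \<le> liminf (\<lambda>n. \<integral>\<^sup>+x. ennreal (Im z * (norm (?yn n x))\<^sup>2) * indicator {0..real (r n)} x \<partial>lborel)"
      by (rule nn_integral_liminf) measurable
    also have "\<dots> \<le> liminf (\<lambda>n. ennreal 1)" by (intro Liminf_mono always_eventually allI bn)
    also have "\<dots> = ennreal 1" by (simp add: Liminf_const)
    finally have "(\<integral>\<^sup>+x. ennreal (Im z * (norm (?y x))\<^sup>2) * indicator {0..} x \<partial>lborel) < \<infinity>"
      by (rule order.strict_trans1) simp
    also have "(\<lambda>x. ennreal (Im z * (norm (?y x))\<^sup>2) * indicator {0..} x)
        = (\<lambda>x. ennreal (norm (Im z * (indicator {0..} x * (norm (?y x))\<^sup>2))))"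
      using z by (intro ext) (auto simp: indicator_def)
    finally have "integrable lborel (\<lambda>x. Im z * (indicator {0..} x * (norm (?y x))\<^sup>2))"
      by (intro integrableI_bounded) auto
    then show "L2_right ?y" using z unfolding L2_right_def by simp
  qed
qed

section \<open>Integration along rays\<close>

lemma integrable_exp_decay:
  fixes b :: real
  assumes "b > 0"
  shows "integrable lborel (\<lambda>t. indicator {0..} t * exp (- b * t))"
    "(\<integral>t. indicator {0..} t * exp (- b * t) \<partial>lborel) = 1 / b"
proof -
  have "(\<integral>\<^sup>+t. ennreal (exp (- b * t)) * indicator {0..} t \<partial>lborel) = ennreal (0 - (- exp (- b * 0) / b))"
  proof (rule nn_integral_FTC_atLeast)
    show "((\<lambda>t. - exp (- b * t) / b) has_real_derivative exp (- b * t)) (at t)" for t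
      using assms by (auto intro!: derivative_eq_intros)
    have "((\<lambda>t. - exp (- (b * t)) / b) \<longlongrightarrow> - 0 / b) at_top"
      by (intro tendsto_intros filterlim_compose[OF exp_at_bot] filterlim_compose[OF filterlim_uminus_at_bot_at_top]
            filterlim_tendsto_pos_mult_at_top[OF tendsto_const assms] filterlim_ident) (use assms in auto)
    then show "((\<lambda>t. - exp (- b * t) / b) \<longlongrightarrow> 0) at_top" by simp
  qed auto
  also have "(\<lambda>t. ennreal (exp (- b * t)) * indicator {0..} t) = (\<lambda>t. ennreal (indicator {0..} t * exp (- b * t)))"
    by (auto simp: indicator_def)
  finally have *: "(\<integral>\<^sup>+t. ennreal (indicator {0..} t * exp (- b * t)) \<partial>lborel) = ennreal (1 / b)" by simp
  have "has_bochner_integral lborel (\<lambda>t. indicator {0..} t * exp (- b * t)) (1 / b)"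
    by (rule has_bochner_integral_nn_integral[OF _ _ _ *]) (use assms in \<open>auto simp: indicator_def\<close>)
  then show "integrable lborel (\<lambda>t. indicator {0..} t * exp (- b * t))"
    "(\<integral>t. indicator {0..} t * exp (- b * t) \<partial>lborel) = 1 / b"
    by (auto simp: has_bochner_integral_iff)
qed

text \<open>With s = x + d t this is minus the integral of exp(\<i> a (s - x)) F(s) from x to
  infinity in direction \<open>d\<close>: for bounded \<open>F\<close>, a bounded solution of u' +
  \<i> a u = F. The kernel decays when \<open>Im (a * d) > 0\<close>.\<close>

definition ray_int :: "complex \<Rightarrow> complex \<Rightarrow> (complex \<Rightarrow> complex) \<Rightarrow> complex \<Rightarrow> complex" where
  "ray_int d a F x = - d * (\<integral>t. indicator {0..} t *\<^sub>R (exp (\<i> * a * d * of_real t) * F (x + d * of_real t)) \<partial>lborel)"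

locale ray_domain =
  fixes S :: "complex set" and d :: complex
  assumes open_S: "open S" and ray: "\<And>x t. x \<in> S \<Longrightarrow> t \<ge> 0 \<Longrightarrow> x + d * complex_of_real t \<in> S"
begin

lemma ray_measurable:
  assumes "continuous_on S F" "x \<in> S"
  shows "(\<lambda>t. indicator {0..} t *\<^sub>R (exp (\<i> * a * d * of_real t) * F (x + d * of_real t))) \<in> borel_measurable lborel"
proof -
  have "continuous_on {0..} (\<lambda>t. exp (\<i> * a * d * of_real t) * F (x + d * of_real t))"
    by (intro continuous_intros continuous_on_compose2[OF assms(1)]) (use ray assms(2) in auto)
  then show ?thesis
    by (subst measurable_lborel2, intro borel_measurable_continuous_on_indicator) auto
qed

lemma ray_norm_le:
  assumes "x \<in> S" "\<And>y. y \<in> S \<Longrightarrow> norm (F y) \<le> B" "Im (a * d) \<ge> b"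
  shows "norm (indicator {0..} t *\<^sub>R (exp (\<i> * a * d * of_real t) * F (x + d * of_real t)))
    \<le> (indicator {0..} t * exp (- b * t)) * B"
proof (cases "t \<ge> 0")
  case True
  have "Re (\<i> * a * d * of_real t) = - Im (a * d) * t" by (simp add: algebra_simps)
  also have "\<dots> \<le> - b * t" using mult_right_mono[OF assms(3) True] by (simp only: mult_minus_left neg_le_iff_le)
  finally have "norm (exp (\<i> * a * d * of_real t)) \<le> exp (- b * t)" by simp
  then show ?thesis using True assms(1,2) ray[OF assms(1) True] by (simp add: norm_mult mult_mono)
qed simp

lemma ray_integrable:
  assumes "continuous_on S F" "x \<in> S" "\<And>y. y \<in> S \<Longrightarrow> norm (F y) \<le> B" "Im (a * d) \<ge> b" "b > 0"
  shows "integrable lborel (\<lambda>t. indicator {0..} t *\<^sub>R (exp (\<i> * a * d * of_real t) * F (x + d * of_real t)))"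
proof (rule Bochner_Integration.integrable_bound[OF _ ray_measurable[OF assms(1,2)]])
  show "integrable lborel (\<lambda>t. (indicator {0..} t * exp (- b * t)) * B)"
    by (rule integrable_mult_left[OF integrable_exp_decay(1)[OF assms(5)]])
  show "AE t in lborel. norm (indicator {0..} t *\<^sub>R (exp (\<i> * a * d * of_real t) * F (x + d * of_real t)))
    \<le> norm ((indicator {0..} t * exp (- b * t)) * B)"
    by (rule AE_I2, rule order_trans[OF ray_norm_le[OF assms(2,3,4)]]) (simp_all only: real_norm_def abs_ge_self)
qed

text \<open>The exponential alone supplies convergence: a merely bounded \<open>F\<close> is enough,
  so potentials with arbitrarily slow decay are admissible.\<close>

lemma norm_ray_int_le:
  assumes "continuous_on S F" "x \<in> S" "\<And>y. y \<in> S \<Longrightarrow> norm (F y) \<le> B" "Im (a * d) \<ge> b" "b > 0"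
  shows "norm (ray_int d a F x) \<le> norm d / b * B"
proof -
  let ?f = "\<lambda>t. indicator {0..} t *\<^sub>R (exp (\<i> * a * d * of_real t) * F (x + d * of_real t))"
    and ?g = "\<lambda>t. (indicator {0..} t * exp (- b * t)) * B"
  have g: "integrable lborel ?g" by (rule integrable_mult_left[OF integrable_exp_decay(1)[OF assms(5)]])
  have f: "integrable lborel ?f" by (rule ray_integrable) (use assms in auto)
  have "norm (?f t) \<le> ?g t" for t by (rule ray_norm_le) (use assms in auto)
  then have "norm (integral\<^sup>L lborel ?f) \<le> integral\<^sup>L lborel ?g"
    using Bochner_Integration.integral_norm_bound_integral[OF f g] by blast
  also have "\<dots> = 1 / b * B" using integrable_exp_decay[OF assms(5)] by simp
  finally have "norm d * norm (\<integral>t. indicator {0..} t *\<^sub>R (exp (\<i> * a * d * of_real t) * F (x + d * of_real t)) \<partial>lborel)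
    \<le> norm d * (1 / b * B)" by (rule mult_left_mono) simp
  then show ?thesis by (simp add: ray_int_def norm_mult)
qed

lemma ray_int_diff:
  assumes "continuous_on S F" "continuous_on S G" "x \<in> S" "\<And>y. y \<in> S \<Longrightarrow> norm (F y) \<le> B"
    "\<And>y. y \<in> S \<Longrightarrow> norm (G y) \<le> C" "Im (a * d) \<ge> b" "b > 0"
  shows "ray_int d a F x - ray_int d a G x = ray_int d a (\<lambda>y. F y - G y) x"
  unfolding ray_int_def
  using ray_integrable[OF assms(1,3,4,6,7)] ray_integrable[OF assms(2,3,5,6,7)]
  by (simp add: algebra_simps)

lemma ray_int_holomorphic:
  assumes F: "F holomorphic_on S" "\<And>y. y \<in> S \<Longrightarrow> norm (F y) \<le> B" "Im (a * d) \<ge> b" "b > 0"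
  shows "ray_int d a F holomorphic_on S"
  unfolding ray_int_def[abs_def]
proof (rule holomorphic_on_mult[OF holomorphic_on_const],
    rule holomorphic_on_lebesgue_integral[where f = "\<lambda>x t. indicator {0..} t *\<^sub>R (exp (\<i> * a * d * of_real t) * F (x + d * of_real t))"
      and B = "\<lambda>t. (indicator {0..} t * exp (- b * t)) * B"])
  fix t :: real
  show "(\<lambda>x. indicator {0..} t *\<^sub>R (exp (\<i> * a * d * of_real t) * F (x + d * of_real t))) holomorphic_on S"
  proof (cases "t \<ge> 0")
    case True
    then have "(\<lambda>x. x + d * of_real t) ` S \<subseteq> S" using ray by auto
    then have "(F \<circ> (\<lambda>x. x + d * of_real t)) holomorphic_on S"
      by (intro holomorphic_on_compose_gen[OF _ F(1)] holomorphic_intros) auto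
    then show ?thesis unfolding scaleR_conv_of_real comp_def by (intro holomorphic_intros)
  qed simp
  show "norm (indicator {0..} t *\<^sub>R (exp (\<i> * a * d * of_real t) * F (x + d * of_real t)))
    \<le> (indicator {0..} t * exp (- b * t)) * B" if "x \<in> S" for x
    by (rule ray_norm_le[OF that assms(2,3)])
qed (use open_S ray_measurable[OF holomorphic_on_imp_continuous_on[OF F(1)]] integrable_exp_decay(1)[OF assms(4)] in auto)

lemma ray_int_holomorphic_param:
  assumes D: "open D" and x: "x \<in> S" and c: "\<And>k. k \<in> D \<Longrightarrow> continuous_on S (F k)"
    and hol: "\<And>y. y \<in> S \<Longrightarrow> (\<lambda>k. F k y) holomorphic_on D" and a: "a holomorphic_on D"
    and B: "\<And>k y. k \<in> D \<Longrightarrow> y \<in> S \<Longrightarrow> norm (F k y) \<le> B" and b: "\<And>k. k \<in> D \<Longrightarrow> Im (a k * d) \<ge> b" "b > 0"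
  shows "(\<lambda>k. ray_int d (a k) (F k) x) holomorphic_on D"
  unfolding ray_int_def
proof (rule holomorphic_on_mult[OF holomorphic_on_const],
    rule holomorphic_on_lebesgue_integral[where f = "\<lambda>k t. indicator {0..} t *\<^sub>R (exp (\<i> * a k * d * of_real t) * F k (x + d * of_real t))"
      and B = "\<lambda>t. (indicator {0..} t * exp (- b * t)) * B"])
  fix t :: real
  show "(\<lambda>k. indicator {0..} t *\<^sub>R (exp (\<i> * a k * d * of_real t) * F k (x + d * of_real t))) holomorphic_on D"
  proof (cases "t \<ge> 0")
    case True
    show ?thesis unfolding scaleR_conv_of_real by (intro holomorphic_intros hol ray x True a)
  qed simp
  show "norm (indicator {0..} t *\<^sub>R (exp (\<i> * a k * d * of_real t) * F k (x + d * of_real t)))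
    \<le> (indicator {0..} t * exp (- b * t)) * B" if "k \<in> D" for k
    by (rule ray_norm_le[OF x B[OF that] b(1)[OF that]])
qed (use D ray_measurable[OF c x] integrable_exp_decay(1)[OF b(2)] in auto)

lemma ray_int_tendsto:
  assumes x: "x \<in> S" and c: "\<And>j::nat. continuous_on S (F j)" "continuous_on S G"
    and lim: "\<And>y. y \<in> S \<Longrightarrow> (\<lambda>j. F j y) \<longlonglongrightarrow> G y"
    and B: "\<And>j y. y \<in> S \<Longrightarrow> norm (F j y) \<le> B" and b: "Im (a * d) \<ge> b" "b > 0"
  shows "(\<lambda>j. ray_int d a (F j) x) \<longlonglongrightarrow> ray_int d a G x"
  unfolding ray_int_def
proof (intro tendsto_intros integral_dominated_convergence[where w = "\<lambda>t. (indicator {0..} t * exp (- b * t)) * B"])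
  show "AE t in lborel. (\<lambda>i. indicator {0..} t *\<^sub>R (exp (\<i> * a * d * complex_of_real t) * F i (x + d * complex_of_real t)))
           \<longlonglongrightarrow> indicator {0..} t *\<^sub>R (exp (\<i> * a * d * complex_of_real t) * G (x + d * complex_of_real t))"
  proof (rule AE_I2)
    fix t :: real
    show "(\<lambda>i. indicator {0..} t *\<^sub>R (exp (\<i> * a * d * complex_of_real t) * F i (x + d * complex_of_real t)))
           \<longlonglongrightarrow> indicator {0..} t *\<^sub>R (exp (\<i> * a * d * complex_of_real t) * G (x + d * complex_of_real t))"
      by (cases "t \<ge> 0") (auto intro!: tendsto_intros lim ray x)
  qed
  show "AE t in lborel. norm (indicator {0..} t *\<^sub>R (exp (\<i> * a * d * of_real t) * F j (x + d * of_real t)))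
    \<le> (indicator {0..} t * exp (- b * t)) * B" for j
    by (intro AE_I2 ray_norm_le[OF x B b(1)])
qed (use ray_measurable[OF c(1) x] ray_measurable[OF c(2) x] integrable_exp_decay(1)[OF b(2)] in auto)

text \<open>Restricted to the ray, \<open>exp (\<i> a y)\<close> times the function is an antiderivative, which gives its
  complex derivative.\<close>
lemma ray_int_deriv:
  assumes F: "F holomorphic_on S" "\<And>y. y \<in> S \<Longrightarrow> norm (F y) \<le> B" and b: "Im (a * d) \<ge> b" "b > 0"
    and d: "d \<noteq> 0" and x: "x \<in> S"
  shows "(ray_int d a F has_field_derivative F x - \<i> * a * ray_int d a F x) (at x)"
proof -
  let ?u = "ray_int d a F"
  define h where "h t = exp (\<i> * a * d * of_real t) * F (x + d * of_real t)" for t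
  have cF: "continuous_on S F" by (rule holomorphic_on_imp_continuous_on[OF F(1)])
  have ch: "continuous_on {0..} h" unfolding h_def
    by (intro continuous_intros continuous_on_compose2[OF cF]) (use ray x in auto)
  have ih: "integrable lborel (\<lambda>t. indicator {0..} t *\<^sub>R h t)"
    unfolding h_def by (rule ray_integrable[OF cF x F(2) b])
  have hol: "?u holomorphic_on S" by (rule ray_int_holomorphic[OF F b])
  \<comment> \<open>Holomorphy already provides a complex derivative; only its value is missing, and
    since \<open>d \<noteq> 0\<close> a one-sided derivative along the ray determines it.\<close>
  obtain u' where u': "(?u has_field_derivative u') (at x)"
    using holomorphic_on_imp_differentiable_at[OF hol open_S x] by (auto simp: field_differentiable_def)
  \<comment> \<open>Starting the ray at x + d s instead of x only removes the segment
    \<open>{0..s}\<close> from the integral, up to the factor exp(\<i> a d s).\<close>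
  have key: "exp (\<i> * a * d * of_real s) * ?u (x + d * of_real s) = ?u x + d * integral {0..s} h" if s: "s \<ge> 0" for s
  proof -
    have i1: "set_integrable lborel {0..s} h"
      by (rule borel_integrable_atLeastAtMost'[OF continuous_on_subset[OF ch]]) auto
    have i1': "integrable lborel (\<lambda>t. indicator {0..s} t *\<^sub>R h t)"
      using i1 by (simp add: set_integrable_def)
    have sp: "(\<lambda>t. indicator {s..} t *\<^sub>R h t) = (\<lambda>t. indicator {0..} t *\<^sub>R h t - indicator {0..<s} t *\<^sub>R h t)"
      using s by (auto simp: indicator_def)
    have i3: "integrable lborel (\<lambda>t. indicator {0..<s} t *\<^sub>R h t)"
    proof -
      have "(\<lambda>t. indicator {0..<s} t *\<^sub>R h t) = (\<lambda>t. indicator {0..<s} t *\<^sub>R (indicator {0..s} t *\<^sub>R h t))"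
        by (auto simp: indicator_def)
      then show ?thesis using integrable_mult_indicator[OF _ i1', of "{0..<s}"] by simp
    qed
    have i2: "(\<integral>t. indicator {0..<s} t *\<^sub>R h t \<partial>lborel) = integral {0..s} h"
    proof -
      have "(\<integral>t. indicator {0..<s} t *\<^sub>R h t \<partial>lborel) = (\<integral>t. indicator {0..s} t *\<^sub>R h t \<partial>lborel)"
        by (rule integral_cong_AE) (use i1' i3 in \<open>auto simp: indicator_def intro!: AE_I[where N = "{s}"] split: if_splits dest: borel_measurable_integrable\<close>)
      then show ?thesis using set_borel_integral_eq_integral(2)[OF i1] by (simp add: set_lebesgue_integral_def)
    qed
    have "(\<integral>t. indicator {s..} t *\<^sub>R h t \<partial>lborel) = (\<integral>t. indicator {s..} (s + t) *\<^sub>R h (s + t) \<partial>lborel)"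
      using lborel_integral_real_affine[of 1 "\<lambda>t. indicator {s..} t *\<^sub>R h t" s] by simp
    also have "\<dots> = (\<integral>t. exp (\<i> * a * d * of_real s) * (indicator {0..} t *\<^sub>R (exp (\<i> * a * d * of_real t) * F (x + d * of_real s + d * of_real t))) \<partial>lborel)"
      by (rule Bochner_Integration.integral_cong) (auto simp: indicator_def h_def algebra_simps exp_add)
    also have "\<dots> = exp (\<i> * a * d * of_real s) * (\<integral>t. indicator {0..} t *\<^sub>R (exp (\<i> * a * d * of_real t) * F (x + d * of_real s + d * of_real t)) \<partial>lborel)"
      by (rule integral_mult_right_zero)
    finally have "exp (\<i> * a * d * of_real s) * ?u (x + d * of_real s) = - d * (\<integral>t. indicator {s..} t *\<^sub>R h t \<partial>lborel)"
      by (simp add: ray_int_def)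
    also have "(\<integral>t. indicator {s..} t *\<^sub>R h t \<partial>lborel) = (\<integral>t. indicator {0..} t *\<^sub>R h t \<partial>lborel) - integral {0..s} h"
      unfolding sp i2[symmetric] by (rule Bochner_Integration.integral_diff[OF ih i3])
    finally show ?thesis by (simp add: ray_int_def h_def algebra_simps)
  qed
  have e1: "((\<lambda>s. exp (\<i> * a * d * of_real s) * ?u (x + d * of_real s)) has_vector_derivative
      exp (\<i> * a * d * of_real 0) * (d * u') + \<i> * a * d * exp (\<i> * a * d * of_real 0) * ?u (x + d * of_real 0)) (at 0 within {0..1})"
  proof (rule has_vector_derivative_mult)
    have "((\<lambda>w. exp (\<i> * a * d * w)) has_field_derivative \<i> * a * d * exp (\<i> * a * d * of_real 0)) (at (of_real 0))"
      by (auto intro!: derivative_eq_intros)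
    from has_vector_derivative_real_field[OF this]
    show "((\<lambda>s. exp (\<i> * a * d * of_real s)) has_vector_derivative \<i> * a * d * exp (\<i> * a * d * of_real 0)) (at 0 within {0..1})"
      by (simp add: has_vector_derivative_at_within)
    have "((\<lambda>w. x + d * w) has_field_derivative d) (at 0)"
      by (auto intro!: derivative_eq_intros)
    moreover have "(?u has_field_derivative u') (at (x + d * 0))" using u' by simp
    ultimately have "((\<lambda>w. ?u (x + d * w)) has_field_derivative u' * d) (at (of_real 0))"
      using DERIV_chain2[of ?u u' "\<lambda>w. x + d * w" 0 d UNIV] by simp
    from has_vector_derivative_real_field[OF this]
    show "((\<lambda>s. ?u (x + d * of_real s)) has_vector_derivative d * u') (at 0 within {0..1})"
      by (simp add: has_vector_derivative_at_within mult.commute)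
  qed
  have "((\<lambda>s. integral {0..s} h) has_vector_derivative h 0) (at 0 within {0..1})"
    by (rule integral_has_vector_derivative[OF continuous_on_subset[OF ch]]) auto
  then have e2: "((\<lambda>s. ?u x + d * integral {0..s} h) has_vector_derivative d * h 0) (at 0 within {0..1})"
    using has_vector_derivative_add[OF has_vector_derivative_const has_vector_derivative_mult_right] by fastforce
  have e3: "((\<lambda>s. exp (\<i> * a * d * of_real s) * ?u (x + d * of_real s)) has_vector_derivative d * h 0) (at 0 within {0..1})"
    by (rule has_vector_derivative_transform[OF _ _ e2]) (use key in auto)
  have "exp (\<i> * a * d * of_real 0) * (d * u') + \<i> * a * d * exp (\<i> * a * d * of_real 0) * ?u (x + d * of_real 0) = d * h 0"
    by (rule vector_derivative_unique_within_closed_interval[where a = 0 and b = "1::real" and x = 0])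
       (use e1 e3 in simp_all)
  then have "d * (u' + \<i> * a * ?u x) = d * F x" by (simp add: h_def algebra_simps)
  then have "u' = F x - \<i> * a * ?u x" using d by (simp add: eq_diff_eq)
  then show ?thesis using u' by simp
qed

end

section \<open>The Riccati equation in a sector\<close>

text \<open>Series over the integers are integrals for counting measure, so Fubini, dominated
  convergence and holomorphic dependence on parameters apply to them unchanged.\<close>

abbreviation "csZ \<equiv> count_space (UNIV :: int set)"

definition conv :: "(int \<Rightarrow> 'a::{real_normed_field,banach,second_countable_topology}) \<Rightarrow> (int \<Rightarrow> 'a) \<Rightarrow> int \<Rightarrow> 'a" where
  "conv a b n = (\<integral>m. a m * b (n - m) \<partial>csZ)"

lemma integrable_csZ_norm_le:
  fixes b :: "int \<Rightarrow> 'a::{banach,second_countable_topology}"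
  assumes "integrable csZ b"
  shows "norm (b n) \<le> (\<integral>m. norm (b m) \<partial>csZ)"
proof -
  have "(\<integral>m. indicator {n} m * norm (b n) \<partial>csZ) \<le> (\<integral>m. norm (b m) \<partial>csZ)"
  proof (rule integral_mono)
    show "integrable csZ (\<lambda>m. indicator {n} m * norm (b n))"
      by (intro integrable_mult_left integrable_real_indicator) (auto simp: emeasure_count_space)
  qed (use assms in \<open>auto simp: indicator_def\<close>)
  then show ?thesis by simp
qed

lemma integrable_csZ_shift:
  fixes b :: "int \<Rightarrow> 'a::{banach,second_countable_topology}"
  assumes "integrable csZ b"
  shows "integrable csZ (\<lambda>n. b (n - m))" "(\<integral>n. b (n - m) \<partial>csZ) = (\<integral>n. b n \<partial>csZ)"
proof -
  have bij: "bij_betw (\<lambda>n. n - m) (UNIV :: int set) UNIV"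
    by (rule bij_betwI[where g = "\<lambda>n. n + m"]) auto
  show "integrable csZ (\<lambda>n. b (n - m))"
    using integrable_bij_count_space[OF bij, of b] assms by simp
  show "(\<integral>n. b (n - m) \<partial>csZ) = (\<integral>n. b n \<partial>csZ)"
    using integral_bij_count_space[OF bij, of b] by simp
qed

lemma integrable_conv_term:
  fixes a b :: "int \<Rightarrow> 'a::{real_normed_field,banach,second_countable_topology}"
  assumes a: "integrable csZ a" and b: "integrable csZ b"
  shows "integrable csZ (\<lambda>m. a m * b (n - m))"
proof (rule Bochner_Integration.integrable_bound)
  show "integrable csZ (\<lambda>m. norm (a m) * (\<integral>m. norm (b m) \<partial>csZ))"
    using a by (intro integrable_mult_left integrable_norm)
  show "AE m in csZ. norm (a m * b (n - m)) \<le> norm (norm (a m) * (\<integral>m. norm (b m) \<partial>csZ))"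
    using integrable_csZ_norm_le[OF b] by (intro AE_I2) (auto simp: norm_mult intro!: mult_left_mono)
qed simp

text \<open>Fubini and shift invariance of counting measure: absolutely summable families form an
  algebra under convolution, and the total sum is multiplicative. This later turns the convolution
  of the modes of \<open>w\<close> into the square of \<open>w\<close>.\<close>

lemma integral_conv:
  fixes a b :: "int \<Rightarrow> 'a::{real_normed_field,banach,second_countable_topology}"
  assumes a: "integrable csZ a" and b: "integrable csZ b"
  shows "integrable csZ (conv a b)" "(\<integral>n. conv a b n \<partial>csZ) = (\<integral>n. a n \<partial>csZ) * (\<integral>n. b n \<partial>csZ)"
proof -
  interpret pair_sigma_finite csZ csZ
    by (intro pair_sigma_finite.intro sigma_finite_measure_count_space)
  have pm: "csZ \<Otimes>\<^sub>M csZ = count_space (UNIV \<times> UNIV)"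
    by (rule pair_measure_countable) auto
  let ?f = "\<lambda>(m, n). a m * b (n - m)"
  have nb: "integrable csZ (\<lambda>n. norm (b n))" using b by simp
  have int: "integrable (csZ \<Otimes>\<^sub>M csZ) ?f"
  proof (rule Fubini_integrable)
    show "?f \<in> borel_measurable (csZ \<Otimes>\<^sub>M csZ)" unfolding pm by simp
    have "(\<integral>n. norm (?f (m, n)) \<partial>csZ) = norm (a m) * (\<integral>n. norm (b n) \<partial>csZ)" for m
      using integrable_csZ_shift[OF nb, of m] by (simp add: norm_mult)
    then show "integrable csZ (\<lambda>m. \<integral>n. norm (?f (m, n)) \<partial>csZ)" using a by simp
    show "AE m in csZ. integrable csZ (\<lambda>n. ?f (m, n))"
      using integrable_csZ_shift[OF b] by (intro AE_I2) simp
  qed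
  have "integrable csZ (\<lambda>n. \<integral>m. (case (m, n) of (m, n) \<Rightarrow> a m * b (n - m)) \<partial>csZ)"
    using integrable_snd[OF int] by simp
  then show "integrable csZ (conv a b)" by (simp add: conv_def[abs_def])
  have "(\<integral>n. conv a b n \<partial>csZ) = (\<integral>m. \<integral>n. a m * b (n - m) \<partial>csZ \<partial>csZ)"
    unfolding conv_def using Fubini_integral[OF int] .
  also have "\<dots> = (\<integral>m. a m * (\<integral>n. b n \<partial>csZ) \<partial>csZ)"
    using integrable_csZ_shift[OF b] by (intro Bochner_Integration.integral_cong) auto
  finally show "(\<integral>n. conv a b n \<partial>csZ) = (\<integral>n. a n \<partial>csZ) * (\<integral>n. b n \<partial>csZ)"
    using a by simp
qed

text \<open>\<open>V n\<close> and \<open>v n\<close> are the \<open>n\<close>-th Fourier coefficient of the potential and a bound for it; \<open>dd n\<close> is the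
  direction of the ray along which the \<open>n\<close>-th mode is integrated.\<close>

locale riccati =
  fixes S D :: "complex set" and dd :: "int \<Rightarrow> complex" and A b :: real
    and V :: "int \<Rightarrow> complex \<Rightarrow> complex" and v :: "int \<Rightarrow> real"
  assumes open_D: "open D" and ray: "\<And>n. ray_domain S (dd n)" and dd0: "\<And>n. dd n \<noteq> 0"
    and dd_le: "\<And>n. norm (dd n) / b \<le> A" and b: "b > 0"
    and Im_ge: "\<And>k n. k \<in> D \<Longrightarrow> Im (2 * (of_int n + k) * dd n) \<ge> b"
    and V_hol: "\<And>n. V n holomorphic_on S" and V_le: "\<And>n x. x \<in> S \<Longrightarrow> norm (V n x) \<le> v n"
    and v_int: "integrable csZ v" and v0: "\<And>n. v n \<ge> 0" and small: "4 * A\<^sup>2 * (\<integral>n. v n \<partial>csZ) \<le> 1"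
begin

text \<open>Scalar majorants: \<open>maj j n\<close> bounds the n-th mode of the j-th iterate for
  all \<open>k\<close> in \<open>D\<close> and all \<open>x\<close> in \<open>S\<close>. Since
  \<open>norm (dd n) / b \<le> A\<close>, each ray integral costs a factor \<open>A\<close>.\<close>

primrec maj :: "nat \<Rightarrow> int \<Rightarrow> real" where
  "maj 0 = (\<lambda>n. 0)"
| "maj (Suc j) = (\<lambda>n. A * (v n + conv (maj j) (maj j) n))"

primrec iter :: "nat \<Rightarrow> int \<Rightarrow> complex \<Rightarrow> complex \<Rightarrow> complex" where
  "iter 0 = (\<lambda>n k x. 0)"
| "iter (Suc j) = (\<lambda>n k x. ray_int (dd n) (2 * (of_int n + k)) (\<lambda>x. V n x - conv (\<lambda>m. iter j m k x) (\<lambda>m. iter j m k x) n) x)"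

text \<open>The total mass m of a stationary majorant satisfies m = A (s + m^2), where s is the sum
  of \<open>v\<close>. When 4 A^2 s \<le> 1 the smaller root is real and at most 2 A s.\<close>

definition eps :: real where "eps = 2 * A * (\<integral>n. v n \<partial>csZ)"

lemma open_S: "open S" using ray[of 0] by (rule ray_domain.open_S)

lemma A0: "A \<ge> 0" using dd_le[of 0] b by (meson divide_nonneg_pos norm_ge_zero order_trans)

lemma v_total0: "(\<integral>n. v n \<partial>csZ) \<ge> 0" using v0 by simp

lemma eps_ineq: "A * ((\<integral>n. v n \<partial>csZ) + eps\<^sup>2) \<le> eps"
proof -
  let ?s = "\<integral>n. v n \<partial>csZ"
  have "(A * ?s) * (4 * A\<^sup>2 * ?s) \<le> (A * ?s) * 1"
    by (rule mult_left_mono[OF small]) (use A0 v_total0 in simp)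
  then show ?thesis by (simp add: eps_def power2_eq_square algebra_simps)
qed

lemma conv_mono:
  fixes f g :: "int \<Rightarrow> real"
  assumes "integrable csZ f" "integrable csZ g" "\<And>n. 0 \<le> f n" "\<And>n. f n \<le> g n"
  shows "0 \<le> conv f f n" "conv f f n \<le> conv g g n"
  unfolding conv_def
  by (auto intro!: integral_mono integrable_conv_term mult_mono assms Bochner_Integration.integral_nonneg mult_nonneg_nonneg intro: order_trans[OF assms(3,4)])

lemma maj_props: "integrable csZ (maj j) \<and> (\<forall>n. 0 \<le> maj j n) \<and> (\<integral>n. maj j n \<partial>csZ) \<le> eps"
proof (induction j)
  case 0
  then show ?case using A0 v_total0 by (simp add: eps_def)
next
  case (Suc j)
  then have i: "integrable csZ (maj j)" and p: "\<And>n. 0 \<le> maj j n" and e: "(\<integral>n. maj j n \<partial>csZ) \<le> eps" by auto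
  have ic: "integrable csZ (conv (maj j) (maj j))" by (rule integral_conv[OF i i])
  have "(\<integral>n. maj (Suc j) n \<partial>csZ) = A * ((\<integral>n. v n \<partial>csZ) + (\<integral>n. maj j n \<partial>csZ)\<^sup>2)"
    using ic v_int integral_conv(2)[OF i i] by (simp add: power2_eq_square)
  also have "\<dots> \<le> A * ((\<integral>n. v n \<partial>csZ) + eps\<^sup>2)"
    using e p A0 by (intro mult_left_mono add_left_mono power_mono) auto
  also have "\<dots> \<le> eps" by (rule eps_ineq)
  finally show ?case using ic v_int conv_mono(1)[OF i i p order_refl] v0 A0 by auto
qed

lemmas maj_int = maj_props[THEN conjunct1] and maj_nonneg = maj_props[THEN conjunct2, THEN conjunct1, rule_format]
  and maj_eps = maj_props[THEN conjunct2, THEN conjunct2]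

lemma maj_mono: "maj j n \<le> maj (Suc j) n"
proof (induction j arbitrary: n)
  case 0
  show ?case using maj_nonneg[of "Suc 0" n] by simp
next
  case (Suc j)
  have "conv (maj j) (maj j) n \<le> conv (maj (Suc j)) (maj (Suc j)) n"
    by (rule conv_mono) (use maj_int maj_nonneg Suc in blast)+
  then show ?case using A0 by (simp add: mult_left_mono)
qed

lemma maj_incseq: "incseq (\<lambda>j. maj j n)"
  by (rule incseq_SucI) (rule maj_mono)

lemma maj_le_eps: "maj j n \<le> eps"
  using integrable_csZ_norm_le[OF maj_int, of j n] maj_eps[of j] maj_nonneg by simp

definition mlim :: "int \<Rightarrow> real" where "mlim n = lim (\<lambda>j. maj j n)"

lemma maj_tendsto: "(\<lambda>j. maj j n) \<longlonglongrightarrow> mlim n"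
proof -
  have "Bseq (\<lambda>j. maj j n)" by (rule BseqI'[of _ eps]) (use maj_le_eps maj_nonneg in simp)
  then have "convergent (\<lambda>j. maj j n)" using Bseq_mono_convergent maj_incseq by (auto simp: incseq_def)
  then show ?thesis by (simp add: mlim_def convergent_LIMSEQ_iff)
qed

lemma maj_le_mlim: "maj j n \<le> mlim n"
  by (rule incseq_le[OF maj_incseq maj_tendsto])

lemma mlim_nonneg: "0 \<le> mlim n" using maj_le_mlim[of 0 n] by simp

text \<open>Monotone convergence: the masses of the majorants increase with \<open>j\<close> and
  stay below \<open>eps\<close>.\<close>

lemma mlim_int: "integrable csZ mlim" and mlim_eps: "(\<integral>n. mlim n \<partial>csZ) \<le> eps"
proof -
  have conv: "convergent (\<lambda>j. \<integral>n. maj j n \<partial>csZ)"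
  proof -
    have inc: "incseq (\<lambda>j. \<integral>n. maj j n \<partial>csZ)"
      by (rule incseq_SucI, rule integral_mono[OF maj_int maj_int maj_mono])
    have "Bseq (\<lambda>j. \<integral>n. maj j n \<partial>csZ)"
      by (rule BseqI'[of _ eps]) (use maj_eps maj_nonneg in \<open>simp\<close>)
    then show ?thesis using Bseq_mono_convergent inc by (auto simp: incseq_def)
  qed
  then obtain L where L: "(\<lambda>j. \<integral>n. maj j n \<partial>csZ) \<longlonglongrightarrow> L" by (auto simp: convergent_def)
  have "has_bochner_integral csZ mlim L"
    by (rule has_bochner_integral_monotone_convergence[OF maj_int _ _ L])
       (use maj_incseq maj_tendsto in \<open>auto simp: incseq_def mono_def\<close>)
  then show "integrable csZ mlim" "(\<integral>n. mlim n \<partial>csZ) \<le> eps"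
    using LIMSEQ_le_const2[OF L] maj_eps by (auto simp: has_bochner_integral_iff)
qed

lemma csZ_bounded_integrable:
  fixes u :: "int \<Rightarrow> complex"
  assumes "integrable csZ g" "\<And>n. norm (u n) \<le> g n"
  shows "integrable csZ u"
proof (rule Bochner_Integration.integrable_bound[OF assms(1)])
  show "AE n in csZ. norm (u n) \<le> norm (g n)" by (rule AE_I2, rule order_trans[OF assms(2)]) simp
qed simp

lemma norm_conv_le:
  fixes u :: "int \<Rightarrow> complex"
  assumes "integrable csZ g" "\<And>n. norm (u n) \<le> g n"
  shows "norm (conv u u n) \<le> conv g g n"
proof -
  have iu: "integrable csZ u" by (rule csZ_bounded_integrable[OF assms])
  have g0: "0 \<le> g n" for n by (rule order_trans[OF norm_ge_zero assms(2)])
  have t: "norm (u m * u (n - m)) \<le> g m * g (n - m)" for m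
    by (auto simp: norm_mult intro!: mult_mono assms g0)
  show ?thesis unfolding conv_def
    using norm_integral_le_integral[OF integrable_conv_term[OF iu iu] integrable_conv_term[OF assms(1,1)]] t by blast
qed

text \<open>From w w - u u = (w - u) w + u (w - u) and the domination of w - u by h - g, each
  product difference is dominated by that of h h and g g. Increments of iterates are thereby
  controlled by increments of majorants.\<close>

lemma norm_conv_diff_le:
  fixes u w :: "int \<Rightarrow> complex"
  assumes g: "integrable csZ g" "integrable csZ h" and u: "\<And>n. norm (u n) \<le> g n" and w: "\<And>n. norm (w n) \<le> h n"
    and d: "\<And>n. norm (w n - u n) \<le> h n - g n"
  shows "norm (conv w w n - conv u u n) \<le> conv h h n - conv g g n"
proof -
  have iu: "integrable csZ u" "integrable csZ w" using csZ_bounded_integrable g u w by blast+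
  have pos: "0 \<le> g n" "0 \<le> h n" for n
    by (rule order_trans[OF norm_ge_zero u], rule order_trans[OF norm_ge_zero w])
  have t: "norm (w m * w l - u m * u l) \<le> h m * h l - g m * g l" for m l
  proof -
    have "w m * w l - u m * u l = (w m - u m) * w l + u m * (w l - u l)" by (simp add: algebra_simps)
    also have "norm \<dots> \<le> (h m - g m) * h l + g m * (h l - g l)"
      by (rule order_trans[OF norm_triangle_ineq])
         (auto simp: norm_mult intro!: add_mono mult_mono d u w pos intro: order_trans[OF norm_ge_zero d])
    finally show ?thesis by (simp add: algebra_simps)
  qed
  have "conv w w n - conv u u n = (\<integral>m. w m * w (n - m) - u m * u (n - m) \<partial>csZ)"
    unfolding conv_def by (rule Bochner_Integration.integral_diff[symmetric, OF integrable_conv_term[OF iu(2,2)] integrable_conv_term[OF iu(1,1)]])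
  also have "norm \<dots> \<le> (\<integral>m. h m * h (n - m) - g m * g (n - m) \<partial>csZ)"
    using norm_integral_le_integral[OF
        Bochner_Integration.integrable_diff[OF integrable_conv_term[OF iu(2,2)] integrable_conv_term[OF iu(1,1)]]
        Bochner_Integration.integrable_diff[OF integrable_conv_term[OF g(2,2)] integrable_conv_term[OF g(1,1)]]] t by blast
  also have "\<dots> = conv h h n - conv g g n"
    unfolding conv_def by (rule Bochner_Integration.integral_diff[OF integrable_conv_term[OF g(2,2)] integrable_conv_term[OF g(1,1)]])
  finally show ?thesis .
qed

lemma conv_holomorphic:
  assumes T: "open T" and g: "integrable csZ g"
    and u: "\<And>n. u n holomorphic_on T" "\<And>n x. x \<in> T \<Longrightarrow> norm (u n x) \<le> g n"
  shows "(\<lambda>x. conv (\<lambda>m. u m x) (\<lambda>m. u m x) n) holomorphic_on T"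
  unfolding conv_def
proof (rule holomorphic_on_lebesgue_integral[OF T, where B = "\<lambda>m. g m * g (n - m)"])
  have "0 \<le> g n" if "x \<in> T" for n x by (rule order_trans[OF norm_ge_zero u(2)[OF that]])
  then show "norm (u m x * u (n - m) x) \<le> g m * g (n - m)" if "x \<in> T" for m x
    using that u(2) by (auto simp: norm_mult intro!: mult_mono)
qed (auto intro!: holomorphic_intros u integrable_conv_term g)

lemma A_bound: "norm (dd n) / b * B \<le> A * B" if "B \<ge> 0"
  using dd_le that by (rule mult_right_mono)

text \<open>The three claims go through one induction: the next ray integral uses the bound for
  convergence, holomorphy in \<open>x\<close> for the continuity of its integrand, and holomorphy in
  \<open>k\<close> for its dependence on the parameter.\<close>

lemma iter_props:
  "(\<forall>n. \<forall>k\<in>D. \<forall>x\<in>S. norm (iter j n k x) \<le> maj j n) \<and> (\<forall>n. \<forall>k\<in>D. iter j n k holomorphic_on S)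
    \<and> (\<forall>n. \<forall>x\<in>S. (\<lambda>k. iter j n k x) holomorphic_on D)"
proof (induction j)
  case (Suc j)
  define F where "F n k x = V n x - conv (\<lambda>m. iter j m k x) (\<lambda>m. iter j m k x) n" for n k x
  have Fx: "F n k holomorphic_on S" if "k \<in> D" for n k
    unfolding F_def[abs_def] using Suc that
    by (intro holomorphic_intros V_hol conv_holomorphic[OF open_S maj_int[of j]]) auto
  have Fk: "(\<lambda>k. F n k x) holomorphic_on D" if "x \<in> S" for n x
    unfolding F_def using Suc that
    by (intro holomorphic_intros conv_holomorphic[OF open_D maj_int[of j], where u = "\<lambda>m k. iter j m k x"]) auto
  have Fb: "norm (F n k x) \<le> v n + conv (maj j) (maj j) n" if "k \<in> D" "x \<in> S" for n k x
    unfolding F_def by (rule order_trans[OF norm_triangle_ineq4 add_mono[OF V_le norm_conv_le[OF maj_int]]]) (use Suc that in auto)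
  have pos: "0 \<le> v n + conv (maj j) (maj j) n" for n
    using v0 conv_mono(1)[OF maj_int maj_int maj_nonneg order_refl] by simp
  have it: "iter (Suc j) n k = ray_int (dd n) (2 * (of_int n + k)) (F n k)" for n k
    by (rule ext) (simp add: F_def[abs_def])
  show ?case
  proof (intro conjI allI ballI)
    fix n k x assume kx: "k \<in> D" "x \<in> S"
    have "norm (iter (Suc j) n k x) \<le> norm (dd n) / b * (v n + conv (maj j) (maj j) n)"
      unfolding it
      by (rule ray_domain.norm_ray_int_le[OF ray holomorphic_on_imp_continuous_on[OF Fx[OF kx(1)]] kx(2) Fb[OF kx(1)] Im_ge[OF kx(1)] b])
    also have "\<dots> \<le> A * (v n + conv (maj j) (maj j) n)" by (rule A_bound[OF pos])
    finally show "norm (iter (Suc j) n k x) \<le> maj (Suc j) n" by simp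
  next
    fix n k assume k: "k \<in> D"
    show "iter (Suc j) n k holomorphic_on S" unfolding it
      by (rule ray_domain.ray_int_holomorphic[OF ray Fx[OF k] Fb[OF k] Im_ge[OF k] b])
  next
    fix n x assume x: "x \<in> S"
    show "(\<lambda>k. iter (Suc j) n k x) holomorphic_on D" unfolding it
      by (rule ray_domain.ray_int_holomorphic_param[OF ray open_D x _ Fk _ Fb Im_ge b])
         (auto intro!: holomorphic_intros holomorphic_on_imp_continuous_on[OF Fx])
  qed
qed auto

lemmas iter_le = iter_props[THEN conjunct1, rule_format]
  and iter_hol = iter_props[THEN conjunct2, THEN conjunct1, rule_format]
  and iter_hol_k = iter_props[THEN conjunct2, THEN conjunct2, rule_format]

definition rhs :: "nat \<Rightarrow> int \<Rightarrow> complex \<Rightarrow> complex \<Rightarrow> complex" where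
  "rhs j n k x = V n x - conv (\<lambda>m. iter j m k x) (\<lambda>m. iter j m k x) n"

lemma rhs_cont: "k \<in> D \<Longrightarrow> continuous_on S (rhs j n k)"
  unfolding rhs_def[abs_def]
  by (intro holomorphic_on_imp_continuous_on holomorphic_intros V_hol conv_holomorphic[OF open_S maj_int[of j]]) (auto intro: iter_hol iter_le)

lemma rhs_le: "k \<in> D \<Longrightarrow> x \<in> S \<Longrightarrow> norm (rhs j n k x) \<le> v n + conv (maj j) (maj j) n"
  unfolding rhs_def
  by (rule order_trans[OF norm_triangle_ineq4 add_mono[OF V_le norm_conv_le[OF maj_int]]]) (auto intro: iter_le)

lemma iter_Suc: "iter (Suc j) n k x = ray_int (dd n) (2 * (of_int n + k)) (rhs j n k) x"
  by (simp add: rhs_def[abs_def])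

text \<open>Comparison with the majorants takes the place of a contraction constant: their
  increments telescope, so the iterates converge uniformly in \<open>k\<close> and \<open>x\<close>
  even in the borderline case of equality in \<open>small\<close>.\<close>

lemma iter_diff: "k \<in> D \<Longrightarrow> x \<in> S \<Longrightarrow> norm (iter (Suc j) n k x - iter j n k x) \<le> maj (Suc j) n - maj j n"
proof (induction j arbitrary: n x)
  case 0
  show ?case using iter_le[OF 0, of "Suc 0" n] by simp
next
  case (Suc j)
  note k = Suc.prems(1) and x = Suc.prems(2)
  let ?c = "conv (maj (Suc j)) (maj (Suc j)) n - conv (maj j) (maj j) n"
  have d: "norm (rhs (Suc j) n k y - rhs j n k y) \<le> ?c" if y: "y \<in> S" for y
  proof -
    have "norm (conv (\<lambda>m. iter (Suc j) m k y) (\<lambda>m. iter (Suc j) m k y) n - conv (\<lambda>m. iter j m k y) (\<lambda>m. iter j m k y) n) \<le> ?c"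
      by (rule norm_conv_diff_le[OF maj_int maj_int]) (use iter_le Suc.IH k y in \<open>auto simp del: iter.simps maj.simps\<close>)
    then show ?thesis by (simp add: rhs_def norm_minus_commute del: iter.simps maj.simps)
  qed
  have c0: "?c \<ge> 0" by (rule order_trans[OF norm_ge_zero d[OF x]])
  have "iter (Suc (Suc j)) n k x - iter (Suc j) n k x
     = ray_int (dd n) (2 * (of_int n + k)) (\<lambda>y. rhs (Suc j) n k y - rhs j n k y) x"
    unfolding iter_Suc[of "Suc j"] iter_Suc[of j]
    by (rule ray_domain.ray_int_diff[OF ray rhs_cont[OF k] rhs_cont[OF k] x rhs_le[OF k] rhs_le[OF k] Im_ge[OF k] b])
  also have "norm \<dots> \<le> norm (dd n) / b * ?c"
    by (rule ray_domain.norm_ray_int_le[OF ray _ x d Im_ge[OF k] b]) (intro continuous_intros rhs_cont k)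
  also have "\<dots> \<le> A * ?c" by (rule A_bound[OF c0])
  finally show ?case by (simp add: algebra_simps)
qed

lemma iter_diff_le:
  assumes k: "k \<in> D" "x \<in> S"
  shows "j \<le> i \<Longrightarrow> norm (iter i n k x - iter j n k x) \<le> maj i n - maj j n"
proof (induction i rule: dec_induct)
  case (step i)
  have "norm ((iter (Suc i) n k x - iter i n k x) + (iter i n k x - iter j n k x))
      \<le> (maj (Suc i) n - maj i n) + (maj i n - maj j n)"
    by (rule order_trans[OF norm_triangle_ineq add_mono[OF iter_diff[OF k] step.IH]])
  then show ?case by (simp del: iter.simps maj.simps)
qed simp

definition U :: "int \<Rightarrow> complex \<Rightarrow> complex \<Rightarrow> complex" where "U n k x = lim (\<lambda>j. iter j n k x)"

lemma iter_tendsto: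
  assumes k: "k \<in> D" "x \<in> S"
  shows "(\<lambda>j. iter j n k x) \<longlonglongrightarrow> U n k x"
proof -
  have "Cauchy (\<lambda>j. iter j n k x)"
  proof (rule CauchyI')
    fix e :: real assume "e > 0"
    then obtain M where M: "\<And>j. j \<ge> M \<Longrightarrow> dist (maj j n) (mlim n) < e"
      using maj_tendsto[of n] unfolding lim_sequentially by blast
    show "\<exists>M. \<forall>m\<ge>M. \<forall>i>m. dist (iter m n k x) (iter i n k x) < e"
    proof (intro exI[of _ M] allI impI)
      fix m i assume "M \<le> m" "m < i"
      then have "norm (iter i n k x - iter m n k x) \<le> maj i n - maj m n" using iter_diff_le[OF k] by simp
      also have "\<dots> \<le> mlim n - maj m n" using maj_le_mlim by simp
      also have "\<dots> < e" using M[OF \<open>M \<le> m\<close>] by (simp add: dist_real_def)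
      finally show "dist (iter m n k x) (iter i n k x) < e" by (simp add: dist_norm norm_minus_commute)
    qed
  qed
  then show ?thesis by (simp add: U_def Cauchy_convergent_iff convergent_LIMSEQ_iff)
qed

lemma U_diff_le:
  assumes k: "k \<in> D" "x \<in> S"
  shows "norm (U n k x - iter j n k x) \<le> mlim n - maj j n"
proof (rule LIMSEQ_le)
  show "(\<lambda>i. norm (iter i n k x - iter j n k x)) \<longlonglongrightarrow> norm (U n k x - iter j n k x)"
    by (intro tendsto_intros iter_tendsto k)
  show "(\<lambda>i. maj i n - maj j n) \<longlonglongrightarrow> mlim n - maj j n" by (intro tendsto_intros maj_tendsto)
qed (use iter_diff_le[OF k] in blast)

lemma U_le: "k \<in> D \<Longrightarrow> x \<in> S \<Longrightarrow> norm (U n k x) \<le> mlim n"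
  using U_diff_le[of k x n 0] by simp

text \<open>Both arguments move with \<open>y\<close>, so one statement gives uniform convergence in
  \<open>x\<close> for fixed \<open>k\<close> and in \<open>k\<close> for fixed
  \<open>x\<close>.\<close>

lemma iter_uniform:
  assumes "\<And>y. y \<in> T \<Longrightarrow> k y \<in> D \<and> x y \<in> S"
  shows "uniform_limit T (\<lambda>j y. iter j n (k y) (x y)) (\<lambda>y. U n (k y) (x y)) sequentially"
proof (rule uniform_limitI)
  fix e :: real assume "e > 0"
  have "\<forall>\<^sub>F j in sequentially. dist (maj j n) (mlim n) < e" using maj_tendsto \<open>e > 0\<close> by (rule tendstoD)
  then show "\<forall>\<^sub>F j in sequentially. \<forall>y\<in>T. dist (iter j n (k y) (x y)) (U n (k y) (x y)) < e"
  proof eventually_elim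
    case (elim j)
    show ?case
    proof
      fix y assume "y \<in> T"
      then have "norm (U n (k y) (x y) - iter j n (k y) (x y)) \<le> mlim n - maj j n" using U_diff_le assms by blast
      also have "\<dots> < e" using elim maj_le_mlim[of j n] by (simp add: dist_real_def)
      finally show "dist (iter j n (k y) (x y)) (U n (k y) (x y)) < e" by (simp add: dist_norm norm_minus_commute)
    qed
  qed
qed

lemma U_hol: "k \<in> D \<Longrightarrow> U n k holomorphic_on S"
proof (rule holomorphic_uniform_sequence[OF open_S iter_hol])
  fix x assume k: "k \<in> D" and "x \<in> S"
  then obtain r where r: "r > 0" "cball x r \<subseteq> S" using open_S open_contains_cball by blast
  then have "uniform_limit (cball x r) (\<lambda>j y. iter j n k y) (\<lambda>y. U n k y) sequentially"
    using k by (intro iter_uniform) auto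
  then show "\<exists>d>0. cball x d \<subseteq> S \<and> uniform_limit (cball x d) (\<lambda>j. iter j n k) (U n k) sequentially"
    using r by blast
qed

lemma U_hol_k: "x \<in> S \<Longrightarrow> (\<lambda>k. U n k x) holomorphic_on D"
proof (rule holomorphic_uniform_sequence[OF open_D iter_hol_k])
  fix k assume x: "x \<in> S" and "k \<in> D"
  then obtain r where r: "r > 0" "cball k r \<subseteq> D" using open_D open_contains_cball by blast
  then have "uniform_limit (cball k r) (\<lambda>j k. iter j n k x) (\<lambda>k. U n k x) sequentially"
    using x by (intro iter_uniform) auto
  then show "\<exists>d>0. cball k d \<subseteq> D \<and> uniform_limit (cball k d) (\<lambda>j k. iter j n k x) (\<lambda>k. U n k x) sequentially"
    using r by blast
qed

definition urhs :: "int \<Rightarrow> complex \<Rightarrow> complex \<Rightarrow> complex" where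
  "urhs n k x = V n x - conv (\<lambda>m. U m k x) (\<lambda>m. U m k x) n"

lemma urhs_hol: "k \<in> D \<Longrightarrow> urhs n k holomorphic_on S"
  unfolding urhs_def[abs_def]
  by (intro holomorphic_intros V_hol conv_holomorphic[OF open_S mlim_int]) (auto intro: U_hol U_le)

lemma urhs_le: "k \<in> D \<Longrightarrow> x \<in> S \<Longrightarrow> norm (urhs n k x) \<le> v n + conv mlim mlim n"
  unfolding urhs_def
  by (rule order_trans[OF norm_triangle_ineq4 add_mono[OF V_le norm_conv_le[OF mlim_int]]]) (auto intro: U_le)

lemma rhs_tendsto:
  assumes k: "k \<in> D" "x \<in> S"
  shows "(\<lambda>j. rhs j n k x) \<longlonglongrightarrow> urhs n k x"
  unfolding rhs_def urhs_def conv_def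
proof (intro tendsto_intros integral_dominated_convergence[where w = "\<lambda>m. mlim m * mlim (n - m)"])
  have l: "norm (iter j n k x) \<le> mlim n" for j n using iter_le[OF k, of j n] maj_le_mlim[of j n] by linarith
  show "AE m in csZ. norm (iter j m k x * iter j (n - m) k x) \<le> mlim m * mlim (n - m)" for j
    by (rule AE_I2) (auto simp: norm_mult intro!: mult_mono l mlim_nonneg)
  show "AE m in csZ. (\<lambda>j. iter j m k x * iter j (n - m) k x) \<longlonglongrightarrow> U m k x * U (n - m) k x"
    by (intro AE_I2 tendsto_intros iter_tendsto k)
qed (auto intro!: integrable_conv_term mlim_int)

text \<open>Limit of the recursion: the integrands converge pointwise and stay below
  \<open>v n\<close> plus the convolution of \<open>mlim\<close> with itself, a bound independent of
  \<open>j\<close>.\<close>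

lemma U_eq:
  assumes k: "k \<in> D" "x \<in> S"
  shows "U n k x = ray_int (dd n) (2 * (of_int n + k)) (urhs n k) x"
proof (rule LIMSEQ_unique)
  show "(\<lambda>j. iter (Suc j) n k x) \<longlonglongrightarrow> U n k x" by (rule LIMSEQ_Suc[OF iter_tendsto[OF k]])
  have le: "norm (rhs j n k y) \<le> v n + conv mlim mlim n" if "y \<in> S" for j y
    by (rule order_trans[OF rhs_le[OF k(1) that]])
       (auto intro!: conv_mono maj_int mlim_int maj_nonneg maj_le_mlim)
  show "(\<lambda>j. iter (Suc j) n k x) \<longlonglongrightarrow> ray_int (dd n) (2 * (of_int n + k)) (urhs n k) x"
    unfolding iter_Suc
    by (rule ray_domain.ray_int_tendsto[OF ray k(2) rhs_cont[OF k(1)] holomorphic_on_imp_continuous_on[OF urhs_hol[OF k(1)]] rhs_tendsto[OF k(1)] le Im_ge[OF k(1)] b])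
qed

lemma U_deriv:
  assumes k: "k \<in> D" "x \<in> S"
  shows "(U n k has_field_derivative urhs n k x - 2 * \<i> * (of_int n + k) * U n k x) (at x)"
proof -
  have "(ray_int (dd n) (2 * (of_int n + k)) (urhs n k) has_field_derivative
      urhs n k x - \<i> * (2 * (of_int n + k)) * ray_int (dd n) (2 * (of_int n + k)) (urhs n k) x) (at x)"
    by (rule ray_domain.ray_int_deriv[OF ray urhs_hol[OF k(1)] urhs_le[OF k(1)] Im_ge[OF k(1)] b dd0 k(2)])
  then have "(ray_int (dd n) (2 * (of_int n + k)) (urhs n k) has_field_derivative
      urhs n k x - 2 * \<i> * (of_int n + k) * U n k x) (at x)"
    using U_eq[OF k] by (simp add: mult_ac)
  then show ?thesis
    by (rule has_field_derivative_transform_within_open[OF _ open_S k(2)]) (use U_eq k in auto)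
qed

end

text \<open>Enumerating the integers by \<open>int_decode\<close> makes termwise differentiation of
  ordinary series available.\<close>

lemma csZ_series:
  fixes f :: "int \<Rightarrow> 'a::{banach,second_countable_topology}"
  assumes "integrable csZ f"
  shows "summable (\<lambda>i. f (int_decode i))" "(\<integral>n. f n \<partial>csZ) = (\<Sum>i. f (int_decode i))"
proof -
  have bij: "bij_betw int_decode UNIV UNIV" by (rule bij_int_decode)
  have i: "integrable (count_space UNIV) (\<lambda>i. f (int_decode i))"
    using integrable_bij_count_space[OF bij, of f] assms by simp
  then show "summable (\<lambda>i. f (int_decode i))"
    unfolding integrable_count_space_nat_iff by (rule summable_norm_cancel)
  have "(\<integral>n. f n \<partial>csZ) = (\<integral>i. f (int_decode i) \<partial>count_space UNIV)"
    using integral_bij_count_space[OF bij, of f] by simp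
  also have "\<dots> = (\<Sum>i. f (int_decode i))" by (rule integral_count_space_nat[OF i])
  finally show "(\<integral>n. f n \<partial>csZ) = (\<Sum>i. f (int_decode i))" .
qed

section \<open>From the modes back to a solution on the real half line\<close>

definition mode :: "int \<Rightarrow> real \<Rightarrow> complex" where
  "mode n x = exp (2 * \<i> * of_int n * of_real x)"

lemma norm_mode [simp]: "norm (mode n x) = 1"
proof -
  have "mode n x = exp (\<i> * of_real (2 * of_int n * x))" by (simp add: mode_def mult_ac)
  then show ?thesis by (simp only: norm_exp_i_times)
qed

lemma mode_mult: "mode m x * mode (n - m) x = mode n x"
  unfolding mode_def by (simp flip: exp_add add: algebra_simps)

lemma mode_deriv: "(mode n has_vector_derivative 2 * \<i> * of_int n * mode n x) (at x)"
proof -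
  have "((\<lambda>w. exp (2 * \<i> * of_int n * w)) has_field_derivative 2 * \<i> * of_int n * exp (2 * \<i> * of_int n * of_real x)) (at (of_real x))"
    by (auto intro!: derivative_eq_intros)
  from has_vector_derivative_real_field[OF this] show ?thesis by (simp add: mode_def[abs_def])
qed

context riccati begin

definition w :: "complex \<Rightarrow> real \<Rightarrow> complex" where
  "w k x = (\<integral>n. U n k (of_real x) * mode n x \<partial>csZ)"

lemma term_le: "k \<in> D \<Longrightarrow> of_real x \<in> S \<Longrightarrow> norm (U n k (of_real x) * mode n x) \<le> mlim n"
  using U_le by (simp add: norm_mult)

lemma term_int: "k \<in> D \<Longrightarrow> of_real x \<in> S \<Longrightarrow> integrable csZ (\<lambda>n. U n k (of_real x) * mode n x)"
  by (rule csZ_bounded_integrable[OF mlim_int]) (rule term_le)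

lemma norm_w_le: "k \<in> D \<Longrightarrow> of_real x \<in> S \<Longrightarrow> norm (w k x) \<le> eps"
  unfolding w_def
  by (rule order_trans[OF norm_integral_le_integral[OF term_int mlim_int] mlim_eps]) (auto intro: term_le)

lemma w_hol: "of_real x \<in> S \<Longrightarrow> (\<lambda>k. w k x) holomorphic_on D"
  unfolding w_def
  by (rule holomorphic_on_lebesgue_integral[OF open_D, where B = mlim])
     (auto intro!: holomorphic_intros U_hol_k mlim_int term_le)

text \<open>Differentiating \<open>mode n\<close> contributes 2 \<i> n U_n, which cancels the same
  term in \<open>U_deriv\<close>. What remains is dominated by \<open>?b\<close> without a factor n,
  so termwise differentiation is possible although the n U_n need not be summable.\<close>

lemma w_deriv:
  assumes T: "open T" "convex T" "\<And>x. x \<in> T \<Longrightarrow> complex_of_real x \<in> S" and x: "x \<in> T" and k: "k \<in> D"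
    and q: "q = (\<integral>n. V n (of_real x) * mode n x \<partial>csZ)"
  shows "(w k has_vector_derivative q - (w k x)\<^sup>2 - 2 * \<i> * k * w k x) (at x)"
proof -
  let ?f = "\<lambda>n x. U n k (of_real x) * mode n x"
  let ?f' = "\<lambda>n x. (urhs n k (of_real x) - 2 * \<i> * k * U n k (of_real x)) * mode n x"
  let ?b = "\<lambda>n. v n + conv mlim mlim n + 2 * norm k * mlim n"
  have bint: "integrable csZ ?b" using v_int integral_conv(1)[OF mlim_int mlim_int] mlim_int by simp
  have d: "(?f n has_vector_derivative ?f' n x) (at x)" if "x \<in> T" for n x
  proof -
    have "((\<lambda>x. U n k (of_real x)) has_vector_derivative (urhs n k (of_real x) - 2 * \<i> * (of_int n + k) * U n k (of_real x))) (at x)"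
      by (rule has_vector_derivative_real_field[OF U_deriv[OF k T(3)[OF that]]])
    from has_vector_derivative_mult[OF this mode_deriv[of n x]]
    show ?thesis by (simp add: algebra_simps)
  qed
  have b: "norm (?f' n x) \<le> ?b n" if "x \<in> T" for n x
  proof -
    have "norm (urhs n k (of_real x) - 2 * \<i> * k * U n k (of_real x)) \<le> (v n + conv mlim mlim n) + 2 * norm k * mlim n"
      by (rule order_trans[OF norm_triangle_ineq4 add_mono[OF urhs_le[OF k T(3)[OF that]]]])
         (auto simp: norm_mult intro!: mult_left_mono U_le k T(3) that)
    then show ?thesis by (simp add: norm_mult)
  qed
  have "((\<lambda>x. \<Sum>i. ?f (int_decode i) x) has_vector_derivative (\<Sum>i. ?f' (int_decode i) x)) (at x)"
  proof (rule has_vector_derivative_suminf[OF T(1,2)])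
    show "norm (?f' (int_decode i) x) \<le> ?b (int_decode i)" if "x \<in> T" for i x by (rule b[OF that])
    show "summable (\<lambda>i. ?b (int_decode i))" by (rule csZ_series[OF bint])
    show "summable (\<lambda>i. ?f (int_decode i) x)" if "x \<in> T" for x by (rule csZ_series[OF term_int[OF k T(3)[OF that]]])
  qed (use d x in auto)
  moreover have "(\<Sum>i. ?f (int_decode i) y) = w k y" if "y \<in> T" for y
    unfolding w_def using csZ_series(2)[OF term_int[OF k T(3)[OF that]]] by simp
  ultimately have 1: "(w k has_vector_derivative (\<Sum>i. ?f' (int_decode i) x)) (at x)"
    using has_vector_derivative_transform_within_open[of "\<lambda>x. \<Sum>i. ?f (int_decode i) x" _ x T "w k"] T(1) x by simp
  have xS: "of_real x \<in> S" by (rule T(3)[OF x])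
  have f'int: "integrable csZ (\<lambda>n. ?f' n x)" by (rule csZ_bounded_integrable[OF bint b[OF x]])
  have Vint: "integrable csZ (\<lambda>n. V n (of_real x) * mode n x)"
    by (rule csZ_bounded_integrable[OF v_int]) (use V_le xS in \<open>simp add: norm_mult\<close>)
  let ?g = "\<lambda>n. U n k (of_real x) * mode n x"
  have gint: "integrable csZ ?g" by (rule term_int[OF k xS])
  \<comment> \<open>By \<open>mode_mult\<close> the exponentials with indices m and n - m combine to
    the one with index n, so multiplying the modes by exponentials commutes with
    convolution.\<close>
  have cv: "conv ?g ?g n = conv (\<lambda>m. U m k (of_real x)) (\<lambda>m. U m k (of_real x)) n * mode n x" for n
  proof -
    have eq: "(\<lambda>m. ?g m * ?g (n - m)) = (\<lambda>m. U m k (of_real x) * U (n - m) k (of_real x) * mode n x)"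
      by (rule ext, subst mode_mult[of _ x n, symmetric]) (simp only: mult_ac)
    show ?thesis unfolding conv_def eq by simp
  qed
  have "(\<Sum>i. ?f' (int_decode i) x) = (\<integral>n. ?f' n x \<partial>csZ)" using csZ_series(2)[OF f'int] by simp
  also have "\<dots> = (\<integral>n. V n (of_real x) * mode n x - conv ?g ?g n - 2 * \<i> * k * ?g n \<partial>csZ)"
    unfolding cv by (rule Bochner_Integration.integral_cong) (auto simp: urhs_def algebra_simps)
  also have "\<dots> = q - (w k x)\<^sup>2 - 2 * \<i> * k * w k x"
    using Vint integral_conv[OF gint gint] gint by (simp add: q w_def power2_eq_square)
  finally show ?thesis using 1 by simp
qed

end

lemma L2_right_of_exp_decay:
  assumes y: "continuous_on UNIV y" and c: "c > 0" and a: "a \<ge> 0"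
    and le: "\<And>x. x \<ge> a \<Longrightarrow> norm (y x) \<le> exp (- c * (x - a))"
  shows "L2_right y"
proof -
  have "compact (y ` {0..a})" by (intro compact_continuous_image continuous_on_subset[OF y]) auto
  from compact_imp_bounded[OF this] obtain M where "\<forall>v\<in>y ` {0..a}. norm v \<le> M" unfolding bounded_iff by blast
  then have M: "\<And>x. x \<in> {0..a} \<Longrightarrow> norm (y x) \<le> M" by simp
  have M0: "M \<ge> 0" by (rule order_trans[OF norm_ge_zero M[of 0]]) (use a in auto)
  let ?C = "(max M 1)\<^sup>2 * exp (2 * c * a)"
  have bd: "indicator {0..} x * (norm (y x))\<^sup>2 \<le> indicator {0..} x * exp (- (2 * c) * x) * ?C" for x :: real
  proof (cases "x \<ge> 0")
    case True
    have "norm (y x) \<le> max M 1 * exp (- c * (x - a))"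
    proof (cases "x \<le> a")
      case xa: True
      have "norm (y x) \<le> max M 1" using M[of x] True xa by auto
      also have "\<dots> = max M 1 * 1" by simp
      also have "\<dots> \<le> max M 1 * exp (- c * (x - a))" by (rule mult_left_mono) (use mult_nonneg_nonneg[of c "a - x"] c xa in \<open>simp_all add: algebra_simps\<close>)
      finally show ?thesis .
    next
      case False
      then have "norm (y x) \<le> 1 * exp (- c * (x - a))" using le by simp
      also have "\<dots> \<le> max M 1 * exp (- c * (x - a))" by (rule mult_right_mono) auto
      finally show ?thesis .
    qed
    then have "(norm (y x))\<^sup>2 \<le> (max M 1 * exp (- c * (x - a)))\<^sup>2" by (rule power_mono) simp
    also have "\<dots> = (max M 1)\<^sup>2 * exp (2 * (- c * (x - a)))"
      by (simp only: power_mult_distrib exp_double)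
    also have "exp (2 * (- c * (x - a))) = exp (- (2 * c) * x) * exp (2 * c * a)"
      by (simp add: exp_add[symmetric] algebra_simps)
    finally have "(norm (y x))\<^sup>2 \<le> exp (- (2 * c) * x) * ?C" by (simp only: mult_ac)
    then show ?thesis using True by simp
  qed simp
  have m: "(\<lambda>x. indicator {0..} x * (norm (y x))\<^sup>2) \<in> borel_measurable lborel"
  proof -
    have "y \<in> borel_measurable borel" by (rule borel_measurable_continuous_onI[OF y])
    then show ?thesis by measurable
  qed
  show ?thesis unfolding L2_right_def
  proof (rule Bochner_Integration.integrable_bound[OF _ m])
    show "integrable lborel (\<lambda>x. indicator {0..} x * exp (- (2 * c) * x) * ?C)"
      by (rule integrable_mult_left[OF integrable_exp_decay(1)]) (use c in simp)
    show "AE x in lborel. norm (indicator {0..} x * (norm (y x))\<^sup>2) \<le> norm (indicator {0..} x * exp (- (2 * c) * x) * ?C)"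
    proof (rule AE_I2)
      fix x :: real
      have "norm (indicator {0..} x * (norm (y x))\<^sup>2) = indicator {0..} x * (norm (y x))\<^sup>2" by simp
      also have "\<dots> \<le> indicator {0..} x * exp (- (2 * c) * x) * ?C" by (rule bd)
      also have "\<dots> \<le> norm (indicator {0..} x * exp (- (2 * c) * x) * ?C)" by simp
      finally show "norm (indicator {0..} x * (norm (y x))\<^sup>2) \<le> norm (indicator {0..} x * exp (- (2 * c) * x) * ?C)" .
    qed
  qed
qed

text \<open>Constancy of the Wronskians with the two standard solutions transports the data from
  \<open>a\<close> to 0 by Cramer's rule; a solution known only on \<open>T\<close> is thus
  identified with a global one.\<close>

lemma csol_eq_local_solution:
  assumes V: "continuous_on UNIV V" and T: "convex T" and a: "a \<in> T"
    and y: "\<And>x. x \<in> T \<Longrightarrow> (y has_vector_derivative y' x) (at x)"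
      "\<And>x. x \<in> T \<Longrightarrow> (y' has_vector_derivative (of_real (V x) - z) * y x) (at x)" and x: "x \<in> T"
  shows "y x = csol V (y a * ivp' V 0 1 z a - y' a * ivp V 0 1 z a) (ivp V 1 0 z a * y' a - ivp' V 1 0 z a * y a) z x"
proof -
  have iv: "(ivp V c d z has_vector_derivative ivp' V c d z x) (at x)"
    "(ivp' V c d z has_vector_derivative (of_real (V x) - z) * ivp V c d z x) (at x)" for c d x
    using ivp_solves[OF V, of z c d] by (auto simp: schr_sol_def)
  have W: "y x * ivp' V c d z x - y' x * ivp V c d z x = y a * ivp' V c d z a - y' a * ivp V c d z a" for c d
  proof -
    have d: "((\<lambda>x. y x * ivp' V c d z x - y' x * ivp V c d z x) has_vector_derivative 0) (at x)" if "x \<in> T" for x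
      by (rule has_vector_derivative_eq_rhs[OF has_vector_derivative_diff[OF has_vector_derivative_mult[OF y(1) iv(2)] has_vector_derivative_mult[OF y(2) iv(1)]]])
         (use that in \<open>auto simp: algebra_simps\<close>)
    obtain e where "\<And>x. x \<in> T \<Longrightarrow> y x * ivp' V c d z x - y' x * ivp V c d z x = e"
      by (rule has_vector_derivative_zero_constant[OF T has_vector_derivative_at_within[OF d]]) auto
    then show ?thesis using a x by simp
  qed
  have "y x = y x * (ivp V 1 0 z x * ivp' V 0 1 z x - ivp' V 1 0 z x * ivp V 0 1 z x)"
    by (simp add: ivp_wronskian[OF V])
  also have "\<dots> = (y x * ivp' V 0 1 z x - y' x * ivp V 0 1 z x) * ivp V 1 0 z x
      - (y x * ivp' V 1 0 z x - y' x * ivp V 1 0 z x) * ivp V 0 1 z x" by (simp add: algebra_simps)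
  also have "\<dots> = (y a * ivp' V 0 1 z a - y' a * ivp V 0 1 z a) * ivp V 1 0 z x
      - (y a * ivp' V 1 0 z a - y' a * ivp V 1 0 z a) * ivp V 0 1 z x" by (simp only: W)
  finally show ?thesis by (simp add: csol_def algebra_simps)
qed

context riccati begin

text \<open>The solution is the exponential of \<i> k (x - a) plus the integral of \<open>w\<close>
  from a to x. Its data at 0 involve \<open>w\<close> only at the single point \<open>a\<close> and
  are therefore holomorphic on all of \<open>D\<close>, also where the solution does not decay. The
  decay rate is at least Im k - eps because |w| \<le> eps.\<close>

lemma jost_solution:
  fixes q :: "real \<Rightarrow> real"
  assumes q: "continuous_on UNIV q" and S: "\<And>x. x > r \<Longrightarrow> complex_of_real x \<in> S" and r: "r \<ge> 0"
    and qV: "\<And>x. x > r \<Longrightarrow> complex_of_real (q x) = (\<integral>n. V n (of_real x) * mode n x \<partial>csZ)"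
  obtains p s where "p holomorphic_on D" "s holomorphic_on D"
    "\<And>k. k \<in> D \<Longrightarrow> Im k > eps \<Longrightarrow> (p k \<noteq> 0 \<or> s k \<noteq> 0) \<and> L2_right (csol q (p k) (s k) (k\<^sup>2))"
proof -
  define a where "a = r + 1"
  define p where "p k = ivp' q 0 1 (k\<^sup>2) a - (\<i> * k + w k a) * ivp q 0 1 (k\<^sup>2) a" for k
  define s where "s k = ivp q 1 0 (k\<^sup>2) a * (\<i> * k + w k a) - ivp' q 1 0 (k\<^sup>2) a" for k
  have hol: "(\<lambda>k. ivp q c d (k\<^sup>2) a) holomorphic_on D" "(\<lambda>k. ivp' q c d (k\<^sup>2) a) holomorphic_on D" for c d
  proof -
    have sq: "(\<lambda>k. k\<^sup>2) holomorphic_on D" by (intro holomorphic_intros)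
    show "(\<lambda>k. ivp q c d (k\<^sup>2) a) holomorphic_on D" "(\<lambda>k. ivp' q c d (k\<^sup>2) a) holomorphic_on D"
      using holomorphic_on_compose_gen[OF sq ivp_holomorphic(1)[OF q, of c d a]]
        holomorphic_on_compose_gen[OF sq ivp_holomorphic(2)[OF q, of c d a]] by (auto simp: comp_def)
  qed
  have aS: "complex_of_real a \<in> S" by (rule S) (simp add: a_def)
  show ?thesis
  proof
    show "p holomorphic_on D" "s holomorphic_on D"
      unfolding p_def s_def by (intro holomorphic_intros hol w_hol aS)+
    fix k assume k: "k \<in> D" and Im: "Im k > eps"
    have wd: "(w k has_vector_derivative q x - (w k x)\<^sup>2 - 2 * \<i> * k * w k x) (at x)" if "x > r" for x
      by (rule w_deriv[of "{r<..}", OF _ _ _ _ k qV]) (use S that in auto)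
    have "isCont (w k) x" if "x > r" for x using has_vector_derivative_continuous[OF wd[OF that]] .
    then have "\<exists>F. \<forall>x. ereal r < ereal x \<longrightarrow> ereal x < \<infinity> \<longrightarrow> (F has_vector_derivative w k x) (at x)"
      by (intro einterval_antiderivative) auto
    then obtain F where F: "\<And>x. x > r \<Longrightarrow> (F has_vector_derivative w k x) (at x)" by auto
    define y where "y x = exp (\<i> * k * of_real (x - a) + (F x - F a))" for x
    define y' where "y' x = (\<i> * k + w k x) * y x" for x
    have y1: "(y has_vector_derivative y' x) (at x)" if "x > r" for x
    proof -
      have "((\<lambda>x. \<i> * k * of_real (x - a)) has_vector_derivative \<i> * k) (at x)"
        by (auto intro!: derivative_eq_intros simp: has_vector_derivative_def scaleR_conv_of_real)
      from has_vector_derivative_add[OF this has_vector_derivative_diff[OF F[OF that] has_vector_derivative_const[of "F a"]]]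
      have "((\<lambda>x. \<i> * k * of_real (x - a) + (F x - F a)) has_vector_derivative \<i> * k + w k x) (at x)" by simp
      from field_vector_diff_chain_at[OF this DERIV_exp]
      show ?thesis by (simp add: y_def[abs_def] y'_def comp_def mult.commute)
    qed
    have y2: "(y' has_vector_derivative (q x - k\<^sup>2) * y x) (at x)" if "x > r" for x
    proof -
      have "((\<lambda>x. (\<i> * k + w k x) * y x) has_vector_derivative
         (\<i> * k + w k x) * y' x + (0 + (q x - (w k x)\<^sup>2 - 2 * \<i> * k * w k x)) * y x) (at x)"
        by (rule has_vector_derivative_mult[OF has_vector_derivative_add[OF has_vector_derivative_const wd[OF that]] y1[OF that]])
      moreover have "(\<i> * k + w k x) * y' x + (0 + (q x - (w k x)\<^sup>2 - 2 * \<i> * k * w k x)) * y x = (q x - k\<^sup>2) * y x"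
        by (simp add: y'_def power2_eq_square algebra_simps)
      ultimately show ?thesis by (simp add: y'_def[abs_def])
    qed
    have ya: "y a = 1" "y' a = \<i> * k + w k a" by (auto simp: y_def y'_def)
    have eq: "y x = csol q (p k) (s k) (k\<^sup>2) x" if "x > r" for x
      using csol_eq_local_solution[OF q, of "{r<..}" a y y' "k\<^sup>2" x] y1 y2 that
      by (simp add: a_def[symmetric] ya p_def s_def) (simp add: a_def)
    have ar: "a > r" by (simp add: a_def)
    have "p k \<noteq> 0 \<or> s k \<noteq> 0"
      using eq[OF ar] ya by (auto simp: csol_def)
    moreover have "L2_right (csol q (p k) (s k) (k\<^sup>2))"
    proof (rule L2_right_of_exp_decay[where c = "Im k - eps" and a = a])
      show "continuous_on UNIV (csol q (p k) (s k) (k\<^sup>2))" by (rule schr_sol_continuous[OF schr_sol_csol[OF q]])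
      show "Im k - eps > 0" using Im by simp
      show "a \<ge> 0" using r by (simp add: a_def)
      fix x assume x: "x \<ge> a"
      have eps0: "eps \<ge> 0" by (rule order_trans[OF norm_ge_zero norm_w_le[OF k aS]])
      have "(w k has_integral F x - F a) {a..x}"
        by (rule fundamental_theorem_of_calculus[OF x]) (use ar in \<open>auto intro!: has_vector_derivative_at_within F\<close>)
      then have "norm (F x - F a) \<le> eps * measure lborel {a..x}"
        using has_integral_bound_real[of eps "{}" "w k" "F x - F a" a x] eps0 norm_w_le[OF k S] ar by simp
      then have "norm (F x - F a) \<le> eps * (x - a)" using x by simp
      then have Re: "Re (F x - F a) \<le> eps * (x - a)" by (rule order_trans[OF complex_Re_le_cmod])
      have "norm (csol q (p k) (s k) (k\<^sup>2) x) = norm (y x)" using eq[of x] x ar by simp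
      also have "\<dots> = exp (- Im k * (x - a) + Re (F x - F a))" by (simp add: y_def)
      also have "\<dots> \<le> exp (- (Im k - eps) * (x - a))" using Re by (simp add: algebra_simps)
      finally show "norm (csol q (p k) (s k) (k\<^sup>2) x) \<le> exp (- (Im k - eps) * (x - a))" .
    qed
    ultimately show "(p k \<noteq> 0 \<or> s k \<noteq> 0) \<and> L2_right (csol q (p k) (s k) (k\<^sup>2))" by simp
  qed
qed

end

section \<open>Jost solutions near a nonthreshold energy\<close>

definition right_sector :: "real \<Rightarrow> real \<Rightarrow> complex set" where
  "right_sector R K = {x. Re x > R \<and> \<bar>Im x\<bar> < K * Re x}"

text \<open>This describes the potential near \<open>+\<infinity>\<close> only; the other end enters
  through the reflected potential. Separating \<open>v n\<close> from the power of Re x bounds the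
  sum over all modes beyond abscissa R by R^(-\<mu>) times the sum of \<open>v\<close>, which is
  small far out.\<close>

definition sector_expansion :: "(real \<Rightarrow> real) \<Rightarrow> bool" where
  "sector_expansion q \<longleftrightarrow> (\<exists>R K \<mu> V v. R > 0 \<and> K > 0 \<and> \<mu> > 0 \<and>
     (\<forall>n. V n holomorphic_on right_sector R K) \<and> integrable csZ v \<and>
     (\<forall>n. \<forall>x\<in>right_sector R K. norm (V n x) \<le> v n * Re x powr (- \<mu>)) \<and>
     (\<forall>x>R. complex_of_real (q x) = (\<integral>n. V n (of_real x) * mode n x \<partial>csZ)))"

lemma open_right_sector: "open (right_sector R K)"
  unfolding right_sector_def
  by (intro open_Collect_conj open_Collect_less continuous_intros)

text \<open>Along slope \<open>s\<close> the height |Im x| grows by at most K t, while the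
  admissible height K Re x grows by K t.\<close>

lemma ray_domain_right_sector:
  assumes "K > 0" "\<bar>s\<bar> \<le> K"
  shows "ray_domain (right_sector R K) (Complex 1 s)"
proof
  show "open (right_sector R K)" by (rule open_right_sector)
  fix x t assume x: "x \<in> right_sector R K" and t: "t \<ge> (0::real)"
  have "\<bar>Im x + s * t\<bar> \<le> \<bar>Im x\<bar> + \<bar>s\<bar> * t" using t by (metis abs_mult abs_of_nonneg abs_triangle_ineq)
  also have "\<dots> < K * Re x + K * t"
    using x assms t by (intro add_less_le_mono mult_right_mono) (auto simp: right_sector_def)
  finally show "x + Complex 1 s * complex_of_real t \<in> right_sector R K"
    using x t by (auto simp: right_sector_def algebra_simps)
qed

lemma nonint_dist:
  fixes k :: real
  assumes "k \<notin> \<int>"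
  obtains \<delta> where "\<delta> > 0" "\<And>n::int. \<bar>of_int n + k\<bar> \<ge> \<delta>"
proof -
  let ?d = "min (frac k) (1 - frac k)"
  have f: "frac k > 0" "frac k < 1" using assms frac_gt_0_iff frac_lt_1 by auto
  have "\<bar>of_int n + k\<bar> \<ge> ?d" for n :: int
  proof -
    have e: "of_int n + k = of_int (n + \<lfloor>k\<rfloor>) + frac k" by (simp add: frac_def)
    consider "n + \<lfloor>k\<rfloor> \<ge> 0" | "n + \<lfloor>k\<rfloor> \<le> -1" by linarith
    then show ?thesis
    proof cases
      case 1
      then have "real_of_int (n + \<lfloor>k\<rfloor>) \<ge> 0" by linarith
      then show ?thesis unfolding e using f by linarith
    next
      case 2
      then have "real_of_int (n + \<lfloor>k\<rfloor>) \<le> -1" by linarith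
      then show ?thesis unfolding e using f by linarith
    qed
  qed
  then show ?thesis using f that[of ?d] by auto
qed

text \<open>The data may depend on \<open>r\<close>. Where Im z > r/2 the square root has imaginary
  part above some \<tau>, and the sector is cut off at an R chosen after r so that eps < \<tau>. The
  region where the continued solution is known to decay then covers that part of the disc.\<close>

lemma local_jost_solution:
  assumes q: "continuous_on UNIV q" and se: "sector_expansion q" and lam: "E0 > 0" "sqrt E0 \<notin> \<int>"
  obtains r0 where "r0 > 0" "\<And>r. 0 < r \<Longrightarrow> r < r0 \<Longrightarrow> \<exists>p s. p holomorphic_on ball (complex_of_real E0) r \<and>
     s holomorphic_on ball (complex_of_real E0) r \<and>
     (\<forall>z\<in>ball (complex_of_real E0) r. Im z > r / 2 \<longrightarrow> (p z \<noteq> 0 \<or> s z \<noteq> 0) \<and> L2_right (csol q (p z) (s z) z))"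
proof -
  obtain R0 K \<mu> V v where *: "R0 > 0 \<and> K > 0 \<and> \<mu> > 0 \<and>
     (\<forall>n. V n holomorphic_on right_sector R0 K) \<and> integrable csZ v \<and>
     (\<forall>n. \<forall>x\<in>right_sector R0 K. norm (V n x) \<le> v n * Re x powr (- \<mu>)) \<and>
     (\<forall>x>R0. complex_of_real (q x) = (\<integral>n. V n (of_real x) * mode n x \<partial>csZ))"
    using se unfolding sector_expansion_def by (elim exE)
  then have se: "R0 > 0" "K > 0" "\<mu> > 0" "\<And>n. V n holomorphic_on right_sector R0 K" "integrable csZ v"
    "\<And>n x. x \<in> right_sector R0 K \<Longrightarrow> norm (V n x) \<le> v n * Re x powr (- \<mu>)"
    "\<And>x. x > R0 \<Longrightarrow> complex_of_real (q x) = (\<integral>n. V n (of_real x) * mode n x \<partial>csZ)" by simp_all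
  define k0 where "k0 = sqrt E0"
  have k0: "k0 > 0" "csqrt (of_real E0) = of_real k0" using lam by (simp_all add: k0_def csqrt_of_real_nonneg)
  obtain \<delta>' where d': "\<delta>' > 0" "\<And>n::int. \<bar>of_int n + k0\<bar> \<ge> \<delta>'" using nonint_dist[of k0] lam(2) by (auto simp: k0_def)
  define \<delta> where "\<delta> = \<delta>' / 2"
  have d: "\<delta> > 0" "\<And>n::int. \<bar>of_int n + k0\<bar> \<ge> 2 * \<delta>" using d' by (auto simp: \<delta>_def)
  \<comment> \<open>The bound \<delta> keeps n + Re k on the same side as n + k0 and at distance at
    least \<delta> from 0; the bound K \<delta>/2 prevents Im k from spending more than half of the
    gain K \<delta> of the tilted ray.\<close>
  define \<rho> where "\<rho> = min \<delta> (K * \<delta> / 2)"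
  have rho: "\<rho> > 0" "\<rho> \<le> \<delta>" "\<rho> \<le> K * \<delta> / 2" using d se by (auto simp: \<rho>_def)
  define D where "D = ball (complex_of_real k0) \<rho>"
  define dd where "dd n = Complex 1 (sgn (of_int n + k0) * K)" for n :: int
  define b where "b = K * \<delta>"
  define A where "A = (1 + K) / b"
  have b: "b > 0" using d se by (simp add: b_def)
  have A: "A > 0" using b se by (simp add: A_def)
  have Im_ge: "Im (2 * (of_int n + k) * dd n) \<ge> b" if "k \<in> D" for k n
  proof -
    have nk: "norm (k - of_real k0) < \<rho>" using that by (simp add: D_def dist_norm norm_minus_commute)
    have re: "\<bar>Re k - k0\<bar> \<le> \<rho>" using abs_Re_le_cmod[of "k - of_real k0"] nk by simp
    have im: "\<bar>Im k\<bar> \<le> \<rho>" using abs_Im_le_cmod[of "k - of_real k0"] nk by simp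
    have s: "sgn (of_int n + k0) * (of_int n + Re k) \<ge> \<delta>"
      using re d(2)[of n] rho d(1) by (cases "of_int n + k0 > 0") (auto simp: sgn_if abs_if split: if_splits)
    have "K * \<delta> \<le> K * (sgn (of_int n + k0) * (of_int n + Re k))" using s se by simp
    then have "Im k + K * (sgn (of_int n + k0) * (of_int n + Re k)) \<ge> K * \<delta> - K * \<delta> / 2" using im rho by linarith
    moreover have "Im (2 * (of_int n + k) * dd n) = 2 * (Im k + K * (sgn (of_int n + k0) * (of_int n + Re k)))"
      by (simp add: dd_def algebra_simps)
    ultimately show ?thesis by (simp add: b_def)
  qed
  have norm_dd: "norm (dd n) \<le> 1 + K" for n
    using cmod_le[of "dd n"] se by (auto simp: dd_def sgn_if abs_mult)
  have cont: "isCont csqrt (complex_of_real E0)" by (rule continuous_at_csqrt) (use lam in auto)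
  obtain r1 where r1: "r1 > 0" "\<And>z. dist z (of_real E0) < r1 \<Longrightarrow> dist (csqrt z) (of_real k0) < \<rho>"
    using cont rho(1) k0(2) unfolding continuous_at_eps_delta by auto
  have I0: "(\<integral>n. v n \<partial>csZ) \<ge> 0"
  proof -
    have "complex_of_real (R0 + 1) \<in> right_sector R0 K" using se by (auto simp: right_sector_def)
    from order_trans[OF norm_ge_zero se(6)[OF this]] have v0: "0 \<le> v n * (R0 + 1) powr (- \<mu>)" for n by simp
    have "(R0 + 1) powr (- \<mu>) > 0" using se(1) by simp
    then have "0 \<le> v n" for n using v0[of n] mult_neg_pos[of "v n"] by (meson not_less)
    then show ?thesis by simp
  qed
  show ?thesis
  \<comment> \<open>A radius below \<open>E0\<close> keeps the disc off the branch cut of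
    \<open>csqrt\<close>; below \<open>r1\<close> its image stays in \<open>D\<close>.\<close>
  proof (rule that[of "min r1 E0"])
    show "min r1 E0 > 0" using r1 lam by simp
    fix r assume r: "0 < r" "r < min r1 E0"
    \<comment> \<open>As Im z = 2 Re k Im k and Re k < k0 + \<rho>, the condition Im z > r/2 forces
      Im k > \<tau>.\<close>
    define \<tau> where "\<tau> = r / (4 * (k0 + \<rho>))"
    have tau: "\<tau> > 0" using r k0 rho by (simp add: \<tau>_def)
    have "((\<lambda>R. 4 * A\<^sup>2 * (R powr (- \<mu>) * (\<integral>n. v n \<partial>csZ))) \<longlongrightarrow> 4 * A\<^sup>2 * (0 * (\<integral>n. v n \<partial>csZ))) at_top"
      "((\<lambda>R. 2 * A * (R powr (- \<mu>) * (\<integral>n. v n \<partial>csZ))) \<longlongrightarrow> 2 * A * (0 * (\<integral>n. v n \<partial>csZ))) at_top"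
      using se(3) by (intro tendsto_intros tendsto_neg_powr filterlim_ident; simp)+
    then have "\<forall>\<^sub>F R in at_top. 4 * A\<^sup>2 * (R powr (- \<mu>) * (\<integral>n. v n \<partial>csZ)) < 1"
      "\<forall>\<^sub>F R in at_top. 2 * A * (R powr (- \<mu>) * (\<integral>n. v n \<partial>csZ)) < \<tau>"
      using tau by (auto elim!: order_tendstoD(2))
    then have "\<forall>\<^sub>F R in at_top. 4 * A\<^sup>2 * (R powr (- \<mu>) * (\<integral>n. v n \<partial>csZ)) < 1 \<and> 2 * A * (R powr (- \<mu>) * (\<integral>n. v n \<partial>csZ)) < \<tau> \<and> R \<ge> R0"
      using eventually_ge_at_top[of R0] by eventually_elim auto
    then obtain R where R: "4 * A\<^sup>2 * (R powr (- \<mu>) * (\<integral>n. v n \<partial>csZ)) < 1" "2 * A * (R powr (- \<mu>) * (\<integral>n. v n \<partial>csZ)) < \<tau>" "R \<ge> R0"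
      using eventually_happens'[OF trivial_limit_at_top_linorder] by blast
    have sub: "right_sector R K \<subseteq> right_sector R0 K" using R(3) by (auto simp: right_sector_def)
    define vR where "vR n = R powr (- \<mu>) * v n" for n
    have Vle: "norm (V n x) \<le> vR n" if "x \<in> right_sector R K" for n x
    proof -
      have vn: "v n * Re x powr (- \<mu>) \<ge> 0" by (rule order_trans[OF norm_ge_zero se(6)]) (use that sub in auto)
      have Rx: "Re x > R" "R > 0" using that R(3) se(1) by (auto simp: right_sector_def)
      have "Re x powr (- \<mu>) \<le> R powr (- \<mu>)" by (rule powr_mono2') (use Rx se(3) in auto)
      moreover have "Re x powr (- \<mu>) > 0" using Rx by simp
      then have "v n \<ge> 0" using vn mult_neg_pos[of "v n"] by (meson not_less)
      ultimately have "v n * Re x powr (- \<mu>) \<le> v n * R powr (- \<mu>)" by (rule mult_left_mono)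
      then show ?thesis using se(6)[of x n] that sub by (auto simp: vR_def mult.commute)
    qed
    interpret riccati "right_sector R K" D dd A b V vR
    proof (rule riccati.intro)
      show "open D" by (simp add: D_def)
      show "ray_domain (right_sector R K) (dd n)" for n
        unfolding dd_def by (rule ray_domain_right_sector) (use se in \<open>auto simp: sgn_if\<close>)
      show "dd n \<noteq> 0" for n by (simp add: dd_def complex_eq_iff)
      show "norm (dd n) / b \<le> A" for n unfolding A_def using norm_dd b by (intro divide_right_mono) auto
      show "V n holomorphic_on right_sector R K" for n by (rule holomorphic_on_subset[OF se(4) sub])
      show "integrable csZ vR" unfolding vR_def using se(5) by simp
      have "complex_of_real (R + 1) \<in> right_sector R K" using se R by (auto simp: right_sector_def)
      then show "vR n \<ge> 0" for n by (rule order_trans[OF norm_ge_zero Vle])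
      show "4 * A\<^sup>2 * (\<integral>n. vR n \<partial>csZ) \<le> 1" using R(1) by (simp add: vR_def)
      show "b > 0" by (rule b)
      show "b \<le> Im (2 * (of_int n + k) * dd n)" if "k \<in> D" for k n by (rule Im_ge[OF that])
      show "norm (V n x) \<le> vR n" if "x \<in> right_sector R K" for n x by (rule Vle[OF that])
    qed
    have eps: "eps < \<tau>" using R(2) by (simp add: eps_def vR_def)
    have "R > 0" using R(3) se(1) by simp
    then obtain p s where ps: "p holomorphic_on D" "s holomorphic_on D"
      "\<And>k. k \<in> D \<Longrightarrow> Im k > eps \<Longrightarrow> (p k \<noteq> 0 \<or> s k \<noteq> 0) \<and> L2_right (csol q (p k) (s k) (k\<^sup>2))"
      using jost_solution[OF q, of R] se(7) R(3) se(2) by (auto simp: right_sector_def)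
    have inD: "csqrt z \<in> D" if "z \<in> ball (complex_of_real E0) r" for z
      using r1(2)[of z] that r by (simp add: D_def dist_commute)
    have pos: "Re z > 0" if "z \<in> ball (complex_of_real E0) r" for z
    proof -
      have "\<bar>Re (z - of_real E0)\<bar> < r" using that abs_Re_le_cmod[of "z - of_real E0"] by (simp add: dist_norm norm_minus_commute)
      then have "E0 - Re z < r" by (simp add: abs_less_iff)
      moreover have "r < E0" using r by simp
      ultimately show ?thesis by linarith
    qed
    have npos: "z \<notin> \<real>\<^sub>\<le>\<^sub>0" if "z \<in> ball (complex_of_real E0) r" for z
      using pos[OF that] by (auto simp: complex_nonpos_Reals_iff)
    have hs: "csqrt holomorphic_on ball (complex_of_real E0) r"
      by (rule holomorphic_on_csqrt'[OF holomorphic_on_ident]) (rule npos)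
    have im: "csqrt ` ball (complex_of_real E0) r \<subseteq> D" using inD by blast
    show "\<exists>p s. p holomorphic_on ball (complex_of_real E0) r \<and> s holomorphic_on ball (complex_of_real E0) r \<and>
     (\<forall>z\<in>ball (complex_of_real E0) r. Im z > r / 2 \<longrightarrow> (p z \<noteq> 0 \<or> s z \<noteq> 0) \<and> L2_right (csol q (p z) (s z) z))"
    proof (intro exI conjI ballI impI)
      show "(p \<circ> csqrt) holomorphic_on ball (complex_of_real E0) r" "(s \<circ> csqrt) holomorphic_on ball (complex_of_real E0) r"
        by (rule holomorphic_on_compose_gen[OF hs ps(1) im], rule holomorphic_on_compose_gen[OF hs ps(2) im])
      fix z assume z: "z \<in> ball (complex_of_real E0) r" and Im: "Im z > r / 2"
      define k where "k = csqrt z"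
      have "\<bar>Re k - k0\<bar> < \<rho>" using inD[OF z, folded k_def] abs_Re_le_cmod[of "k - of_real k0"] by (simp add: D_def dist_norm norm_minus_commute)
      then have Re: "Re k < k0 + \<rho>" by linarith
      have "k\<^sup>2 = z" by (simp add: k_def)
      then have Imz: "Im z = 2 * Re k * Im k" using Im_power2[of k] by simp
      have "Re k \<ge> 0" using csqrt_principal[of z] unfolding k_def[symmetric] by linarith
      moreover have "Re k \<noteq> 0" using Im r Imz by auto
      ultimately have pk: "Re k > 0" "2 * Re k * Im k > r / 2" using Im Imz by auto
      have "Im k > 0"
      proof (rule ccontr)
        assume "\<not> ?thesis"
        then have "2 * Re k * Im k \<le> 0" using pk(1) by (intro mult_nonneg_nonpos) auto
        then show False using pk(2) r by linarith
      qed
      have "r / 2 < 2 * Re k * Im k" by (rule pk)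
      also have "\<dots> \<le> 2 * (k0 + \<rho>) * Im k" using Re \<open>Im k > 0\<close> by (intro mult_right_mono) auto
      finally have "\<tau> < Im k" using k0 rho by (simp add: \<tau>_def field_simps)
      then have "Im k > eps" using eps by simp
      from ps(3)[OF inD[OF z] this[unfolded k_def]]
      show "(p \<circ> csqrt) z \<noteq> 0 \<or> (s \<circ> csqrt) z \<noteq> 0" "L2_right (csol q ((p \<circ> csqrt) z) ((s \<circ> csqrt) z) z)"
        by auto
    qed
  qed
qed

section \<open>Smooth functions and mollifiers\<close>

text \<open>No formula for the higher derivatives is involved, only a family of differentiable
  functions that \<open>deriv\<close> maps into itself.\<close>

lemma smooth_realI:
  assumes "g \<in> F" "\<And>h x. h \<in> F \<Longrightarrow> h field_differentiable (at x)" "\<And>h. h \<in> F \<Longrightarrow> deriv h \<in> F"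
  shows "smooth_real g"
proof -
  have "(deriv ^^ k) g \<in> F" for k using assms(1,3) by (induction k) auto
  then show ?thesis using assms(2) unfolding smooth_real_def by blast
qed

lemma smooth_real_deriv:
  assumes "smooth_real f"
  shows "smooth_real (deriv f)"
  unfolding smooth_real_def
proof (intro allI)
  fix k x
  show "(deriv ^^ k) (deriv f) field_differentiable (at x)"
    using assms[unfolded smooth_real_def, rule_format, of "Suc k" x] by (simp add: funpow_swap1)
qed

lemma smooth_real_DERIV:
  assumes "smooth_real f"
  shows "(f has_real_derivative deriv f x) (at x)"
  using assms[unfolded smooth_real_def, rule_format, of 0 x] by (simp add: DERIV_deriv_iff_field_differentiable)

lemma smooth_real_continuous:
  assumes "smooth_real f"
  shows "continuous_on S f"
  by (intro continuous_at_imp_continuous_on ballI DERIV_isCont[OF smooth_real_DERIV[OF assms]])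

inductive_set ring_span :: "('a \<Rightarrow> real) set \<Rightarrow> ('a \<Rightarrow> real) set" for B where
  gen: "b \<in> B \<Longrightarrow> b \<in> ring_span B"
| add: "f \<in> ring_span B \<Longrightarrow> g \<in> ring_span B \<Longrightarrow> (\<lambda>x. f x + g x) \<in> ring_span B"
| mult: "f \<in> ring_span B \<Longrightarrow> g \<in> ring_span B \<Longrightarrow> (\<lambda>x. f x * g x) \<in> ring_span B"

text \<open>Products differentiate to sums of products, so everything generated by sums and products
  from all derivatives of the generators is closed under \<open>deriv\<close>.\<close>

lemma smooth_real_ring_span:
  assumes B: "\<And>b. b \<in> B \<Longrightarrow> smooth_real b" and f: "f \<in> ring_span B"
  shows "smooth_real f"
proof -
  let ?B = "{(deriv ^^ k) b | k b. b \<in> B}"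
  have *: "\<exists>g'\<in>ring_span ?B. \<forall>x. (g has_real_derivative g' x) (at x)" if "g \<in> ring_span ?B" for g
    using that
  proof induction
    case (gen b)
    then obtain k c where k: "b = (deriv ^^ k) c" "c \<in> B" by blast
    have "(b has_real_derivative deriv b x) (at x)" for x
      using B[OF k(2)] unfolding k(1) smooth_real_def DERIV_deriv_iff_field_differentiable by blast
    moreover have "deriv b \<in> ?B"
      by (intro CollectI exI[of _ "Suc k"] exI[of _ c] conjI k(2)) (simp add: k(1))
    then have "deriv b \<in> ring_span ?B" by (rule ring_span.gen)
    ultimately show ?case by (intro bexI[of _ "deriv b"]) simp_all
  next
    case (add f g)
    then obtain f' g' where "f' \<in> ring_span ?B" "\<forall>x. (f has_real_derivative f' x) (at x)"
      "g' \<in> ring_span ?B" "\<forall>x. (g has_real_derivative g' x) (at x)" by blast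
    then show ?case by (intro bexI[of _ "\<lambda>x. f' x + g' x"]) (auto intro!: DERIV_add ring_span.add)
  next
    case (mult f g)
    then obtain f' g' where fg: "f' \<in> ring_span ?B" "\<forall>x. (f has_real_derivative f' x) (at x)"
      "g' \<in> ring_span ?B" "\<forall>x. (g has_real_derivative g' x) (at x)" by blast
    show ?case
    proof (intro bexI allI)
      show "(\<lambda>x. f' x * g x + g' x * f x) \<in> ring_span ?B" by (intro ring_span.add ring_span.mult fg mult.hyps)
      show "((\<lambda>x. f x * g x) has_real_derivative f' x * g x + g' x * f x) (at x)" for x
        by (rule DERIV_mult) (use fg in auto)
    qed
  qed
  have "f \<in> ring_span ?B" using f
  proof induction
    case (gen b)
    then have "(deriv ^^ 0) b \<in> ?B" by blast
    then show ?case by (simp add: ring_span.gen)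
  qed (auto intro: ring_span.intros)
  then show ?thesis
  proof (rule smooth_realI)
    fix h x assume "h \<in> ring_span ?B"
    from *[OF this] show "h field_differentiable (at x)" unfolding field_differentiable_def by blast
  next
    fix h assume "h \<in> ring_span ?B"
    from *[OF this] obtain g' where g: "g' \<in> ring_span ?B" "\<And>x. (h has_real_derivative g' x) (at x)" by blast
    have "deriv h = g'" by (rule ext) (rule DERIV_imp_deriv[OF g(2)])
    then show "deriv h \<in> ring_span ?B" using g by simp
  qed
qed

lemma smooth_real_mult:
  assumes "smooth_real f" "smooth_real g"
  shows "smooth_real (\<lambda>x. f x * g x)"
  by (rule smooth_real_ring_span[of "{f, g}"]) (use assms in \<open>auto intro: ring_span.intros\<close>)

lemma deriv_funpow_affine:
  assumes "smooth_real f"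
  shows "(deriv ^^ k) (\<lambda>x. c * f (a * x + b)) = (\<lambda>x. c * a ^ k * (deriv ^^ k) f (a * x + b))"
    and "smooth_real (\<lambda>x. c * f (a * x + b))"
proof -
  have d: "((\<lambda>x. c * g (a * x + b)) has_real_derivative c * a * deriv g (a * x + b)) (at x)"
    if "smooth_real g" for g x c
  proof -
    have "((\<lambda>x. g (a * x + b)) has_real_derivative deriv g (a * x + b) * a) (at x)"
      by (rule DERIV_chain2[OF smooth_real_DERIV[OF that]]) (auto intro!: derivative_eq_intros)
    from DERIV_cmult[OF this, of c] show ?thesis by (simp add: mult_ac)
  qed
  have sm: "smooth_real ((deriv ^^ k) f)" for k
    using assms by (induction k) (auto intro: smooth_real_deriv)
  have eq: "(deriv ^^ k) (\<lambda>x. c * f (a * x + b)) = (\<lambda>x. c * a ^ k * (deriv ^^ k) f (a * x + b))" for k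
  proof (induction k)
    case (Suc k)
    have "deriv ((deriv ^^ k) (\<lambda>x. c * f (a * x + b))) = (\<lambda>x. c * a ^ k * a * deriv ((deriv ^^ k) f) (a * x + b))"
      unfolding Suc by (rule ext) (rule DERIV_imp_deriv[OF d[OF sm]])
    then show ?case by (simp add: mult_ac)
  qed simp
  then show "(deriv ^^ k) (\<lambda>x. c * f (a * x + b)) = (\<lambda>x. c * a ^ k * (deriv ^^ k) f (a * x + b))" .
  show "smooth_real (\<lambda>x. c * f (a * x + b))"
    unfolding smooth_real_def eq
    using d[OF sm] unfolding field_differentiable_def by blast
qed

text \<open>For \<open>p = 1\<close> this is the classical function exp(-1/x), extended by 0.
  Polynomial factors in 1/x make the family closed under differentiation.\<close>

definition flat :: "real poly \<Rightarrow> real \<Rightarrow> real" where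
  "flat p x = (if x > 0 then poly p (1 / x) * exp (- (1 / x)) else 0)"

lemma poly_exp_tendsto_0: "((\<lambda>y. poly p y * exp (- y)) \<longlongrightarrow> (0::real)) at_top"
proof (induction p)
  case (pCons a p)
  have *: "((\<lambda>y. y ^ n * (poly p y * exp (- y))) \<longlongrightarrow> (0::real)) at_top" for n
  proof -
    have "(\<lambda>y. y ^ n * (poly p y * exp (- y))) = (\<lambda>y. \<Sum>i\<le>degree p. coeff p i * (y ^ (n + i) / exp y))"
      by (auto simp: poly_altdef sum_distrib_left sum_distrib_right exp_minus divide_inverse power_add mult_ac intro!: sum.cong)
    moreover have "((\<lambda>y. \<Sum>i\<le>degree p. coeff p i * (y ^ (n + i) / exp y)) \<longlongrightarrow> (\<Sum>i\<le>degree p. coeff p i * 0)) at_top"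
      by (intro tendsto_sum tendsto_mult tendsto_const tendsto_power_div_exp_0)
    ultimately show ?thesis by simp
  qed
  have "((\<lambda>y. a * (y ^ 0 / exp y) + y ^ 1 * (poly p y * exp (- y))) \<longlongrightarrow> a * 0 + 0) at_top"
    by (intro tendsto_intros tendsto_power_div_exp_0 *)
  then show ?case by (simp add: exp_minus divide_inverse algebra_simps)
qed simp

text \<open>In y = 1/x one has d/dx = - y^2 d/dy, which sends p(y) exp(-y) to y^2 (p - p')(y)
  exp(-y); \<open>[:0, 0, 1:]\<close> is the polynomial y^2. At 0 the exponential beats every power
  of 1/x.\<close>

lemma flat_deriv: "(flat p has_real_derivative flat ([:0, 0, 1:] * (p - pderiv p)) x) (at x)"
proof -
  let ?q = "[:0, 0, 1:] * (p - pderiv p)"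
  consider "x > 0" | "x < 0" | "x = 0" by linarith
  then show ?thesis
  proof cases
    case 1
    have "((\<lambda>x. poly p (1 / x) * exp (- (1 / x))) has_real_derivative
       poly (pderiv p) (1 / x) * (- 1 / x\<^sup>2) * exp (- (1 / x)) + exp (- (1 / x)) * (1 / x\<^sup>2) * poly p (1 / x)) (at x)"
      using 1 by (auto intro!: derivative_eq_intros DERIV_chain2[OF poly_DERIV] simp: power2_eq_square)
    moreover have "poly (pderiv p) (1 / x) * (- 1 / x\<^sup>2) * exp (- (1 / x)) + exp (- (1 / x)) * (1 / x\<^sup>2) * poly p (1 / x) = flat ?q x"
      using 1 by (simp add: flat_def power2_eq_square algebra_simps)
    ultimately have "((\<lambda>x. poly p (1 / x) * exp (- (1 / x))) has_real_derivative flat ?q x) (at x)" by simp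
    then show ?thesis
      by (rule has_field_derivative_transform_within_open[where S = "{0<..}"]) (use 1 in \<open>auto simp: flat_def\<close>)
  next
    case 2
    have "((\<lambda>x. 0) has_real_derivative flat ?q x) (at x)" using 2 by (simp add: flat_def)
    then show ?thesis
      by (rule has_field_derivative_transform_within_open[where S = "{..<0}"]) (use 2 in \<open>auto simp: flat_def\<close>)
  next
    case 3
    have r: "((\<lambda>h. flat p h / h) \<longlongrightarrow> 0) (at_right 0)"
    proof -
      have "((\<lambda>h. poly ([:0, 1:] * p) (inverse h) * exp (- inverse h)) \<longlongrightarrow> 0) (at_right (0::real))"
        by (rule filterlim_compose[OF poly_exp_tendsto_0 filterlim_inverse_at_top_right])
      moreover have "\<forall>\<^sub>F h in at_right (0::real). poly ([:0, 1:] * p) (inverse h) * exp (- inverse h) = flat p h / h"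
        by (rule eventually_at_rightI[of 0 1]) (auto simp: flat_def divide_inverse)
      ultimately show ?thesis by (rule Lim_transform_eventually)
    qed
    have l: "((\<lambda>h. flat p h / h) \<longlongrightarrow> 0) (at_left 0)"
      by (rule Lim_transform_eventually[OF tendsto_const])
         (rule eventually_at_leftI[of "-1" 0], auto simp: flat_def)
    have "((\<lambda>h. flat p h / h) \<longlongrightarrow> 0) (at 0)" by (rule filterlim_split_at[OF l r])
    then show ?thesis unfolding 3 by (simp add: DERIV_def flat_def)
  qed
qed

lemma flat_smooth: "smooth_real (flat p)"
proof (rule smooth_realI[of _ "range flat"])
  show "h field_differentiable (at x)" if "h \<in> range flat" for h x
    using that flat_deriv unfolding field_differentiable_def by blast
  show "deriv h \<in> range flat" if h: "h \<in> range flat" for h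
  proof -
    obtain p where "h = flat p" using h by blast
    then have "deriv h = flat ([:0, 0, 1:] * (p - pderiv p))" using DERIV_imp_deriv[OF flat_deriv] by blast
    then show ?thesis by simp
  qed
qed simp

lemma mollifier_exists:
  fixes \<epsilon> :: real
  assumes "\<epsilon> > 0"
  obtains \<phi> where "smooth_real \<phi>" "\<And>x. \<phi> x \<ge> 0" "\<And>x. \<bar>x\<bar> \<ge> \<epsilon> \<Longrightarrow> \<phi> x = 0" "integrable lborel \<phi>" "(\<integral>x. \<phi> x \<partial>lborel) = 1"
proof -
  \<comment> \<open>Positive exactly on the open interval of radius \<epsilon> about 0. The explicit
    constants put both factors into the form of \<open>deriv_funpow_affine\<close>.\<close>
  define f where "f x = (1 * flat 1 (1 * x + \<epsilon>)) * (1 * flat 1 ((-1) * x + \<epsilon>))" for x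
  have sf: "smooth_real f" unfolding f_def[abs_def]
    by (intro smooth_real_mult deriv_funpow_affine(2) flat_smooth)
  have f0: "f x \<ge> 0" for x by (simp add: f_def flat_def)
  have fz: "f x = 0" if "\<bar>x\<bar> \<ge> \<epsilon>" for x using that by (auto simp: f_def flat_def)
  have fp: "f x > 0" if "\<bar>x\<bar> < \<epsilon>" for x using that by (auto simp: f_def flat_def)
  have cf: "continuous_on UNIV f" by (rule smooth_real_continuous[OF sf])
  have mf: "f \<in> borel_measurable borel" by (rule borel_measurable_continuous_onI[OF cf])
  have "set_integrable lborel {-\<epsilon>..\<epsilon>} f"
    by (rule borel_integrable_atLeastAtMost'[OF continuous_on_subset[OF cf]]) auto
  moreover have "(\<lambda>x. indicator {-\<epsilon>..\<epsilon>} x *\<^sub>R f x) = f" using fz by (force simp: indicator_def)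
  ultimately have i: "integrable lborel f" by (simp add: set_integrable_def)
  have "(\<integral>x. f x \<partial>lborel) \<noteq> 0"
  proof
    assume "(\<integral>x. f x \<partial>lborel) = 0"
    then have "AE x in lborel. f x = 0" using integral_nonneg_eq_0_iff_AE[OF i] f0 by simp
    then have "AE x in lborel. x \<notin> {-\<epsilon><..<\<epsilon>}"
    proof eventually_elim
      case (elim x)
      then show ?case using fp[of x] by (auto simp: abs_less_iff)
    qed
    moreover have "{x. - \<epsilon> < x \<and> x < \<epsilon>} = {-\<epsilon><..<\<epsilon>}" by auto
    ultimately have "emeasure lborel {-\<epsilon><..<\<epsilon>} = 0"
      using AE_iff_measurable[of "{-\<epsilon><..<\<epsilon>}" lborel "\<lambda>x. x \<notin> {-\<epsilon><..<\<epsilon>}"] by auto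
    then show False using assms by simp
  qed
  moreover have "(\<integral>x. f x \<partial>lborel) \<ge> 0" using f0 by simp
  ultimately have I: "(\<integral>x. f x \<partial>lborel) > 0" by simp
  show ?thesis
  proof
    let ?c = "1 / (\<integral>x. f x \<partial>lborel)"
    show "smooth_real (\<lambda>x. ?c * f (1 * x + 0))" by (rule deriv_funpow_affine(2)[OF sf])
  qed (use f0 fz i I in auto)
qed

section \<open>Fourier expansion of the potential\<close>

lemma periodic_int:
  fixes h :: "real \<Rightarrow> 'a"
  assumes "\<And>x. h (x + p) = h x"
  shows "h (x + of_int m * p) = h x"
proof -
  have n: "h (x + of_nat n * p) = h x" for n x
  proof (induction n)
    case (Suc n)
    have "h (x + of_nat (Suc n) * p) = h ((x + of_nat n * p) + p)" by (simp add: algebra_simps)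
    then show ?case using assms Suc by simp
  qed simp
  show ?thesis
  proof (cases "m \<ge> 0")
    case True
    then show ?thesis using n[of x "nat m"] by simp
  next
    case False
    then show ?thesis using n[of "x + of_int m * p" "nat (- m)"] by simp
  qed
qed

section \<open>Trigonometric approximation and completeness of the modes\<close>

lemma mode_0 [simp]: "mode 0 x = 1" by (simp add: mode_def)

lemma mode_add: "mode m x * mode n x = mode (m + n) x"
  unfolding mode_def by (simp flip: exp_add add: algebra_simps)

lemma continuous_on_mode [continuous_intros]: "continuous_on A (mode n)"
  unfolding mode_def[abs_def] by (intro continuous_intros)

lemma mode_period: "mode n (x + pi) = mode n x"
proof -
  have e: "exp ((2 * of_int n * of_real pi) * \<i>) = (1::complex)" by (auto simp: exp_eq_1)
  have "mode n (x + pi) = mode n x * exp ((2 * of_int n * of_real pi) * \<i>)"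
    unfolding mode_def exp_add[symmetric] by (rule arg_cong[where f = exp]) (simp add: algebra_simps)
  then show ?thesis unfolding e by simp
qed

text \<open>A \<pi>-periodic function factors through the circle by x -> exp(2 \<i> x), where
  Stone-Weierstrass applies. Continuity across the cut of \<open>Arg\<close> is seen from the second
  formula \<open>H2\<close>, whose cut lies on the opposite side.\<close>

lemma periodic_approx_poly:
  fixes r :: "real \<Rightarrow> real"
  assumes r: "continuous_on UNIV r" and p: "\<And>x. r (x + pi) = r x" and e: "e > 0"
  obtains g where "real_polynomial_function g" "\<And>x. \<bar>r x - g (mode 1 x)\<bar> < e"
proof -
  define H where "H w = r (Arg w / 2)" for w
  have H2: "H w = r (Arg (- w) / 2 + pi / 2)" if "w \<noteq> 0" for w
  proof (cases "Arg w \<le> 0")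
    case True
    then have "Arg (- w) = Arg w + pi" using Arg_minus[OF that] by simp
    then have "Arg (- w) / 2 + pi / 2 = Arg w / 2 + pi" by (simp add: field_simps)
    then show ?thesis using p by (simp add: H_def)
  next
    case False
    then have "Arg (- w) = Arg w - pi" using Arg_minus[OF that] by simp
    then have eq: "Arg (- w) / 2 + pi / 2 = Arg w / 2" by (simp add: field_simps)
    show ?thesis unfolding H_def eq ..
  qed
  have c: "isCont r x" for x using r by (simp add: continuous_on_eq_continuous_at)
  have "isCont H w" if "w \<in> sphere 0 1" for w
  proof (cases "w \<in> \<real>\<^sub>\<le>\<^sub>0")
    case False
    have "isCont (\<lambda>w. Arg w / 2) w" using continuous_at_Arg[OF False] by (intro continuous_intros) auto
    then show ?thesis unfolding H_def[abs_def] by (rule isCont_o2) (rule c)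
  next
    case True
    have w0: "w \<noteq> 0" using that by auto
    have "- w \<notin> \<real>\<^sub>\<le>\<^sub>0" using True w0 by (auto simp: complex_nonpos_Reals_iff complex_eq_iff)
    then have "isCont Arg (- w)" by (rule continuous_at_Arg)
    then have "isCont (\<lambda>w. Arg (- w)) w" by (intro isCont_o2[where f = uminus and g = Arg]) (auto intro: continuous_intros)
    then have "isCont (\<lambda>w. Arg (- w) / 2 + pi / 2) w" by (intro continuous_intros) auto
    then have 1: "isCont (\<lambda>w. r (Arg (- w) / 2 + pi / 2)) w" by (rule isCont_o2) (rule c)
    have "\<forall>\<^sub>F v in nhds w. H v = r (Arg (- v) / 2 + pi / 2)"
      using t1_space_nhds[OF w0] by eventually_elim (rule H2)
    then show ?thesis using 1 isCont_cong[of H] by simp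
  qed
  then have "continuous_on (sphere 0 1) H" by (intro continuous_at_imp_continuous_on) blast
  then obtain g where g: "real_polynomial_function g" "\<And>w. w \<in> sphere 0 1 \<Longrightarrow> \<bar>H w - g w\<bar> < e"
    using Stone_Weierstrass_real_polynomial_function[OF compact_sphere _ e] by blast
  have "H (mode 1 x) = r x" for x
  proof -
    let ?w = "mode 1 x"
    have "?w \<noteq> 0" using norm_mode[of 1 x] by (metis norm_zero zero_neq_one)
    then have "?w = exp (\<i> * of_real (Arg ?w))" using Arg_eq[of ?w] by simp
    then have "exp (\<i> * of_real (Arg ?w)) = exp (2 * \<i> * of_int 1 * of_real x)" by (simp add: mode_def)
    then obtain m :: int where "\<i> * of_real (Arg ?w) = 2 * \<i> * of_int 1 * of_real x + (of_int (2 * m) * of_real pi) * \<i>"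
      unfolding exp_eq by auto
    then have "\<i> * of_real (Arg ?w) = \<i> * of_real (2 * x + 2 * of_int m * pi)" by (simp add: algebra_simps)
    then have "Arg ?w = 2 * x + 2 * of_int m * pi" by (simp only: mult_cancel_left complex_i_not_zero of_real_eq_iff) simp
    then have "Arg ?w / 2 = x + of_int m * pi" by simp
    then have "H ?w = r (x + of_int m * pi)" by (simp only: H_def)
    also have "\<dots> = r x" by (rule periodic_int[of r pi, OF p])
    finally show ?thesis .
  qed
  then show ?thesis using that[OF g(1)] g(2)[of "mode 1 _"] by (metis dist_0_norm mem_sphere norm_mode)
qed

text \<open>This links the real polynomials in the plane supplied by Stone-Weierstrass with
  trigonometric polynomials.\<close>

lemma real_linear_mode:
  assumes "bounded_linear f"
  shows "complex_of_real (f (mode 1 x)) = (f 1 - \<i> * f \<i>) / 2 * mode 1 x + (f 1 + \<i> * f \<i>) / 2 * mode (-1) x"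
proof -
  interpret bounded_linear f by fact
  have m: "mode (-1) x = cnj (mode 1 x)" by (simp add: mode_def exp_cnj)
  have "f (mode 1 x) = f (Re (mode 1 x) *\<^sub>R 1 + Im (mode 1 x) *\<^sub>R \<i>)"
    by (rule arg_cong[where f = f]) (simp add: complex_eq_iff)
  also have "\<dots> = Re (mode 1 x) * f 1 + Im (mode 1 x) * f \<i>" by (simp add: add scaleR)
  finally show ?thesis unfolding m by (simp add: complex_eq_iff field_simps)
qed

lemma continuous_real_polynomial_mode:
  assumes "real_polynomial_function g"
  shows "continuous_on A (\<lambda>x. g (mode 1 x))"
proof -
  have "continuous_on UNIV g"
    by (intro continuous_at_imp_continuous_on ballI continuous_real_polymonial_function assms)
  then show ?thesis by (rule continuous_on_compose2) (auto intro: continuous_on_mode)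
qed

text \<open>\<open>h\<close> varies in the induction: if \<open>h\<close> is orthogonal to all
  modes, so is \<open>h\<close> times a polynomial in the first mode, and a product of polynomials
  is absorbed one factor at a time.\<close>

lemma orthogonal_real_polynomial:
  fixes h :: "real \<Rightarrow> complex"
  assumes h: "continuous_on {0..pi} h" and g: "real_polynomial_function g"
    and o: "\<And>m. integral {0..pi} (\<lambda>x. h x * mode m x) = 0"
  shows "integral {0..pi} (\<lambda>x. h x * of_real (g (mode 1 x)) * mode m x) = 0"
  using g h o
proof (induction g arbitrary: h m)
  case (linear f)
  note h = linear.prems(1) and o = linear.prems(2)
  let ?a = "(f 1 - \<i> * f \<i>) / 2" and ?b = "(f 1 + \<i> * f \<i>) / 2"
  have i: "(\<lambda>x. h x * mode m x) integrable_on {0..pi}" for m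
    by (intro integrable_continuous_real continuous_intros h)
  have "(\<lambda>x. h x * of_real (f (mode 1 x)) * mode m x) = (\<lambda>x. ?a * (h x * mode (1 + m) x) + ?b * (h x * mode (-1 + m) x))"
    unfolding real_linear_mode[OF linear.hyps] mode_add[symmetric] by (rule ext) (simp add: algebra_simps)
  then show ?case
    using o i by (simp add: Henstock_Kurzweil_Integration.integral_add integrable_on_mult_right)
next
  case (const c)
  have "(\<lambda>x. h x * of_real c * mode m x) = (\<lambda>x. of_real c * (h x * mode m x))" by (auto simp: mult_ac)
  then show ?case using const by simp
next
  case (add f g)
  note h = add.prems(1) and o = add.prems(2)
  have i: "(\<lambda>x. h x * of_real (f (mode 1 x)) * mode m x) integrable_on {0..pi}"
    "(\<lambda>x. h x * of_real (g (mode 1 x)) * mode m x) integrable_on {0..pi}"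
    by (intro integrable_continuous_real continuous_intros h continuous_real_polynomial_mode add.hyps)+
  show ?case using add.IH[OF h o, of m] Henstock_Kurzweil_Integration.integral_add[OF i] by (simp add: algebra_simps)
next
  case (mult f g)
  note h = mult.prems(1) and o = mult.prems(2)
  have "continuous_on {0..pi} (\<lambda>x. h x * of_real (f (mode 1 x)))"
    by (intro continuous_intros h continuous_real_polynomial_mode mult.hyps)
  from mult.IH(2)[OF this mult.IH(1)[OF h o]]
  show ?case by (simp add: mult.assoc)
qed

text \<open>By uniform approximation \<open>h\<close> is orthogonal to every real continuous
  \<pi>-periodic function, in particular to its own real and imaginary parts, so the integrals of
  their squares vanish.\<close>

lemma orthogonal_modes_imp_zero:
  fixes h :: "real \<Rightarrow> complex"
  assumes h: "continuous_on UNIV h" and p: "\<And>x. h (x + pi) = h x"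
    and o: "\<And>m. integral {0..pi} (\<lambda>x. h x * mode m x) = 0"
  shows "h x = 0"
proof -
  have key: "integral {0..pi} (\<lambda>x. h x * of_real (r x)) = 0"
    if r: "continuous_on UNIV r" "\<And>x. r (x + pi) = r x" for r :: "real \<Rightarrow> real"
  proof -
    have "compact (h ` {0..pi})" by (intro compact_continuous_image continuous_on_subset[OF h]) auto
    from compact_imp_bounded[OF this] obtain M where "\<forall>v\<in>h ` {0..pi}. norm v \<le> M" unfolding bounded_iff by blast
    then have M: "\<And>x. x \<in> {0..pi} \<Longrightarrow> norm (h x) \<le> M" by simp
    have M0: "M \<ge> 0" by (rule order_trans[OF norm_ge_zero M[of 0]]) auto
    have "norm (integral {0..pi} (\<lambda>x. h x * of_real (r x))) \<le> M * pi * e" if e: "e > 0" for e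
    proof -
      obtain g where g: "real_polynomial_function g" "\<And>x. \<bar>r x - g (mode 1 x)\<bar> < e"
        using periodic_approx_poly[OF r e] by blast
      have c: "continuous_on {0..pi} h" "continuous_on {0..pi} r" "continuous_on {0..pi} (\<lambda>x. g (mode 1 x))"
        using h r(1) continuous_on_subset continuous_real_polynomial_mode[OF g(1)] by blast+
      have i1: "(\<lambda>x. h x * of_real (r x)) integrable_on {0..pi}" "(\<lambda>x. h x * of_real (g (mode 1 x))) integrable_on {0..pi}"
        by (intro integrable_continuous_real continuous_intros c)+
      have z: "integral {0..pi} (\<lambda>x. h x * of_real (g (mode 1 x))) = 0"
        using orthogonal_real_polynomial[OF c(1) g(1) o, of 0] by simp
      have "integral {0..pi} (\<lambda>x. h x * of_real (r x)) = integral {0..pi} (\<lambda>x. h x * of_real (r x) - h x * of_real (g (mode 1 x)))"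
        using Henstock_Kurzweil_Integration.integral_diff[OF i1] z by simp
      also have "norm \<dots> \<le> integral {0..pi} (\<lambda>x. M * e)"
      proof (rule Henstock_Kurzweil_Integration.integral_norm_bound_integral)
        fix x assume x: "x \<in> {0..pi}"
        have "norm (h x * of_real (r x) - h x * of_real (g (mode 1 x))) = norm (h x) * \<bar>r x - g (mode 1 x)\<bar>"
          by (simp flip: right_diff_distrib of_real_diff add: norm_mult)
        also have "\<dots> \<le> M * e" using M[OF x] g(2)[of x] M0 by (intro mult_mono) auto
        finally show "norm (h x * of_real (r x) - h x * of_real (g (mode 1 x))) \<le> M * e" .
      qed (auto intro!: integrable_diff i1)
      finally show ?thesis by (simp add: mult_ac)
    qed
    then have "norm (integral {0..pi} (\<lambda>x. h x * of_real (r x))) \<le> 0"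
    proof -
      assume *: "\<And>e. e > 0 \<Longrightarrow> norm (integral {0..pi} (\<lambda>x. h x * of_real (r x))) \<le> M * pi * e"
      show ?thesis
      proof (rule field_le_epsilon)
        fix e :: real assume e: "e > 0"
        have pos: "M * pi + 1 > 0" using M0 by (simp add: add_nonneg_pos)
        define d where "d = e / (M * pi + 1)"
        have d: "d > 0" "(M * pi + 1) * d = e" using e pos by (simp_all add: d_def)
        have "norm (integral {0..pi} (\<lambda>x. h x * of_real (r x))) \<le> M * pi * d" by (rule *[OF d(1)])
        also have "\<dots> \<le> (M * pi + 1) * d" using d(1) by (simp add: algebra_simps)
        also have "\<dots> = e" by (rule d)
        finally show "norm (integral {0..pi} (\<lambda>x. h x * of_real (r x))) \<le> 0 + e" by simp
      qed
    qed
    then show ?thesis by simp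
  qed
  have cR: "continuous_on UNIV (\<lambda>x. Re (h x))" "continuous_on UNIV (\<lambda>x. Im (h x))"
    using h by (auto intro!: continuous_intros)
  have c0: "continuous_on {0..pi} h" using h continuous_on_subset by blast
  have re: "integral {0..pi} (\<lambda>x. (Re (h x))\<^sup>2) = 0"
  proof -
    have i: "(\<lambda>x. h x * of_real (Re (h x))) integrable_on {0..pi}"
      by (intro integrable_continuous_real continuous_intros c0)
    have "integral {0..pi} (\<lambda>x. Re (h x * of_real (Re (h x)))) = Re (integral {0..pi} (\<lambda>x. h x * of_real (Re (h x))))"
      using integral_linear[OF i bounded_linear_Re] by (simp add: comp_def)
    also have "\<dots> = 0" using key[OF cR(1)] p by simp
    finally show ?thesis by (simp add: power2_eq_square)
  qed
  have im: "integral {0..pi} (\<lambda>x. (Im (h x))\<^sup>2) = 0"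
  proof -
    have i: "(\<lambda>x. h x * of_real (Im (h x))) integrable_on {0..pi}"
      by (intro integrable_continuous_real continuous_intros c0)
    have "integral {0..pi} (\<lambda>x. Im (h x * of_real (Im (h x)))) = Im (integral {0..pi} (\<lambda>x. h x * of_real (Im (h x))))"
      using integral_linear[OF i bounded_linear_Im] by (simp add: comp_def)
    also have "\<dots> = 0" using key[OF cR(2)] p by simp
    finally show ?thesis by (simp add: power2_eq_square)
  qed
  have z: "h x = 0" if "x \<in> {0..pi}" for x
  proof -
    have "continuous_on {0..pi} (\<lambda>x. (Re (h x))\<^sup>2)" "continuous_on {0..pi} (\<lambda>x. (Im (h x))\<^sup>2)"
      by (intro continuous_intros c0)+
    then have "(Re (h x))\<^sup>2 = 0" "(Im (h x))\<^sup>2 = 0"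
      using re im that integral_eq_0_iff[of 0 pi "\<lambda>x. (Re (h x))\<^sup>2"] integral_eq_0_iff[of 0 pi "\<lambda>x. (Im (h x))\<^sup>2"] by auto
    then show ?thesis by (simp add: complex_eq_iff)
  qed
  define m where "m = \<lfloor>x / pi\<rfloor>"
  have "h x = h ((x - m * pi) + of_int m * pi)" by simp
  also have "\<dots> = h (x - m * pi)" by (rule periodic_int[of h pi, OF p])
  also have "\<dots> = 0"
  proof (rule z)
    have "of_int m \<le> x / pi" "x / pi < of_int m + 1" unfolding m_def by linarith+
    then have "of_int m * pi \<le> x" "x < (of_int m + 1) * pi" by (simp_all add: pos_le_divide_eq pos_divide_less_eq)
    then show "x - m * pi \<in> {0..pi}" by (simp add: algebra_simps)
  qed
  finally show ?thesis .
qed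

lemma integral_mode: "integral {0..pi} (mode n) = (if n = 0 then of_real pi else 0)"
proof (cases "n = 0")
  case True
  then have "mode n = (\<lambda>x. 1)" by (auto simp: mode_def)
  then show ?thesis using True by (simp add: scaleR_conv_of_real)
next
  case False
  have "(mode n has_integral (1 / (2 * \<i> * of_int n)) * mode n pi - (1 / (2 * \<i> * of_int n)) * mode n 0) {0..pi}"
  proof (rule fundamental_theorem_of_calculus)
    fix x :: real
    have "((\<lambda>x. (1 / (2 * \<i> * of_int n)) * mode n x) has_vector_derivative (1 / (2 * \<i> * of_int n)) * (2 * \<i> * of_int n * mode n x)) (at x)"
      by (rule has_vector_derivative_mult_right[OF mode_deriv])
    then show "((\<lambda>x. (1 / (2 * \<i> * of_int n)) * mode n x) has_vector_derivative mode n x) (at x within {0..pi})"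
      using False by (simp add: has_vector_derivative_at_within)
  qed simp
  moreover have "mode n pi = mode n 0" using mode_period[of n 0] by simp
  ultimately show ?thesis using False by (simp add: integral_unique)
qed

text \<open>Absolute summability makes the Fourier series converge uniformly to a continuous
  \<pi>-periodic function; its difference from \<open>s\<close> has vanishing coefficients and is
  zero by completeness.\<close>

lemma fourier_inversion:
  assumes "periodic_factor s"
  shows "integrable csZ (fourier_coeff_pi s)"
    "complex_of_real (s x) = (\<integral>n. fourier_coeff_pi s n * mode n x \<partial>csZ)"
proof -
  let ?c = "fourier_coeff_pi s"
  have s: "continuous_on UNIV s" "\<And>x. s (x + pi) = s x" "(\<lambda>n. norm (?c n)) summable_on UNIV"
    using assms by (auto simp: periodic_factor_def)
  have "Infinite_Set_Sum.abs_summable_on ?c UNIV" using s(3) by (simp add: abs_summable_equivalent)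
  then show i: "integrable csZ ?c" by (simp add: Infinite_Set_Sum.abs_summable_on_def)
  have ix: "integrable csZ (\<lambda>n. ?c n * mode n x)" for x
    by (rule Bochner_Integration.integrable_bound[OF integrable_norm[OF i]]) (auto simp: norm_mult)
  let ?S = "\<lambda>x. \<Sum>i. ?c (int_decode i) * mode (int_decode i) x"
  define h where "h x = complex_of_real (s x) - ?S x" for x
  have ul: "uniform_limit A (\<lambda>n x. \<Sum>i<n. ?c (int_decode i) * mode (int_decode i) x) ?S sequentially" for A
  proof (rule Weierstrass_m_test[where M = "\<lambda>i. norm (?c (int_decode i))"])
    show "summable (\<lambda>i. norm (?c (int_decode i)))" by (rule csZ_series(1)[OF integrable_norm[OF i]])
  qed (simp add: norm_mult)
  have cS: "continuous_on UNIV ?S"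
    by (rule uniform_limit_theorem[OF _ ul]) (auto intro!: always_eventually continuous_intros)
  have "h x = 0" for x
  proof (rule orthogonal_modes_imp_zero)
    show "continuous_on UNIV h" unfolding h_def[abs_def] by (intro continuous_intros s cS)
    show "h (x + pi) = h x" for x by (simp add: h_def s mode_period)
    fix m :: int
    have cm: "continuous_on {0..pi} (mode m)" by (rule continuous_on_mode)
    have "bounded (mode m ` {0..pi})" by (auto simp: bounded_iff)
    have ul': "uniform_limit {0..pi} (\<lambda>n x. \<Sum>i<n. ?c (int_decode i) * mode (int_decode i + m) x) (\<lambda>x. ?S x * mode m x) sequentially"
    proof -
      have "(\<lambda>x. ?S x * mode m x) = (\<lambda>x. \<Sum>i. ?c (int_decode i) * mode (int_decode i + m) x)"
        using csZ_series(1)[OF ix] by (intro ext) (simp add: suminf_mult2 mult.assoc mode_add)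
      moreover have "uniform_limit {0..pi} (\<lambda>n x. \<Sum>i<n. ?c (int_decode i) * mode (int_decode i + m) x) (\<lambda>x. \<Sum>i. ?c (int_decode i) * mode (int_decode i + m) x) sequentially"
      proof (rule Weierstrass_m_test[where M = "\<lambda>i. norm (?c (int_decode i))"])
        show "summable (\<lambda>i. norm (?c (int_decode i)))" by (rule csZ_series(1)[OF integrable_norm[OF i]])
      qed (simp add: norm_mult)
      ultimately show ?thesis by simp
    qed
    obtain I J where IJ: "\<And>n. ((\<lambda>x. \<Sum>i<n. ?c (int_decode i) * mode (int_decode i + m) x) has_integral I n) {0..pi}"
      "((\<lambda>x. ?S x * mode m x) has_integral J) {0..pi}" "I \<longlonglongrightarrow> J"
      by (rule uniform_limit_integral[OF ul']) (auto intro!: continuous_intros)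
    have "I n = (\<Sum>i<n. ?c (int_decode i) * (if int_decode i + m = 0 then of_real pi else 0))" for n
    proof -
      have "I n = integral {0..pi} (\<lambda>x. \<Sum>i<n. ?c (int_decode i) * mode (int_decode i + m) x)"
        using IJ(1)[of n] by (simp add: integral_unique)
      also have "\<dots> = (\<Sum>i<n. integral {0..pi} (\<lambda>x. ?c (int_decode i) * mode (int_decode i + m) x))"
        by (rule Henstock_Kurzweil_Integration.integral_sum) (auto intro!: integrable_continuous_real continuous_intros)
      finally show ?thesis by (simp add: integral_mode)
    qed
    then have "I = (\<lambda>n. \<Sum>i<n. ?c (int_decode i) * (if int_decode i + m = 0 then of_real pi else 0))" by (rule ext)
    \<comment> \<open>Only the term of index \<open>- m\<close> survives integration against
      \<open>mode m\<close>, so the partial sums are constant once its position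
      \<open>int_encode (- m)\<close> has been passed; \<open>Suc\<close> makes the sum include
      it.\<close>
    moreover have "(\<lambda>n. \<Sum>i<n. ?c (int_decode i) * (if int_decode i + m = 0 then of_real pi else 0)) \<longlonglongrightarrow> ?c (- m) * of_real pi"
    proof (rule LIMSEQ_I)
      fix r :: real assume "r > 0"
      have "(\<Sum>i<n. ?c (int_decode i) * (if int_decode i + m = 0 then of_real pi else 0)) = ?c (- m) * of_real pi"
        if "n \<ge> Suc (int_encode (- m))" for n
      proof -
        have "(\<Sum>i<n. ?c (int_decode i) * (if int_decode i + m = 0 then of_real pi else 0))
          = (\<Sum>i<n. if i = int_encode (- m) then ?c (- m) * of_real pi else 0)"
        proof (intro sum.cong refl)
          fix i
          have "int_decode i + m = 0 \<longleftrightarrow> i = int_encode (- m)"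
            by (metis add_eq_0_iff2 int_decode_inverse int_encode_inverse)
          then show "?c (int_decode i) * (if int_decode i + m = 0 then of_real pi else 0) = (if i = int_encode (- m) then ?c (- m) * of_real pi else 0)"
            by simp
        qed
        then show ?thesis using that by simp
      qed
      then show "\<exists>no. \<forall>n\<ge>no. norm ((\<Sum>i<n. ?c (int_decode i) * (if int_decode i + m = 0 then of_real pi else 0)) - ?c (- m) * of_real pi) < r"
        using \<open>r > 0\<close> by (intro exI[of _ "Suc (int_encode (- m))"]) simp
    qed
    ultimately have "J = ?c (- m) * of_real pi" using LIMSEQ_unique[OF IJ(3)] by (simp only:)
    moreover have "?c (- m) * of_real pi = integral {0..pi} (\<lambda>x. of_real (s x) * mode m x)"
      by (simp add: fourier_coeff_pi_def mode_def mult_ac)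
    ultimately have J: "((\<lambda>x. ?S x * mode m x) has_integral integral {0..pi} (\<lambda>x. of_real (s x) * mode m x)) {0..pi}"
      using IJ(2) by simp
    have "((\<lambda>x. of_real (s x) * mode m x) has_integral integral {0..pi} (\<lambda>x. of_real (s x) * mode m x)) {0..pi}"
      by (intro integrable_integral integrable_continuous_real continuous_intros continuous_on_subset[OF s(1)]) auto
    from has_integral_diff[OF this J] show "integral {0..pi} (\<lambda>x. h x * mode m x) = 0"
      by (simp add: h_def left_diff_distrib integral_unique)
  qed
  then show "complex_of_real (s x) = (\<integral>n. ?c n * mode n x \<partial>csZ)"
    using csZ_series(2)[OF ix[of x]] by (simp add: h_def)
qed

section \<open>Sector expansions for the potential and its reflection\<close>

lemma sector_expansionI:
  assumes "R > 0" "K > 0" "\<mu> > 0" "\<And>n. V n holomorphic_on right_sector R K" "integrable csZ v"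
    "\<And>n x. x \<in> right_sector R K \<Longrightarrow> norm (V n x) \<le> v n * Re x powr (- \<mu>)"
    "\<And>x. x > R \<Longrightarrow> complex_of_real (q x) = (\<integral>n. V n (of_real x) * mode n x \<partial>csZ)"
  shows "sector_expansion q"
  unfolding sector_expansion_def
  by (rule exI[of _ R], rule exI[of _ K], rule exI[of _ \<mu>], rule exI[of _ V], rule exI[of _ v]) (use assms in simp)

lemma sector_expansionE:
  assumes "sector_expansion q"
  obtains R K \<mu> V v where "R > 0" "K > 0" "\<mu> > 0" "\<And>n. V n holomorphic_on right_sector R K" "integrable csZ v"
    "\<And>n x. x \<in> right_sector R K \<Longrightarrow> norm (V n x) \<le> v n * Re x powr (- \<mu>)"
    "\<And>x. x > R \<Longrightarrow> complex_of_real (q x) = (\<integral>n. V n (of_real x) * mode n x \<partial>csZ)"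
proof -
  obtain R K \<mu> V v where *: "R > 0 \<and> K > 0 \<and> \<mu> > 0 \<and>
     (\<forall>n. V n holomorphic_on right_sector R K) \<and> integrable csZ v \<and>
     (\<forall>n. \<forall>x\<in>right_sector R K. norm (V n x) \<le> v n * Re x powr (- \<mu>)) \<and>
     (\<forall>x>R. complex_of_real (q x) = (\<integral>n. V n (of_real x) * mode n x \<partial>csZ))"
    using assms unfolding sector_expansion_def by (elim exE)
  show ?thesis by (rule that[of R K \<mu> V v]) (use * in simp_all)
qed

lemma of_real_right_sector: "x > R \<Longrightarrow> R \<ge> 0 \<Longrightarrow> K > 0 \<Longrightarrow> complex_of_real x \<in> right_sector R K"
  by (auto simp: right_sector_def)

lemma mode_coeff_integrable:
  assumes v: "integrable csZ v" and V: "\<And>n. norm (V n) \<le> v n * c"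
  shows "integrable csZ (\<lambda>n. V n * mode n x)"
proof (rule Bochner_Integration.integrable_bound)
  show "integrable csZ (\<lambda>n. v n * c)" using v by simp
  show "AE n in csZ. norm (V n * mode n x) \<le> norm (v n * c)"
    by (rule AE_I2, simp only: norm_mult[of "V _"] norm_mode mult_1_right, rule order_trans[OF V])
      (simp only: real_norm_def abs_ge_self)
qed simp

lemma sector_expansion_0: "sector_expansion (\<lambda>x. 0)"
  by (rule sector_expansionI[of 1 1 1 "\<lambda>n x. 0" "\<lambda>n. 0"]) auto

lemma sector_expansion_add:
  assumes "sector_expansion q1" "sector_expansion q2"
  shows "sector_expansion (\<lambda>x. q1 x + q2 x)"
proof -
  obtain R1 K1 \<mu>1 V1 v1 where 1: "R1 > 0" "K1 > 0" "\<mu>1 > 0" "\<And>n. V1 n holomorphic_on right_sector R1 K1" "integrable csZ v1"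
    "\<And>n x. x \<in> right_sector R1 K1 \<Longrightarrow> norm (V1 n x) \<le> v1 n * Re x powr (- \<mu>1)"
    "\<And>x. x > R1 \<Longrightarrow> complex_of_real (q1 x) = (\<integral>n. V1 n (of_real x) * mode n x \<partial>csZ)"
    by (rule sector_expansionE[OF assms(1)]) (rule that)
  obtain R2 K2 \<mu>2 V2 v2 where 2: "R2 > 0" "K2 > 0" "\<mu>2 > 0" "\<And>n. V2 n holomorphic_on right_sector R2 K2" "integrable csZ v2"
    "\<And>n x. x \<in> right_sector R2 K2 \<Longrightarrow> norm (V2 n x) \<le> v2 n * Re x powr (- \<mu>2)"
    "\<And>x. x > R2 \<Longrightarrow> complex_of_real (q2 x) = (\<integral>n. V2 n (of_real x) * mode n x \<partial>csZ)"
    by (rule sector_expansionE[OF assms(2)]) (rule that)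
  \<comment> \<open>\<open>R \<ge> 1\<close> makes the bound with the smaller exponent the weaker
    one, so that it holds for both summands.\<close>
  define R where "R = max 1 (max R1 R2)"
  define K where "K = min K1 K2"
  define \<mu> where "\<mu> = min \<mu>1 \<mu>2"
  have sub: "right_sector R K \<subseteq> right_sector R1 K1" "right_sector R K \<subseteq> right_sector R2 K2"
  proof -
    have *: "K * Re x \<le> K1 * Re x" "K * Re x \<le> K2 * Re x" if "Re x > R" for x
      using that by (auto intro!: mult_right_mono simp: K_def R_def)
    have "x \<in> right_sector R1 K1 \<and> x \<in> right_sector R2 K2" if "x \<in> right_sector R K" for x
    proof -
      have x: "Re x > R" "\<bar>Im x\<bar> < K * Re x" using that by (auto simp: right_sector_def)
      have "R1 \<le> R" "R2 \<le> R" by (auto simp: R_def)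
      with x less_le_trans[OF x(2) *(1)[OF x(1)]] less_le_trans[OF x(2) *(2)[OF x(1)]]
      show ?thesis by (simp add: right_sector_def)
    qed
    then show "right_sector R K \<subseteq> right_sector R1 K1" "right_sector R K \<subseteq> right_sector R2 K2" by blast+
  qed
  have weaken: "v' * Re x powr (- \<mu>') \<le> v' * Re x powr (- \<mu>)"
    if "0 \<le> v' * Re x powr (- \<mu>')" "x \<in> right_sector R K" "\<mu> \<le> \<mu>'" for v' \<mu>' x
  proof -
    have x: "Re x > 1" using that(2) by (auto simp: right_sector_def R_def)
    then have "Re x powr (- \<mu>') > 0" by simp
    then have "v' \<ge> 0" using that(1) mult_neg_pos[of v'] by (meson not_less)
    moreover have "Re x powr (- \<mu>') \<le> Re x powr (- \<mu>)" using x that(3) by (intro powr_mono) auto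
    ultimately show ?thesis by (intro mult_left_mono)
  qed
  show ?thesis
  proof (rule sector_expansionI[of R K \<mu> "\<lambda>n x. V1 n x + V2 n x" "\<lambda>n. v1 n + v2 n"])
    show "(\<lambda>x. V1 n x + V2 n x) holomorphic_on right_sector R K" for n
      by (intro holomorphic_intros holomorphic_on_subset[OF 1(4)] holomorphic_on_subset[OF 2(4)] sub)
    fix n x assume x: "x \<in> right_sector R K"
    have b1: "norm (V1 n x) \<le> v1 n * Re x powr (- \<mu>1)" "norm (V2 n x) \<le> v2 n * Re x powr (- \<mu>2)"
      using 1(6) 2(6) sub x by blast+
    have "norm (V1 n x) \<le> v1 n * Re x powr (- \<mu>)" "norm (V2 n x) \<le> v2 n * Re x powr (- \<mu>)"
      by (rule order_trans[OF b1(1) weaken[OF order_trans[OF norm_ge_zero b1(1)] x]], simp add: \<mu>_def)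
         (rule order_trans[OF b1(2) weaken[OF order_trans[OF norm_ge_zero b1(2)] x]], simp add: \<mu>_def)
    then show "norm (V1 n x + V2 n x) \<le> (v1 n + v2 n) * Re x powr (- \<mu>)"
      by (intro order_trans[OF norm_triangle_ineq]) (simp add: algebra_simps)
  next
    fix x assume x: "x > R"
    have xs: "complex_of_real x \<in> right_sector R1 K1" "complex_of_real x \<in> right_sector R2 K2"
      by (rule of_real_right_sector; use x 1 2 in \<open>simp add: R_def\<close>)+
    have i: "integrable csZ (\<lambda>n. V1 n (of_real x) * mode n x)" "integrable csZ (\<lambda>n. V2 n (of_real x) * mode n x)"
      by (rule mode_coeff_integrable[OF 1(5) 1(6)[OF xs(1)]], rule mode_coeff_integrable[OF 2(5) 2(6)[OF xs(2)]])
    show "complex_of_real (q1 x + q2 x) = (\<integral>n. (V1 n (of_real x) + V2 n (of_real x)) * mode n x \<partial>csZ)"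
      using 1(7)[of x] 2(7)[of x] x i by (simp add: R_def distrib_right)
  qed (use 1 2 in \<open>auto simp: R_def K_def \<mu>_def\<close>)
qed

lemma sector_expansion_sum:
  assumes "finite A" "\<And>j. j \<in> A \<Longrightarrow> sector_expansion (q j)"
  shows "sector_expansion (\<lambda>x. \<Sum>j\<in>A. q j x)"
  using assms by (induction A rule: finite_induct) (auto intro: sector_expansion_0 sector_expansion_add)

text \<open>The coefficient functions are \<open>c n * Wc\<close>: the periodic factor enters
  through constants, and nothing but \<open>Wc\<close> leaves the real axis. A bound in |z| implies
  one in Re z because the exponent is negative and 0 < Re z \<le> |z|.\<close>

lemma sector_expansion_mult:
  assumes c: "integrable csZ c" "\<And>x. complex_of_real (s x) = (\<integral>n. c n * mode n x \<partial>csZ)"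
    and W: "R > 0" "K > 0" "\<mu> > 0" "C > 0" "Wc holomorphic_on right_sector R K" "\<And>x. x > R \<Longrightarrow> Wc (of_real x) = of_real (W x)"
      "\<And>z. z \<in> right_sector R K \<Longrightarrow> norm (Wc z) \<le> C * norm z powr (- \<mu>)"
  shows "sector_expansion (\<lambda>x. s x * W x)"
proof (rule sector_expansionI[of R K \<mu> "\<lambda>n x. c n * Wc x" "\<lambda>n. norm (c n) * C"])
  show "integrable csZ (\<lambda>n. norm (c n) * C)" using c(1) by simp
  fix n x assume x: "x \<in> right_sector R K"
  have "Re x > 0" using x W(1) by (auto simp: right_sector_def)
  then have "norm x powr (- \<mu>) \<le> Re x powr (- \<mu>)" using W(3) by (intro powr_mono2' complex_Re_le_cmod) auto
  then have "C * norm x powr (- \<mu>) \<le> C * Re x powr (- \<mu>)" using W(4) by simp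
  with W(7)[OF x] have "norm (Wc x) \<le> C * Re x powr (- \<mu>)" by (rule order_trans)
  then have "norm (c n) * norm (Wc x) \<le> norm (c n) * (C * Re x powr (- \<mu>))" by (rule mult_left_mono) simp
  then show "norm (c n * Wc x) \<le> norm (c n) * C * Re x powr (- \<mu>)" by (simp add: norm_mult mult.assoc)
next
  fix x assume x: "x > R"
  have "integrable csZ (\<lambda>n. c n * mode n x)"
    by (rule mode_coeff_integrable[of "\<lambda>n. norm (c n)" c 1]) (use c(1) in auto)
  have "(\<integral>n. c n * Wc (of_real x) * mode n x \<partial>csZ) = (\<integral>n. (c n * mode n x) * of_real (W x) \<partial>csZ)"
    using W(6)[OF x] by (simp add: mult_ac)
  also have "\<dots> = (\<integral>n. c n * mode n x \<partial>csZ) * of_real (W x)" by (rule integral_mult_left_zero)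
  finally show "complex_of_real (s x * W x) = (\<integral>n. c n * Wc (of_real x) * mode n x \<partial>csZ)" using c(2)[of x] by simp
qed (use W in \<open>auto intro!: holomorphic_intros\<close>)

text \<open>Reflection exchanges the Fourier coefficients of index n and -n and uses the left half
  of \<open>sector_region\<close>, so both ends of the line are described over a right
  sector.\<close>

lemma sector_expansion_factor:
  assumes s: "periodic_factor s" and W: "decaying_factor W"
  shows "sector_expansion (\<lambda>x. s x * W x)" "sector_expansion (\<lambda>x. s (- x) * W (- x))"
proof -
  note c = fourier_inversion[OF s]
  obtain R K \<mu> C Wc where W: "R > 0" "K > 0" "\<mu> > 0" "C > 0" "Wc holomorphic_on sector_region R K"
    "\<forall>x. \<bar>x\<bar> > R \<longrightarrow> Wc (complex_of_real x) = complex_of_real (W x)"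
    "\<forall>z\<in>sector_region R K. norm (Wc z) \<le> C * norm z powr (- \<mu>)"
    using W unfolding decaying_factor_def by (elim conjE exE) (rule that)
  have sub: "right_sector R K \<subseteq> sector_region R K" "uminus ` right_sector R K \<subseteq> sector_region R K"
    using W(1) by (auto simp: right_sector_def sector_region_def)
  show "sector_expansion (\<lambda>x. s x * W x)"
  proof (rule sector_expansion_mult[OF c W(1-4) holomorphic_on_subset[OF W(5) sub(1)]])
    show "norm (Wc z) \<le> C * norm z powr (- \<mu>)" if "z \<in> right_sector R K" for z using W(7) sub(1) that by blast
  qed (use W in auto)
  show "sector_expansion (\<lambda>x. s (- x) * W (- x))"
  proof (rule sector_expansion_mult[of "\<lambda>n. fourier_coeff_pi s (- n)" "\<lambda>x. s (- x)" R K \<mu> C "\<lambda>z. Wc (- z)" "\<lambda>x. W (- x)"])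
    have bij: "bij_betw uminus (UNIV :: int set) UNIV" by (rule bij_betwI[where g = uminus]) auto
    show "integrable csZ (\<lambda>n. fourier_coeff_pi s (- n))"
      using integrable_bij_count_space[OF bij, of "fourier_coeff_pi s"] c(1) by simp
    have "mode (- n) x = mode n (- x)" for n x by (simp add: mode_def)
    then have "(\<integral>n. fourier_coeff_pi s (- n) * mode n x \<partial>csZ) = (\<integral>n. fourier_coeff_pi s (- n) * mode (- n) (- x) \<partial>csZ)" for x by simp
    also have "\<dots> x = (\<integral>n. fourier_coeff_pi s n * mode n (- x) \<partial>csZ)" for x
      using integral_bij_count_space[OF bij, of "\<lambda>n. fourier_coeff_pi s n * mode n (- x)"] by simp
    finally show "complex_of_real (s (- x)) = (\<integral>n. fourier_coeff_pi s (- n) * mode n x \<partial>csZ)" for x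
      using c(2)[of "- x"] by simp
    show "(\<lambda>z. Wc (- z)) holomorphic_on right_sector R K"
      using holomorphic_on_compose_gen[OF holomorphic_on_minus[OF holomorphic_on_ident] W(5), of "right_sector R K"] sub(2)
      by (simp add: comp_def)
    show "norm (Wc (- z)) \<le> C * norm z powr (- \<mu>)" if z: "z \<in> right_sector R K" for z
    proof -
      have "- z \<in> sector_region R K" using sub(2) z by blast
      then show ?thesis using W(7)[rule_format, of "- z"] by simp
    qed
    show "Wc (- complex_of_real x) = complex_of_real (W (- x))" if "x > R" for x
      using W(6)[rule_format, of "- x"] that W(1) by simp
  qed (use W in auto)
qed

text \<open>Decay at both ends will give the uniform continuity of \<open>V\<close> on which the
  uniqueness proof rests.\<close>

lemma sector_expansion_tendsto_0:
  assumes "sector_expansion q"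
  shows "(q \<longlongrightarrow> 0) at_top"
proof -
  obtain R K \<mu> V v where *: "R > 0" "K > 0" "\<mu> > 0" "\<And>n. V n holomorphic_on right_sector R K" "integrable csZ v"
    "\<And>n x. x \<in> right_sector R K \<Longrightarrow> norm (V n x) \<le> v n * Re x powr (- \<mu>)"
    "\<And>x. x > R \<Longrightarrow> complex_of_real (q x) = (\<integral>n. V n (of_real x) * mode n x \<partial>csZ)"
    by (rule sector_expansionE[OF assms]) (rule that)
  have le: "\<bar>q x\<bar> \<le> (\<integral>n. v n \<partial>csZ) * x powr (- \<mu>)" if x: "x > R" for x
  proof -
    have xs: "complex_of_real x \<in> right_sector R K" by (rule of_real_right_sector) (use x * in auto)
    note b = *(6)[OF xs]
    have "norm (complex_of_real (q x)) \<le> (\<integral>n. v n * x powr (- \<mu>) \<partial>csZ)"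
      unfolding *(7)[OF x]
      by (rule norm_integral_le_integral[OF mode_coeff_integrable[OF *(5) b]]) (use *(5) b in \<open>auto simp: norm_mult\<close>)
    then show ?thesis by simp
  qed
  have "((\<lambda>x. (\<integral>n. v n \<partial>csZ) * x powr (- \<mu>)) \<longlongrightarrow> (\<integral>n. v n \<partial>csZ) * 0) at_top"
    using *(3) by (intro tendsto_intros tendsto_neg_powr filterlim_ident) auto
  then have lim: "((\<lambda>x. (\<integral>n. v n \<partial>csZ) * x powr (- \<mu>)) \<longlongrightarrow> 0) at_top" by simp
  show ?thesis
    by (rule Lim_null_comparison[OF _ lim]) (use le in \<open>auto intro!: eventually_mono[OF eventually_gt_at_top[of R]]\<close>)
qed

lemma vanishing_bounded_uniformly_continuous:
  fixes V :: "real \<Rightarrow> real"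
  assumes V: "continuous_on UNIV V" "(V \<longlongrightarrow> 0) at_top" "((\<lambda>x. V (- x)) \<longlongrightarrow> 0) at_top"
  shows "\<exists>B. \<forall>x. \<bar>V x\<bar> \<le> B" "\<And>e. e > 0 \<Longrightarrow> \<exists>d>0. \<forall>x y. \<bar>x - y\<bar> < d \<longrightarrow> \<bar>V x - V y\<bar> < e"
proof -
  have tail: "\<exists>X>0. \<forall>x. \<bar>x\<bar> \<ge> X \<longrightarrow> \<bar>V x\<bar> < e" if e: "e > 0" for e
  proof -
    obtain X where X: "\<And>x. x \<ge> X \<Longrightarrow> \<bar>V x\<bar> < e"
      using tendstoD[OF V(2) e] by (auto simp: eventually_at_top_linorder)
    obtain Y where Y: "\<And>x. x \<ge> Y \<Longrightarrow> \<bar>V (- x)\<bar> < e"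
      using tendstoD[OF V(3) e] by (auto simp: eventually_at_top_linorder)
    show ?thesis
    proof (intro exI[of _ "max 1 (max X Y)"] conjI allI impI)
      fix x assume x: "max 1 (max X Y) \<le> \<bar>x\<bar>"
      show "\<bar>V x\<bar> < e"
      proof (cases "x \<ge> 0")
        case True
        then show ?thesis using X[of x] x by simp
      next
        case False
        then show ?thesis using Y[of "- x"] x by simp
      qed
    qed simp
  qed
  obtain X where X: "X > 0" "\<And>x. \<bar>x\<bar> \<ge> X \<Longrightarrow> \<bar>V x\<bar> < 1" using tail[of 1] by auto
  have "compact (V ` {-X..X})" by (intro compact_continuous_image continuous_on_subset[OF V(1)]) auto
  from compact_imp_bounded[OF this] obtain B where "\<forall>v\<in>V ` {-X..X}. norm v \<le> B" unfolding bounded_iff by blast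
  then have B: "\<And>x. \<bar>x\<bar> \<le> X \<Longrightarrow> \<bar>V x\<bar> \<le> B" by (auto simp: abs_le_iff)
  have "\<bar>V x\<bar> \<le> max B 1" for x using B[of x] X(2)[of x] by (cases "\<bar>x\<bar> \<le> X") auto
  then show "\<exists>B. \<forall>x. \<bar>V x\<bar> \<le> B" by blast
  fix e :: real assume e: "e > 0"
  obtain X where X: "X > 0" "\<And>x. \<bar>x\<bar> \<ge> X \<Longrightarrow> \<bar>V x\<bar> < e / 2" using tail[of "e / 2"] e by auto
  \<comment> \<open>The interval is enlarged by 1: if |x - y| < 1 and one of the points lies outside
    it, both lie in the tails, where |V| < e/2.\<close>
  have "uniformly_continuous_on {-X-1..X+1} V"
    by (intro compact_uniformly_continuous continuous_on_subset[OF V(1)]) auto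
  then obtain d where d: "d > 0" "\<And>x y. x \<in> {-X-1..X+1} \<Longrightarrow> y \<in> {-X-1..X+1} \<Longrightarrow> dist y x < d \<Longrightarrow> dist (V y) (V x) < e"
    unfolding uniformly_continuous_on_def using e by metis
  show "\<exists>d>0. \<forall>x y. \<bar>x - y\<bar> < d \<longrightarrow> \<bar>V x - V y\<bar> < e"
  proof (intro exI[of _ "min d 1"] conjI allI impI)
    fix x y :: real assume xy: "\<bar>x - y\<bar> < min d 1"
    show "\<bar>V x - V y\<bar> < e"
    proof (cases "x \<in> {-X-1..X+1} \<and> y \<in> {-X-1..X+1}")
      case True
      then show ?thesis using d(2)[of y x] xy by (simp add: dist_real_def)
    next
      case False
      then have "\<bar>x\<bar> \<ge> X" "\<bar>y\<bar> \<ge> X" using xy by auto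
      then show ?thesis using X(2)[of x] X(2)[of y] by (auto simp: abs_if split: if_splits)
    qed
  qed (use d in auto)
qed

section \<open>Uniqueness of weak square integrable solutions\<close>

lemma integrable_indicator_Icc [simp]: "integrable lborel (indicator {a..b::real} :: real \<Rightarrow> real)"
  by (rule integrable_real_indicator) (auto simp: emeasure_lborel_Icc_eq)

lemma L2_mult_integrable:
  fixes k :: "real \<Rightarrow> complex"
  assumes u: "L2 u" and k: "k \<in> borel_measurable borel" "\<And>x. norm (k x) \<le> C * indicator {a..b} x"
  shows "integrable lborel (\<lambda>x. u x * k x)"
proof (rule Bochner_Integration.integrable_bound)
  have um: "u \<in> borel_measurable lborel" "integrable lborel (\<lambda>x. (norm (u x))\<^sup>2)" using u by (auto simp: L2_def)
  show "integrable lborel (\<lambda>x. \<bar>C\<bar> * (indicator {a..b} x + (norm (u x))\<^sup>2))"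
    using um by (intro integrable_mult_right Bochner_Integration.integrable_add) auto
  show "(\<lambda>x. u x * k x) \<in> borel_measurable lborel" using um k by simp
  show "AE x in lborel. norm (u x * k x) \<le> norm (\<bar>C\<bar> * (indicator {a..b} x + (norm (u x))\<^sup>2))"
  proof (rule AE_I2)
    fix x
    have le: "norm (u x) \<le> 1 + (norm (u x))\<^sup>2"
    proof -
      have "0 \<le> (norm (u x) - 1)\<^sup>2" by simp
      then have "2 * norm (u x) \<le> 1 + (norm (u x))\<^sup>2" by (simp add: power2_diff)
      then show ?thesis by (smt (verit) norm_ge_zero)
    qed
    show "norm (u x * k x) \<le> norm (\<bar>C\<bar> * (indicator {a..b} x + (norm (u x))\<^sup>2))"
    proof (cases "x \<in> {a..b}")
      case True
      then have "norm (k x) \<le> \<bar>C\<bar>" using k(2)[of x] by simp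
      then have "norm (u x) * norm (k x) \<le> (1 + (norm (u x))\<^sup>2) * \<bar>C\<bar>" using le by (intro mult_mono) auto
      then show ?thesis using True by (simp add: norm_mult abs_mult mult.commute)
    next
      case False
      then have "norm (k x) = 0" using k(2)[of x] by simp
      then show ?thesis by (simp add: norm_mult)
    qed
  qed
qed

lemma compact_support_bounded:
  fixes f :: "real \<Rightarrow> real"
  assumes f: "continuous_on UNIV f" "\<And>x. \<bar>x\<bar> \<ge> r \<Longrightarrow> f x = 0"
  obtains M where "M \<ge> 0" "\<And>x. \<bar>f x\<bar> \<le> M * indicator {-r..r} x"
proof -
  have "compact (f ` {-r..r})" by (intro compact_continuous_image continuous_on_subset[OF f(1)]) auto
  from compact_imp_bounded[OF this] obtain B where B: "\<forall>v\<in>f ` {-r..r}. norm v \<le> B" unfolding bounded_iff by blast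
  have "\<bar>f x\<bar> \<le> max B 0 * indicator {-r..r} x" for x
  proof (cases "x \<in> {-r..r}")
    case True
    then have "norm (f x) \<le> B" using B by blast
    then show ?thesis using True by simp
  next
    case False
    then have "f x = 0" by (intro f(2)) auto
    then show ?thesis by simp
  qed
  then show ?thesis using that[of "max B 0"] by simp
qed

text \<open>For |x| > r the function is locally zero; at |x| = r the derivative vanishes by
  continuity.\<close>

lemma smooth_deriv_support:
  assumes f: "smooth_real f" "\<And>x. \<bar>x\<bar> \<ge> r \<Longrightarrow> f x = 0"
  shows "\<bar>x\<bar> \<ge> r \<Longrightarrow> deriv f x = 0"
proof -
  have ext: "deriv f x = 0" if x: "\<bar>x\<bar> > r" for x
  proof -
    have o: "open {x. \<bar>x\<bar> > r}" by (intro open_Collect_less continuous_intros)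
    have "(f has_real_derivative 0) (at x)"
      by (rule has_field_derivative_transform_within_open[OF DERIV_const o]) (use x f(2) in auto)
    then show ?thesis by (rule DERIV_imp_deriv)
  qed
  have cl: "closed {x. deriv f x = 0}"
    by (intro closed_Collect_eq smooth_real_continuous smooth_real_deriv f continuous_intros)
  show "\<bar>x\<bar> \<ge> r \<Longrightarrow> deriv f x = 0"
  proof (cases "\<bar>x\<bar> > r")
    case False
    assume "\<bar>x\<bar> \<ge> r"
    then have xr: "\<bar>x\<bar> = r" using False by simp
    define y where "y n = x + (if x \<ge> 0 then 1 else -1) / real (Suc n)" for n
    have "\<bar>y n\<bar> > r" for n
      using xr by (auto simp: y_def abs_if field_simps)
    then have "y n \<in> {x. deriv f x = 0}" for n using ext by simp
    moreover have "y \<longlonglongrightarrow> x + 0" unfolding y_def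
      by (intro tendsto_intros) (rule tendsto_divide_0[OF tendsto_const filterlim_real_sequentially[THEN filterlim_at_top_imp_at_infinity, THEN filterlim_compose[OF _ filterlim_Suc]]])
    ultimately have "x \<in> {x. deriv f x = 0}"
      using closed_sequentially[OF cl, of y x] by simp
    then show ?thesis by simp
  qed (rule ext)
qed

text \<open>The convolution of \<open>u\<close> with \<open>f\<close>. Read as \<open>u\<close>
  tested against a reflected translate of \<open>f\<close>, it converts a distributional equation
  into a pointwise one in \<open>y\<close>.\<close>

definition cv :: "(real \<Rightarrow> complex) \<Rightarrow> (real \<Rightarrow> real) \<Rightarrow> real \<Rightarrow> complex" where
  "cv u f y = (\<integral>x. u x * of_real (f (y - x)) \<partial>lborel)"

lemma cv_integrable:
  assumes u: "L2 u" and f: "continuous_on UNIV f" "\<And>x. \<bar>x\<bar> \<ge> r \<Longrightarrow> f x = 0"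
  shows "integrable lborel (\<lambda>x. u x * of_real (f (y - x)))"
proof -
  obtain M where M: "M \<ge> 0" "\<And>x. \<bar>f x\<bar> \<le> M * indicator {-r..r} x" using compact_support_bounded[OF f] by blast
  have "continuous_on UNIV (\<lambda>x. complex_of_real (f (y - x)))"
    by (intro continuous_intros continuous_on_compose2[OF f(1)]) auto
  then have m: "(\<lambda>x. complex_of_real (f (y - x))) \<in> borel_measurable borel" by (rule borel_measurable_continuous_onI)
  have ind: "indicator {-r..r} (y - x) = (indicator {y-r..y+r} x :: real)" for x by (auto simp: indicator_def)
  have "norm (complex_of_real (f (y - x))) \<le> M * indicator {y-r..y+r} x" for x
    using M(2)[of "y - x"] unfolding ind by simp
  then show ?thesis by (rule L2_mult_integrable[OF u m])
qed

lemma norm_cv_le: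
  assumes u: "L2 u" and f: "continuous_on UNIV f" "\<And>x. \<bar>x\<bar> \<ge> r \<Longrightarrow> f x = 0"
    and M: "M \<ge> 0" "\<And>x. \<bar>f x\<bar> \<le> M * indicator {-r..r} x" and r: "r \<ge> 0"
  shows "norm (cv u f y) \<le> M * (2 * r + (\<integral>x. (norm (u x))\<^sup>2 \<partial>lborel))"
proof -
  have um: "integrable lborel (\<lambda>x. (norm (u x))\<^sup>2)" using u by (auto simp: L2_def)
  have i2: "integrable lborel (\<lambda>x. M * (indicator {y-r..y+r} x + (norm (u x))\<^sup>2))"
    using um by (intro integrable_mult_right Bochner_Integration.integrable_add) auto
  have "norm (cv u f y) \<le> (\<integral>x. M * (indicator {y-r..y+r} x + (norm (u x))\<^sup>2) \<partial>lborel)"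
    unfolding cv_def
  proof (rule norm_integral_le_integral[OF cv_integrable[OF u f] i2])
    fix x
    have "0 \<le> (norm (u x) - 1)\<^sup>2" by simp
    then have "2 * norm (u x) \<le> 1 + (norm (u x))\<^sup>2" by (simp add: power2_diff)
    then have le: "norm (u x) \<le> 1 + (norm (u x))\<^sup>2" by (smt (verit) norm_ge_zero)
    show "norm (u x * of_real (f (y - x))) \<le> M * (indicator {y-r..y+r} x + (norm (u x))\<^sup>2)"
    proof (cases "x \<in> {y-r..y+r}")
      case True
      then have "\<bar>f (y - x)\<bar> \<le> M" using M(2)[of "y - x"] M(1) by (auto simp: indicator_def split: if_splits)
      then have "norm (u x) * \<bar>f (y - x)\<bar> \<le> (1 + (norm (u x))\<^sup>2) * M" using le by (intro mult_mono) auto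
      then show ?thesis using True by (simp add: norm_mult mult.commute)
    next
      case False
      then have "f (y - x) = 0" by (intro f(2)) auto
      then show ?thesis using M(1) by simp
    qed
  qed
  also have "\<dots> = M * (2 * r + (\<integral>x. (norm (u x))\<^sup>2 \<partial>lborel))" using um r by simp
  finally show ?thesis .
qed

lemma cv_deriv:
  assumes u: "L2 u" and f: "smooth_real f" "\<And>x. \<bar>x\<bar> \<ge> r \<Longrightarrow> f x = 0"
  shows "(cv u f has_vector_derivative cv u (deriv f) y) (at y)"
proof -
  note cf = smooth_real_continuous[OF f(1)] and cf' = smooth_real_continuous[OF smooth_real_deriv[OF f(1)]]
  have f': "\<bar>x\<bar> \<ge> r \<Longrightarrow> deriv f x = 0" for x by (rule smooth_deriv_support[OF f])
  obtain M where M: "M \<ge> 0" "\<And>x. \<bar>deriv f x\<bar> \<le> M * indicator {-r..r} x" using compact_support_bounded[OF cf' f'] by blast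
  have "\<bar>deriv f x\<bar> \<le> M" for x by (rule order_trans[OF M(2)]) (use M(1) in \<open>auto simp: indicator_def\<close>)
  then have lip: "\<bar>f a - f b\<bar> \<le> M * \<bar>a - b\<bar>" for a b
    using field_differentiable_bound[of UNIV f "deriv f" M a b] smooth_real_DERIV[OF f(1)] by simp
  have um: "u \<in> borel_measurable borel" "integrable lborel (\<lambda>x. (norm (u x))\<^sup>2)" using u by (auto simp: L2_def)
  have fm[measurable]: "f \<in> borel_measurable borel" "deriv f \<in> borel_measurable borel"
    using cf cf' by (auto intro: borel_measurable_continuous_onI)
  note um(1)[measurable]
  have "((\<lambda>h. (cv u f (y + h) - cv u f y) /\<^sub>R h) \<longlongrightarrow> cv u (deriv f) y) (at 0)"
    unfolding tendsto_at_iff_sequentially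
  proof (intro allI impI)
    fix X :: "nat \<Rightarrow> real" assume X0: "\<forall>i. X i \<in> UNIV - {0}" and X: "X \<longlonglongrightarrow> 0"
    have "\<forall>\<^sub>F n in sequentially. dist (X n) 0 < 1" using X by (intro tendstoD) auto
    then obtain N where N: "\<And>n. n \<ge> N \<Longrightarrow> \<bar>X n\<bar> < 1" unfolding eventually_sequentially by auto
    define Y where "Y n = X (n + N)" for n
    have Y: "Y \<longlonglongrightarrow> 0" "\<And>n. Y n \<noteq> 0" "\<And>n. \<bar>Y n\<bar> < 1"
      using X0 N LIMSEQ_ignore_initial_segment[OF X, of N] unfolding Y_def by simp_all
    let ?q = "\<lambda>n x. u x * of_real ((f (y + Y n - x) - f (y - x)) / Y n)"
    have "(\<lambda>n. \<integral>x. ?q n x \<partial>lborel) \<longlonglongrightarrow> (\<integral>x. u x * of_real (deriv f (y - x)) \<partial>lborel)"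
    \<comment> \<open>The window exceeds the support by 1 on each side because the shifts
      \<open>Y n\<close> are smaller than 1.\<close>
    proof (rule integral_dominated_convergence[where w = "\<lambda>x. M * (indicator {y-\<bar>r\<bar>-1..y+\<bar>r\<bar>+1} x + (norm (u x))\<^sup>2)"])
      show "integrable lborel (\<lambda>x. M * (indicator {y-\<bar>r\<bar>-1..y+\<bar>r\<bar>+1} x + (norm (u x))\<^sup>2))"
        using um by (intro integrable_mult_right Bochner_Integration.integrable_add) auto
      show "AE x in lborel. (\<lambda>n. ?q n x) \<longlonglongrightarrow> u x * of_real (deriv f (y - x))"
      proof (rule AE_I2)
        fix x
        have "((\<lambda>h. (f (y - x + h) - f (y - x)) / h) \<longlongrightarrow> deriv f (y - x)) (at 0)"
          using smooth_real_DERIV[OF f(1)] by (simp add: DERIV_def)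
        then have "(\<lambda>n. (f (y - x + Y n) - f (y - x)) / Y n) \<longlonglongrightarrow> deriv f (y - x)"
          unfolding tendsto_at_iff_sequentially comp_def using Y by auto
        moreover have "y - x + Y n = y + Y n - x" for n by simp
        ultimately show "(\<lambda>n. ?q n x) \<longlonglongrightarrow> u x * of_real (deriv f (y - x))"
          by (intro tendsto_intros) simp
      qed
      show "AE x in lborel. norm (?q n x) \<le> M * (indicator {y-\<bar>r\<bar>-1..y+\<bar>r\<bar>+1} x + (norm (u x))\<^sup>2)" for n
      proof (rule AE_I2)
        fix x
        have "0 \<le> (norm (u x) - 1)\<^sup>2" by simp
        then have "2 * norm (u x) \<le> 1 + (norm (u x))\<^sup>2" by (simp add: power2_diff)
        then have le: "norm (u x) \<le> 1 + (norm (u x))\<^sup>2" by (smt (verit) norm_ge_zero)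
        show "norm (?q n x) \<le> M * (indicator {y-\<bar>r\<bar>-1..y+\<bar>r\<bar>+1} x + (norm (u x))\<^sup>2)"
        proof (cases "x \<in> {y-\<bar>r\<bar>-1..y+\<bar>r\<bar>+1}")
          case True
          have "\<bar>(f (y + Y n - x) - f (y - x)) / Y n\<bar> \<le> M"
            using lip[of "y + Y n - x" "y - x"] Y(2)[of n] by (simp add: field_simps)
          then have "norm (u x) * \<bar>(f (y + Y n - x) - f (y - x)) / Y n\<bar> \<le> (1 + (norm (u x))\<^sup>2) * M"
            using le by (intro mult_mono) auto
          then show ?thesis using True by (simp only: norm_mult norm_of_real indicator_simps mult.commute[of M])
        next
          case False
          then have "\<bar>y - x\<bar> \<ge> r" "\<bar>y + Y n - x\<bar> \<ge> r" using Y(3)[of n] by auto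
          then have "f (y - x) = 0" "f (y + Y n - x) = 0" by (auto intro: f(2))
          then show ?thesis using M(1) by simp
        qed
      qed
    qed auto
    moreover have "(\<lambda>n. \<integral>x. ?q n x \<partial>lborel) = (\<lambda>n. (cv u f (y + Y n) - cv u f y) /\<^sub>R Y n)"
    proof
      fix n
      have "(\<integral>x. ?q n x \<partial>lborel) = (\<integral>x. (u x * of_real (f (y + Y n - x)) - u x * of_real (f (y - x))) /\<^sub>R Y n \<partial>lborel)"
        by (rule Bochner_Integration.integral_cong) (auto simp: scaleR_conv_of_real divide_inverse algebra_simps)
      also have "\<dots> = (cv u f (y + Y n) - cv u f y) /\<^sub>R Y n"
        unfolding cv_def using cv_integrable[OF u cf f(2)] by simp
      finally show "(\<integral>x. ?q n x \<partial>lborel) = (cv u f (y + Y n) - cv u f y) /\<^sub>R Y n" .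
    qed
    ultimately have "(\<lambda>n. (cv u f (y + X (n + N)) - cv u f y) /\<^sub>R X (n + N)) \<longlonglongrightarrow> cv u (deriv f) y"
      by (simp only: cv_def[of u "deriv f"] Y_def)
    then show "((\<lambda>h. (cv u f (y + h) - cv u f y) /\<^sub>R h) \<circ> X) \<longlonglongrightarrow> cv u (deriv f) y"
      by (simp only: comp_def) (rule LIMSEQ_offset[of _ N])
  qed
  then have "((\<lambda>h. norm ((cv u f (y + h) - cv u f y) /\<^sub>R h - cv u (deriv f) y)) \<longlongrightarrow> 0) (at 0)"
    using LIM_zero tendsto_norm_zero by blast
  moreover have "\<forall>\<^sub>F h in at 0. norm ((cv u f (y + h) - cv u f y) /\<^sub>R h - cv u (deriv f) y)
      = norm (cv u f (y + h) - cv u f y - h *\<^sub>R cv u (deriv f) y) / norm h"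
  proof (rule eventually_at_topological[THEN iffD2], intro exI[of _ UNIV] conjI ballI impI)
    fix h :: real assume h: "h \<noteq> 0"
    have "cv u f (y + h) - cv u f y - h *\<^sub>R cv u (deriv f) y = h *\<^sub>R ((cv u f (y + h) - cv u f y) /\<^sub>R h - cv u (deriv f) y)"
      using h by (simp add: scaleR_diff_right)
    then show "norm ((cv u f (y + h) - cv u f y) /\<^sub>R h - cv u (deriv f) y)
      = norm (cv u f (y + h) - cv u f y - h *\<^sub>R cv u (deriv f) y) / norm h" using h by simp
  qed auto
  ultimately have "((\<lambda>h. norm (cv u f (y + h) - cv u f y - h *\<^sub>R cv u (deriv f) y) / norm h) \<longlongrightarrow> 0) (at 0)"
    by (rule Lim_transform_eventually)
  then show ?thesis unfolding has_vector_derivative_def has_derivative_at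
    by (simp add: bounded_linear_scaleR_left)
qed

text \<open>For a real truncation g the measures with densities g^+ and g^- are finite and agree on
  all half lines, so g^+ = g^- almost everywhere. The general case follows by taking real and
  imaginary parts and letting the truncation interval grow.\<close>

lemma AE_zero_if_interval_integrals_zero:
  fixes u :: "real \<Rightarrow> complex"
  assumes u: "u \<in> borel_measurable borel" "\<And>a b. integrable lborel (\<lambda>x. u x * indicator {a..b} x)"
    and z: "\<And>a b. a < b \<Longrightarrow> (\<integral>x. u x * indicator {a..b} x \<partial>lborel) = 0"
  shows "AE x in lborel. u x = 0"
proof -
  have real: "AE x in lborel. w x * indicator {-N..N} x = 0"
    if w: "w \<in> borel_measurable borel" "\<And>a b. integrable lborel (\<lambda>x. w x * indicator {a..b} x)"
      "\<And>a b. a < b \<Longrightarrow> (\<integral>x. w x * indicator {a..b} x \<partial>lborel) = 0" for w :: "real \<Rightarrow> real" and N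
  proof -
    define g where "g x = w x * indicator {-N..N} x" for x
    have gm[measurable]: "g \<in> borel_measurable borel" using w(1) unfolding g_def[abs_def] by measurable
    have gi: "integrable lborel g" unfolding g_def[abs_def] by (rule w(2))
    have tail: "(\<integral>x. g x * indicator {c<..} x \<partial>lborel) = 0" for c
    proof -
      have "(\<integral>x. g x * indicator {c<..} x \<partial>lborel) = (\<integral>x. w x * indicator {max c (-N)..N} x \<partial>lborel)"
      proof (rule integral_cong_AE)
        show "AE x in lborel. g x * indicator {c<..} x = w x * indicator {max c (-N)..N} x"
          using AE_lborel_singleton[of c] by eventually_elim (auto simp: g_def indicator_def)
      qed (use w(1) in auto)
      also have "\<dots> = 0"
      proof (cases "max c (-N) < N")
        case True
        then show ?thesis by (rule w(3))
      next
        case False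
        show ?thesis
        proof (rule integral_eq_zero_AE)
          show "AE x in lborel. w x * indicator {max c (-N)..N} x = 0"
            using AE_lborel_singleton[of N] by eventually_elim (use False in \<open>auto simp: indicator_def\<close>)
        qed
      qed
      finally show ?thesis .
    qed
    have gci: "integrable lborel (\<lambda>x. g x * indicator {c<..} x)" for c
      by (rule Bochner_Integration.integrable_bound[OF gi]) (auto simp: indicator_def)
    have emp: "(\<integral>\<^sup>+x. ennreal (h x) * indicator {c<..} x \<partial>lborel) = ennreal (\<integral>x. max 0 (h x * indicator {c<..} x) \<partial>lborel)"
      if "integrable lborel (\<lambda>x. h x * indicator {c<..} x)" for h c
    proof -
      have "(\<integral>\<^sup>+x. ennreal (h x) * indicator {c<..} x \<partial>lborel) = (\<integral>\<^sup>+x. ennreal (max 0 (h x * indicator {c<..} x)) \<partial>lborel)"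
        by (rule nn_integral_cong) (auto simp: indicator_def max_def ennreal_neg)
      also have "\<dots> = ennreal (\<integral>x. max 0 (h x * indicator {c<..} x) \<partial>lborel)"
        by (rule nn_integral_eq_integral) (use that in \<open>auto intro: integrable_max\<close>)
      finally show ?thesis .
    qed
    have gn: "integrable lborel (\<lambda>x. - g x * indicator {c<..} x)" for c using gci[of c] by simp
    have "density lborel (\<lambda>x. ennreal (g x)) = density lborel (\<lambda>x. ennreal (- g x))"
    proof (rule measure_eqI_lessThan)
      fix c
      show "emeasure (density lborel (\<lambda>x. ennreal (g x))) {c<..} < \<infinity>"
        by (subst emeasure_density) (auto simp: emp[OF gci])
      have "(\<integral>x. max 0 (g x * indicator {c<..} x) \<partial>lborel) - (\<integral>x. max 0 (- g x * indicator {c<..} x) \<partial>lborel)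
         = (\<integral>x. max 0 (g x * indicator {c<..} x) - max 0 (- g x * indicator {c<..} x) \<partial>lborel)"
        by (rule Bochner_Integration.integral_diff[symmetric]; rule integrable_max; (rule gci gn integrable_zero)) 
      also have "\<dots> = (\<integral>x. g x * indicator {c<..} x \<partial>lborel)"
        by (rule Bochner_Integration.integral_cong) (auto simp: max_def)
      finally have "(\<integral>x. max 0 (g x * indicator {c<..} x) \<partial>lborel) = (\<integral>x. max 0 (- g x * indicator {c<..} x) \<partial>lborel)"
        using tail[of c] by simp
      then show "emeasure (density lborel (\<lambda>x. ennreal (g x))) {c<..} = emeasure (density lborel (\<lambda>x. ennreal (- g x))) {c<..}"
        by (subst (1 2) emeasure_density) (auto simp only: emp[OF gci] emp[OF gn], auto)
    qed auto
    then have "AE x in lborel. ennreal (g x) = ennreal (- g x)"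
      by (rule sigma_finite_measure.density_unique[OF sigma_finite_lborel, rotated 2]) auto
    then show ?thesis
    proof eventually_elim
      case (elim x)
      then show ?case by (cases "g x \<ge> 0"; cases "g x = 0") (auto simp: g_def ennreal_neg ennreal_eq_0_iff)
    qed
  qed
  have eq: "(\<lambda>x. Re (u x) * indicator {a..b} x) = (\<lambda>x. Re (u x * indicator {a..b} x))"
    "(\<lambda>x. Im (u x) * indicator {a..b} x) = (\<lambda>x. Im (u x * indicator {a..b} x))" for a b
    by (auto simp: indicator_def)
  have Re: "integrable lborel (\<lambda>x. Re (u x) * indicator {a..b} x)" "integrable lborel (\<lambda>x. Im (u x) * indicator {a..b} x)" for a b
    unfolding eq using integrable_Re[OF u(2)[of a b]] integrable_Im[OF u(2)[of a b]] by auto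
  have I: "(\<integral>x. Re (u x) * indicator {a..b} x \<partial>lborel) = 0" "(\<integral>x. Im (u x) * indicator {a..b} x \<partial>lborel) = 0" if "a < b" for a b
    unfolding eq integral_Re[OF u(2)[of a b]] integral_Im[OF u(2)[of a b]] z[OF that] by simp_all
  have "AE x in lborel. \<forall>n::nat. Re (u x) * indicator {- real n..real n} x = 0 \<and> Im (u x) * indicator {- real n..real n} x = 0"
    unfolding AE_all_countable using real[of "\<lambda>x. Re (u x)"] real[of "\<lambda>x. Im (u x)"] u(1) Re I by auto
  then show ?thesis
  proof eventually_elim
    case (elim x)
    obtain n where "\<bar>x\<bar> \<le> real n" using real_arch_simple by blast
    then have "x \<in> {- real n..real n}" by auto
    then show ?case using elim[rule_format, of n] by (simp add: complex_eq_iff)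
  qed
qed

section \<open>Mollification of weak solutions\<close>

definition mollifier :: "real \<Rightarrow> (real \<Rightarrow> real) \<Rightarrow> bool" where
  "mollifier \<epsilon> \<phi> \<longleftrightarrow> smooth_real \<phi> \<and> (\<forall>x. \<phi> x \<ge> 0) \<and> (\<forall>x. \<bar>x\<bar> \<ge> \<epsilon> \<longrightarrow> \<phi> x = 0) \<and>
     integrable lborel \<phi> \<and> (\<integral>x. \<phi> x \<partial>lborel) = 1"

lemma mollifier_shift:
  fixes \<phi> :: "real \<Rightarrow> real"
  assumes "integrable lborel \<phi>" "(\<integral>x. \<phi> x \<partial>lborel) = 1"
  shows "integrable lborel (\<lambda>x. \<phi> (y - x))" "(\<integral>x. \<phi> (y - x) \<partial>lborel) = 1"
    "integrable lborel (\<lambda>x. \<phi> (x - y))" "(\<integral>x. \<phi> (x - y) \<partial>lborel) = 1"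
  using lborel_integrable_real_affine[OF assms(1), of "-1" y] lborel_integral_real_affine[of "-1" \<phi> y]
    lborel_integrable_real_affine[OF assms(1), of "1" "-y"] lborel_integral_real_affine[of "1" \<phi> "-y"] assms(2)
  by (simp_all add: add.commute)

locale mollified =
  fixes \<epsilon> :: real and \<phi> :: "real \<Rightarrow> real" and u :: "real \<Rightarrow> complex"
  assumes moll: "mollifier \<epsilon> \<phi>" and L2u: "L2 u"
begin

lemma \<phi>_smooth: "smooth_real \<phi>" and \<phi>_nonneg: "\<phi> x \<ge> 0" and \<phi>_support: "\<bar>x\<bar> \<ge> \<epsilon> \<Longrightarrow> \<phi> x = 0"
  and \<phi>_int: "integrable lborel \<phi>" and \<phi>_one: "(\<integral>x. \<phi> x \<partial>lborel) = 1"
  using moll by (auto simp: mollifier_def)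

lemma u_meas [measurable]: "u \<in> borel_measurable borel" and u_int: "integrable lborel (\<lambda>x. (norm (u x))\<^sup>2)"
  using L2u by (auto simp: L2_def)

lemma \<phi>_cont: "continuous_on S \<phi>" by (rule smooth_real_continuous[OF \<phi>_smooth])

lemma \<phi>_meas [measurable]: "\<phi> \<in> borel_measurable borel"
  by (rule borel_measurable_continuous_onI[OF \<phi>_cont])

text \<open>Averages of |u|^2 and |u| with weight \<phi> near \<open>y\<close>. \<open>N\<close>
  bounds the mollification, its square is at most \<open>G\<close>, and \<open>G\<close> has the
  same integral as |u|^2; the estimates built on them do not depend on the size of \<phi>.\<close>

definition G :: "real \<Rightarrow> real" where "G y = (\<integral>x. (norm (u x))\<^sup>2 * \<phi> (y - x) \<partial>lborel)"
definition N :: "real \<Rightarrow> real" where "N y = (\<integral>x. norm (u x) * \<phi> (y - x) \<partial>lborel)"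

lemma \<phi>_bounded: "\<exists>M\<ge>0. \<forall>x. \<phi> x \<le> M"
proof -
  obtain M where M: "M \<ge> 0" "\<And>x. \<bar>\<phi> x\<bar> \<le> M * indicator {-\<epsilon>..\<epsilon>} x"
    using compact_support_bounded[OF \<phi>_cont \<phi>_support] by blast
  have "\<phi> x \<le> M" for x
    using M(2)[of x] M(1) \<phi>_nonneg[of x] by (cases "x \<in> {-\<epsilon>..\<epsilon>}") auto
  then show ?thesis using M(1) by blast
qed

lemma N_int: "integrable lborel (\<lambda>x. norm (u x) * \<phi> (y - x))"
  using integrable_norm[OF cv_integrable[OF L2u \<phi>_cont \<phi>_support, where y = y]] \<phi>_nonneg by (simp add: norm_mult)

lemma G_int: "integrable lborel (\<lambda>x. (norm (u x))\<^sup>2 * \<phi> (y - x))"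
proof -
  obtain M where M: "M \<ge> 0" "\<And>x. \<phi> x \<le> M" using \<phi>_bounded by blast
  show ?thesis
  proof (rule Bochner_Integration.integrable_bound[OF integrable_mult_left[OF u_int, of M]])
    show "AE x in lborel. norm ((norm (u x))\<^sup>2 * \<phi> (y - x)) \<le> norm ((norm (u x))\<^sup>2 * M)"
      using M \<phi>_nonneg by (intro AE_I2) (auto simp: abs_mult intro!: mult_left_mono)
  qed measurable
qed

text \<open>The variance of |u| with respect to the probability weight \<phi>(y - x) is
  nonnegative.\<close>

lemma N_sq_le_G: "(N y)\<^sup>2 \<le> G y"
proof -
  let ?m = "N y"
  have e: "(norm (u x) - ?m)\<^sup>2 * \<phi> (y - x) = (norm (u x))\<^sup>2 * \<phi> (y - x) - 2 * ?m * (norm (u x) * \<phi> (y - x)) + ?m\<^sup>2 * \<phi> (y - x)" for x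
    by (simp add: power2_eq_square algebra_simps)
  have "0 \<le> (\<integral>x. (norm (u x) - ?m)\<^sup>2 * \<phi> (y - x) \<partial>lborel)" using \<phi>_nonneg by simp
  also have "\<dots> = G y - 2 * ?m * ?m + ?m\<^sup>2 * 1"
    unfolding e using G_int[of y] N_int[of y] mollifier_shift[OF \<phi>_int \<phi>_one, of y] by (simp add: G_def N_def)
  finally show ?thesis by (simp add: power2_eq_square)
qed

lemma N_nonneg: "N y \<ge> 0" unfolding N_def using \<phi>_nonneg by simp
lemma G_nonneg: "G y \<ge> 0" unfolding G_def using \<phi>_nonneg by simp

lemma norm_cv_le_N: "norm (cv u \<phi> y) \<le> N y"
  unfolding cv_def N_def
  by (rule norm_integral_le_integral[OF cv_integrable[OF L2u \<phi>_cont \<phi>_support] N_int]) (use \<phi>_nonneg in \<open>auto simp: norm_mult\<close>)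

lemma G_total: "integrable lborel G" "(\<integral>y. G y \<partial>lborel) = (\<integral>x. (norm (u x))\<^sup>2 \<partial>lborel)"
proof -
  let ?f = "\<lambda>(x, y). (norm (u x))\<^sup>2 * \<phi> (y - x)"
  note sh = mollifier_shift[OF \<phi>_int \<phi>_one]
  have int: "integrable (lborel \<Otimes>\<^sub>M lborel) ?f"
  proof (rule lborel_pair.Fubini_integrable)
    show "?f \<in> borel_measurable (lborel \<Otimes>\<^sub>M lborel)" by measurable
    have "(\<integral>y. norm (?f (x, y)) \<partial>lborel) = (norm (u x))\<^sup>2" for x
      using sh(3,4)[of x] \<phi>_nonneg by (simp add: abs_mult)
    then show "integrable lborel (\<lambda>x. \<integral>y. norm (?f (x, y)) \<partial>lborel)" using u_int by simp
    show "AE x in lborel. integrable lborel (\<lambda>y. ?f (x, y))" using sh(3) by (intro AE_I2) simp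
  qed
  show "integrable lborel G" using lborel_pair.integrable_snd[OF int] by (simp add: G_def[abs_def])
  have "(\<integral>y. G y \<partial>lborel) = (\<integral>x. \<integral>y. (norm (u x))\<^sup>2 * \<phi> (y - x) \<partial>lborel \<partial>lborel)"
    unfolding G_def using lborel_pair.Fubini_integral[OF int] .
  then show "(\<integral>y. G y \<partial>lborel) = (\<integral>x. (norm (u x))\<^sup>2 \<partial>lborel)" using sh(4) by simp
qed

text \<open>Every fixed \<open>x\<close> eventually lies outside the support of the translated
  weight, so the integrands tend to 0 pointwise and dominated convergence applies.\<close>

lemma G_tendsto: 
  assumes "\<And>x. \<forall>\<^sub>F n in sequentially. \<bar>y n - x\<bar> \<ge> \<epsilon>"
  shows "(\<lambda>n::nat. G (y n)) \<longlonglongrightarrow> 0"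
proof -
  obtain M where M: "M \<ge> 0" "\<And>x. \<phi> x \<le> M" using \<phi>_bounded by blast
  have "(\<lambda>n. \<integral>x. (norm (u x))\<^sup>2 * \<phi> (y n - x) \<partial>lborel) \<longlonglongrightarrow> integral\<^sup>L lborel (\<lambda>x::real. 0::real)"
  proof (rule integral_dominated_convergence[where w = "\<lambda>x. (norm (u x))\<^sup>2 * M"])
    show "integrable lborel (\<lambda>x. (norm (u x))\<^sup>2 * M)" using u_int by simp
    show "AE x in lborel. (\<lambda>n. (norm (u x))\<^sup>2 * \<phi> (y n - x)) \<longlonglongrightarrow> 0"
    proof (rule AE_I2, rule tendsto_eventually)
      fix x
      show "\<forall>\<^sub>F n in sequentially. (norm (u x))\<^sup>2 * \<phi> (y n - x) = 0"
        using assms[of x] by eventually_elim (simp add: \<phi>_support)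
    qed
    show "AE x in lborel. norm ((norm (u x))\<^sup>2 * \<phi> (y n - x)) \<le> (norm (u x))\<^sup>2 * M" for n
      using M \<phi>_nonneg by (intro AE_I2) (auto simp: abs_mult intro!: mult_left_mono)
  qed measurable
  then show ?thesis by (simp add: G_def)
qed

lemma cv_tendsto:
  assumes "\<And>x. \<forall>\<^sub>F n in sequentially. \<bar>y n - x\<bar> \<ge> \<epsilon>"
  shows "(\<lambda>n::nat. norm (cv u \<phi> (y n))) \<longlonglongrightarrow> 0"
proof -
  have "(\<lambda>n. sqrt (G (y n))) \<longlonglongrightarrow> sqrt 0" by (intro tendsto_real_sqrt G_tendsto assms)
  then have 1: "(\<lambda>n. sqrt (G (y n))) \<longlonglongrightarrow> 0" by simp
  have 2: "norm (cv u \<phi> y) \<le> sqrt (G y)" for y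
    by (rule order_trans[OF norm_cv_le_N real_le_rsqrt[OF N_sq_le_G]])
  show ?thesis
  proof (rule Lim_null_comparison[OF _ 1])
    show "\<forall>\<^sub>F n in sequentially. norm (norm (cv u \<phi> (y n))) \<le> sqrt (G (y n))"
      by (rule always_eventually) (simp add: 2)
  qed
qed

text \<open>The mollification \<open>v\<close> of a weak solution satisfies \<open>v'' = (V - z) v + r\<close> with a commutator \<open>r\<close> that is
  small by the uniform continuity of \<open>V\<close>; the bound is the imaginary part of the energy identity.\<close>

lemma weak_energy_bound:
  fixes V :: "real \<Rightarrow> real"
  assumes V: "continuous_on UNIV V" and z: "Im z > 0"
    and weak: "\<And>\<psi>. test_fun \<psi> \<Longrightarrow> (\<integral>x. u x * (z * of_real (\<psi> x) + of_real ((deriv ^^ 2) \<psi> x) - of_real (V x * \<psi> x)) \<partial>lborel) = 0"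
    and \<omega>: "\<omega> \<ge> 0" "\<And>x y. \<bar>x - y\<bar> \<le> \<epsilon> \<Longrightarrow> \<bar>V x - V y\<bar> \<le> \<omega>"
  shows "integral {a..b} (\<lambda>y. (norm (cv u \<phi> y))\<^sup>2) \<le> \<omega> * (\<integral>x. (norm (u x))\<^sup>2 \<partial>lborel) / Im z"
proof -
  let ?I = "\<integral>x. (norm (u x))\<^sup>2 \<partial>lborel"
  define v where "v = cv u \<phi>"
  define v1 where "v1 = cv u (deriv \<phi>)"
  define v2 where "v2 = cv u (deriv (deriv \<phi>))"
  note sm1 = smooth_real_deriv[OF \<phi>_smooth]
  note sm2 = smooth_real_deriv[OF sm1]
  have su1: "\<bar>x\<bar> \<ge> \<epsilon> \<Longrightarrow> deriv \<phi> x = 0" for x by (rule smooth_deriv_support[OF \<phi>_smooth \<phi>_support])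
  have su2: "\<bar>x\<bar> \<ge> \<epsilon> \<Longrightarrow> deriv (deriv \<phi>) x = 0" for x by (rule smooth_deriv_support[OF sm1 su1])
  have dv: "(v has_vector_derivative v1 y) (at y)" for y unfolding v_def v1_def by (rule cv_deriv[OF L2u \<phi>_smooth \<phi>_support])
  have dv1: "(v1 has_vector_derivative v2 y) (at y)" for y unfolding v1_def v2_def by (rule cv_deriv[OF L2u sm1 su1])
  define r where "r y = v2 y - (of_real (V y) - z) * v y" for y
  have r_eq: "r y = (\<integral>x. u x * of_real ((V x - V y) * \<phi> (y - x)) \<partial>lborel)"
    and r_int: "integrable lborel (\<lambda>x. u x * of_real ((V x - V y) * \<phi> (y - x)))" for y
  proof -
    \<comment> \<open>Testing with the reflected translate of \<phi> turns the weak equation into an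
      identity at the point \<open>y\<close>.\<close>
    define \<psi> where "\<psi> x = 1 * \<phi> ((-1) * x + y)" for x
    have tf: "test_fun \<psi>"
      unfolding test_fun_def
    proof
      show "smooth_real \<psi>" unfolding \<psi>_def[abs_def] by (rule deriv_funpow_affine(2)[OF \<phi>_smooth])
      show "\<exists>r. \<forall>x. r < \<bar>x\<bar> \<longrightarrow> \<psi> x = 0"
        by (rule exI[of _ "\<bar>y\<bar> + \<epsilon>"]) (auto simp: \<psi>_def intro!: \<phi>_support)
    qed
    have d2: "(deriv ^^ 2) \<psi> = (\<lambda>x. deriv (deriv \<phi>) (y - x))"
      unfolding \<psi>_def[abs_def] deriv_funpow_affine(1)[OF \<phi>_smooth] by (simp add: eval_nat_numeral)
    have p: "\<psi> x = \<phi> (y - x)" for x by (simp add: \<psi>_def)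
    have i0: "integrable lborel (\<lambda>x. u x * of_real (\<phi> (y - x)))" by (rule cv_integrable[OF L2u \<phi>_cont \<phi>_support])
    have i2: "integrable lborel (\<lambda>x. u x * of_real (deriv (deriv \<phi>) (y - x)))" by (rule cv_integrable[OF L2u smooth_real_continuous[OF sm2] su2])
    have iV: "integrable lborel (\<lambda>x. u x * of_real (V x * \<phi> (y - x)))"
    proof -
      have c: "continuous_on UNIV (\<lambda>x. V x * \<phi> (y - x))"
        by (intro continuous_intros V continuous_on_compose2[OF \<phi>_cont[of UNIV]]) auto
      have s: "V x * \<phi> (y - x) = 0" if "\<bar>x\<bar> \<ge> \<bar>y\<bar> + \<epsilon>" for x using that by (auto intro!: \<phi>_support)
      obtain M where M: "M \<ge> 0" "\<And>x. \<bar>V x * \<phi> (y - x)\<bar> \<le> M * indicator {-(\<bar>y\<bar> + \<epsilon>)..\<bar>y\<bar> + \<epsilon>} x"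
        using compact_support_bounded[OF c s] by blast
      have c': "continuous_on UNIV (\<lambda>x. complex_of_real (V x * \<phi> (y - x)))" by (rule continuous_on_of_real[OF c])
      show ?thesis
        by (rule L2_mult_integrable[OF L2u borel_measurable_continuous_onI[OF c']]) (use M(2) in \<open>simp only: norm_of_real\<close>)
    qed
    have "0 = (\<integral>x. z * (u x * of_real (\<phi> (y - x))) + u x * of_real (deriv (deriv \<phi>) (y - x)) - u x * of_real (V x * \<phi> (y - x)) \<partial>lborel)"
      unfolding weak[OF tf, symmetric] d2 p by (rule Bochner_Integration.integral_cong) (auto simp: algebra_simps)
    also have "\<dots> = z * v y + v2 y - (\<integral>x. u x * of_real (V x * \<phi> (y - x)) \<partial>lborel)"
      using i0 i2 iV by (simp add: v_def v2_def cv_def)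
    finally have "v2 y = (\<integral>x. u x * of_real (V x * \<phi> (y - x)) \<partial>lborel) - z * v y" by (simp add: algebra_simps)
    then have "r y = (\<integral>x. u x * of_real (V x * \<phi> (y - x)) \<partial>lborel) - of_real (V y) * v y" by (simp add: r_def algebra_simps)
    also have "\<dots> = (\<integral>x. u x * of_real (V x * \<phi> (y - x)) - of_real (V y) * (u x * of_real (\<phi> (y - x))) \<partial>lborel)"
      using i0 iV by (simp add: v_def cv_def)
    finally show "r y = (\<integral>x. u x * of_real ((V x - V y) * \<phi> (y - x)) \<partial>lborel)" by (simp add: algebra_simps)
    have "integrable lborel (\<lambda>x. u x * of_real (V x * \<phi> (y - x)) - of_real (V y) * (u x * of_real (\<phi> (y - x))))"
      using i0 iV by simp
    then show "integrable lborel (\<lambda>x. u x * of_real ((V x - V y) * \<phi> (y - x)))" by (simp add: algebra_simps)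
  qed
  have r_le: "norm (r y) \<le> \<omega> * N y" for y
  proof -
    have "norm (r y) \<le> (\<integral>x. \<omega> * (norm (u x) * \<phi> (y - x)) \<partial>lborel)"
      unfolding r_eq
    proof (rule norm_integral_le_integral[OF r_int])
      show "integrable lborel (\<lambda>x. \<omega> * (norm (u x) * \<phi> (y - x)))" using N_int by simp
      fix x
      have "\<bar>V x - V y\<bar> * \<phi> (y - x) \<le> \<omega> * \<phi> (y - x)"
      proof (cases "\<bar>y - x\<bar> \<ge> \<epsilon>")
        case False
        then show ?thesis using \<omega>(2)[of x y] \<phi>_nonneg by (intro mult_right_mono) auto
      qed (simp add: \<phi>_support)
      then have "norm (u x) * (\<bar>V x - V y\<bar> * \<phi> (y - x)) \<le> norm (u x) * (\<omega> * \<phi> (y - x))" by (rule mult_left_mono) simp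
      then show "norm (u x * of_real ((V x - V y) * \<phi> (y - x))) \<le> \<omega> * (norm (u x) * \<phi> (y - x))"
        unfolding norm_mult norm_of_real abs_mult using \<phi>_nonneg[of "y - x"] by (simp add: mult_ac)
    qed
    then show ?thesis by (simp add: N_def)
  qed
  \<comment> \<open>Both factors are bounded by averages, |r| \<le> \<omega> N and |v| \<le> N, and
    N^2 \<le> G.\<close>
  have rv: "Im (r y * cnj (v y)) \<le> \<omega> * G y" for y
  proof -
    have "Im (r y * cnj (v y)) \<le> norm (r y) * norm (v y)" using abs_Im_le_cmod[of "r y * cnj (v y)"] unfolding norm_mult complex_mod_cnj by linarith
    also have "\<dots> \<le> (\<omega> * N y) * N y" using r_le norm_cv_le_N[of y] \<omega>(1) N_nonneg[of y] unfolding v_def by (intro mult_mono) auto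
    also have "\<dots> \<le> \<omega> * G y" using mult_left_mono[OF N_sq_le_G[of y] \<omega>(1)] by (simp add: power2_eq_square mult.assoc)
    finally show ?thesis .
  qed
  define E where "E y = Im (v1 y * cnj (v y))" for y
  have dE: "(E has_vector_derivative Im (r y * cnj (v y)) - Im z * (norm (v y))\<^sup>2) (at y)" for y
  proof -
    have "((\<lambda>y. v1 y * cnj (v y)) has_vector_derivative v1 y * cnj (v1 y) + v2 y * cnj (v y)) (at y)"
      by (rule has_vector_derivative_mult[OF dv1 bounded_linear.has_vector_derivative[OF bounded_linear_cnj dv]])
    from bounded_linear.has_vector_derivative[OF bounded_linear_Im this]
    have 1: "(E has_vector_derivative Im (v1 y * cnj (v1 y) + v2 y * cnj (v y))) (at y)" unfolding E_def .
    have "v1 y * cnj (v1 y) = of_real ((norm (v1 y))\<^sup>2)" "v y * cnj (v y) = of_real ((norm (v y))\<^sup>2)"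
      by (simp_all only: complex_norm_square)
    moreover have "v2 y * cnj (v y) = r y * cnj (v y) + (of_real (V y) - z) * (v y * cnj (v y))"
      by (simp add: r_def algebra_simps)
    ultimately have "Im (v1 y * cnj (v1 y) + v2 y * cnj (v y)) = Im (r y * cnj (v y)) - Im z * (norm (v y))\<^sup>2"
      by (simp only:) simp
    then show ?thesis using 1 by simp
  qed
  have cvv: "continuous_on S v" for S
    by (intro continuous_at_imp_continuous_on ballI has_vector_derivative_continuous[OF dv])
  \<comment> \<open>Integrating \<open>dE\<close> over a symmetric interval leaves the commutator
    term, bounded by \<omega> times the integral of \<open>G\<close>, and the two boundary values of
    \<open>E\<close>.\<close>
  have main: "Im z * integral {-t..t} (\<lambda>y. (norm (v y))\<^sup>2) \<le> \<omega> * ?I + \<bar>E t\<bar> + \<bar>E (-t)\<bar>" if t: "t \<ge> 0" for t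
  proof -
    have h1: "((\<lambda>y. Im (r y * cnj (v y)) - Im z * (norm (v y))\<^sup>2) has_integral E t - E (-t)) {-t..t}"
      by (rule fundamental_theorem_of_calculus) (use t dE in \<open>auto intro: has_vector_derivative_at_within\<close>)
    have si: "set_integrable lborel {-t..t} G" unfolding set_integrable_def
      using G_total(1) by (rule integrable_mult_indicator[rotated]) simp
    have Gi: "G integrable_on {-t..t}" "integral {-t..t} G = (LINT y:{-t..t}|lborel. G y)"
      using set_borel_integral_eq_integral[OF si] by simp_all
    have "(LINT y:{-t..t}|lborel. G y) \<le> (\<integral>y. G y \<partial>lborel)"
      unfolding set_lebesgue_integral_def
      by (rule integral_mono[OF si[unfolded set_integrable_def] G_total(1)]) (use G_nonneg in \<open>auto simp: indicator_def\<close>)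
    then have GI: "integral {-t..t} G \<le> ?I" using Gi(2) G_total(2) by simp
    have i2: "(\<lambda>y. Im z * (norm (v y))\<^sup>2) integrable_on {-t..t}"
      by (intro integrable_continuous_real continuous_intros cvv)
    have "integral {-t..t} (\<lambda>y. Im z * (norm (v y))\<^sup>2) + (E t - E (-t))
      = integral {-t..t} (\<lambda>y. Im z * (norm (v y))\<^sup>2 + (Im (r y * cnj (v y)) - Im z * (norm (v y))\<^sup>2))"
      using Henstock_Kurzweil_Integration.integral_add[OF i2 has_integral_integrable[OF h1]] integral_unique[OF h1] by simp
    also have "\<dots> \<le> integral {-t..t} (\<lambda>y. \<omega> * G y)"
      by (rule integral_le[OF integrable_add[OF i2 has_integral_integrable[OF h1]]])
         (use rv Gi in \<open>auto intro: integrable_on_mult_right\<close>)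
    also have "\<dots> \<le> \<omega> * ?I" using GI \<omega>(1) by (simp add: mult_left_mono)
    finally show ?thesis by (simp add: abs_if split: if_splits)
  qed
  \<comment> \<open>The boundary values vanish in the limit: \<open>v\<close> tends to 0 along n and
    -n by \<open>cv_tendsto\<close>, while its derivative stays bounded.\<close>
  have lim: "(\<lambda>n. \<omega> * ?I + \<bar>E (real n)\<bar> + \<bar>E (- real n)\<bar>) \<longlonglongrightarrow> \<omega> * ?I"
  proof -
    obtain M where M: "M \<ge> 0" "\<And>x. \<bar>deriv \<phi> x\<bar> \<le> M * indicator {-\<bar>\<epsilon>\<bar>..\<bar>\<epsilon>\<bar>} x"
      using compact_support_bounded[OF smooth_real_continuous[OF sm1], of "\<bar>\<epsilon>\<bar>"] su1 by auto
    define C where "C = M * (2 * \<bar>\<epsilon>\<bar> + ?I)"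
    have C: "norm (v1 y) \<le> C" for y
      unfolding C_def v1_def by (rule norm_cv_le[OF L2u smooth_real_continuous[OF sm1] _ M]) (use su1 in auto)
    have bE: "norm \<bar>E y\<bar> \<le> C * norm (v y)" for y
    proof -
      have "\<bar>E y\<bar> \<le> norm (v1 y) * norm (v y)" using abs_Im_le_cmod[of "v1 y * cnj (v y)"] by (simp add: E_def norm_mult)
      also have "\<dots> \<le> C * norm (v y)" using C by (intro mult_right_mono) auto
      finally show ?thesis by simp
    qed
    have E0: "(\<lambda>n. \<bar>E (y n)\<bar>) \<longlonglongrightarrow> 0" if y: "\<And>x. \<forall>\<^sub>F n in sequentially. \<bar>y n - x\<bar> \<ge> \<epsilon>" for y :: "nat \<Rightarrow> real"
    proof (rule Lim_null_comparison)
      show "\<forall>\<^sub>F n in sequentially. norm \<bar>E (y n)\<bar> \<le> C * norm (v (y n))" using bE by (intro always_eventually allI)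
      show "(\<lambda>n. C * norm (v (y n))) \<longlonglongrightarrow> 0"
        using tendsto_mult_left[OF cv_tendsto[OF y], of C] by (simp add: v_def)
    qed
    have ev: "\<forall>\<^sub>F n in sequentially. real n \<ge> \<bar>x\<bar> + \<epsilon>" for x
      using filterlim_real_sequentially by (simp add: filterlim_at_top)
    have "(\<lambda>n. \<omega> * ?I + \<bar>E (real n)\<bar> + \<bar>E (- real n)\<bar>) \<longlonglongrightarrow> \<omega> * ?I + 0 + 0"
    proof (intro tendsto_add tendsto_const E0)
      show "\<forall>\<^sub>F n in sequentially. \<bar>real n - x\<bar> \<ge> \<epsilon>" for x using ev[of x] by eventually_elim auto
      show "\<forall>\<^sub>F n in sequentially. \<bar>- real n - x\<bar> \<ge> \<epsilon>" for x using ev[of x] by eventually_elim auto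
    qed
    then show ?thesis by simp
  qed
  have "Im z * integral {a..b} (\<lambda>y. (norm (v y))\<^sup>2) \<le> \<omega> * ?I"
  proof (rule LIMSEQ_le_const[OF lim])
    obtain n0 :: nat where n0: "real n0 \<ge> \<bar>a\<bar> + \<bar>b\<bar>" using real_arch_simple by blast
    show "\<exists>n0. \<forall>n\<ge>n0. Im z * integral {a..b} (\<lambda>y. (norm (v y))\<^sup>2) \<le> \<omega> * ?I + \<bar>E (real n)\<bar> + \<bar>E (- real n)\<bar>"
    proof (intro exI[of _ n0] allI impI)
      fix n assume n: "n \<ge> n0"
      have "integral {a..b} (\<lambda>y. (norm (v y))\<^sup>2) \<le> integral {-real n..real n} (\<lambda>y. (norm (v y))\<^sup>2)"
      proof (rule integral_subset_le)
        have "\<bar>a\<bar> + \<bar>b\<bar> \<le> real n" using n n0 by linarith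
        then show "{a..b} \<subseteq> {-real n..real n}" by auto
      qed (auto intro!: integrable_continuous_real continuous_intros cvv)
      then have "Im z * integral {a..b} (\<lambda>y. (norm (v y))\<^sup>2) \<le> Im z * integral {-real n..real n} (\<lambda>y. (norm (v y))\<^sup>2)"
        using z by (intro mult_left_mono) auto
      also have "\<dots> \<le> \<omega> * ?I + \<bar>E (real n)\<bar> + \<bar>E (- real n)\<bar>" by (rule main) simp
      finally show "Im z * integral {a..b} (\<lambda>y. (norm (v y))\<^sup>2) \<le> \<omega> * ?I + \<bar>E (real n)\<bar> + \<bar>E (- real n)\<bar>" .
    qed
  qed
  then show ?thesis using z by (simp add: v_def pos_le_divide_eq mult.commute)
qed

text \<open>Fubini moves the mollifier from \<open>u\<close> to the indicator of
  \<open>{a..b}\<close>. The weight \<kappa> is that indicator smoothed over distance \<epsilon>: it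
  lies between 0 and 1 and differs from it only near the endpoints.\<close>

lemma integral_cv:
  fixes a b :: real
  defines "\<kappa> x \<equiv> \<integral>y. indicator {a..b} y * \<phi> (y - x) \<partial>lborel"
  assumes e: "\<epsilon> > 0" and ab: "a < b"
  shows "integral {a..b} (cv u \<phi>) = (\<integral>x. u x * of_real (\<kappa> x) \<partial>lborel)"
    "0 \<le> \<kappa> x" "\<kappa> x \<le> indicator {a-\<epsilon>..b+\<epsilon>} x" "a + \<epsilon> \<le> x \<Longrightarrow> x \<le> b - \<epsilon> \<Longrightarrow> \<kappa> x = 1" "\<kappa> \<in> borel_measurable borel"
proof -
  note sh = mollifier_shift[OF \<phi>_int \<phi>_one]
  have ki: "integrable lborel (\<lambda>y. indicator {a..b} y * \<phi> (y - x))" for x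
    using integrable_mult_indicator[OF _ sh(3)[of x], of "{a..b}"] by simp
  show k0: "0 \<le> \<kappa> x" for x unfolding \<kappa>_def using \<phi>_nonneg by simp
  show k1: "\<kappa> x \<le> indicator {a-\<epsilon>..b+\<epsilon>} x" for x
  proof (cases "x \<in> {a-\<epsilon>..b+\<epsilon>}")
    case True
    have "\<kappa> x \<le> (\<integral>y. \<phi> (y - x) \<partial>lborel)" unfolding \<kappa>_def
      by (rule integral_mono[OF ki sh(3)]) (use \<phi>_nonneg in \<open>auto simp: indicator_def\<close>)
    then show ?thesis using sh(4) True by simp
  next
    case False
    have "(\<lambda>y. indicator {a..b} y * \<phi> (y - x)) = (\<lambda>y. 0)"
      using False by (auto simp: indicator_def fun_eq_iff intro!: \<phi>_support)
    then show ?thesis using False by (simp add: \<kappa>_def)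
  qed
  show "\<kappa> x = 1" if "a + \<epsilon> \<le> x" "x \<le> b - \<epsilon>" for x
  proof -
    have "indicator {a..b} y * \<phi> (y - x) = \<phi> (y - x)" for y
    proof (cases "y \<in> {a..b}")
      case False
      then have "\<phi> (y - x) = 0" using that by (intro \<phi>_support) auto
      then show ?thesis by simp
    qed simp
    then have "(\<lambda>y. indicator {a..b} y * \<phi> (y - x)) = (\<lambda>y. \<phi> (y - x))" by (rule ext)
    then show ?thesis using sh(4) by (simp add: \<kappa>_def)
  qed
  show km: "\<kappa> \<in> borel_measurable borel" unfolding \<kappa>_def by measurable
  let ?f = "\<lambda>(x, y). u x * of_real (indicator {a..b} y * \<phi> (y - x))"
  have int: "integrable (lborel \<Otimes>\<^sub>M lborel) ?f"
  proof (rule lborel_pair.Fubini_integrable)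
    show "?f \<in> borel_measurable (lborel \<Otimes>\<^sub>M lborel)" by measurable
    have "(\<integral>y. norm (?f (x, y)) \<partial>lborel) = norm (u x * of_real (\<kappa> x))" for x
    proof -
      have "(\<integral>y. norm (?f (x, y)) \<partial>lborel) = (\<integral>y. norm (u x) * (indicator {a..b} y * \<phi> (y - x)) \<partial>lborel)"
        by (rule Bochner_Integration.integral_cong) (use \<phi>_nonneg in \<open>auto simp: norm_mult indicator_def\<close>)
      then show ?thesis using k0[of x] by (simp add: norm_mult \<kappa>_def)
    qed
    moreover have "integrable lborel (\<lambda>x. norm (u x * of_real (\<kappa> x)))"
    proof (intro integrable_norm L2_mult_integrable[OF L2u, where C = 1 and a = "a - \<epsilon>" and b = "b + \<epsilon>"])
      show "(\<lambda>x. complex_of_real (\<kappa> x)) \<in> borel_measurable borel" using km by measurable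
      show "norm (complex_of_real (\<kappa> x)) \<le> 1 * indicator {a - \<epsilon>..b + \<epsilon>} x" for x using k0[of x] k1[of x] by simp
    qed
    ultimately show "integrable lborel (\<lambda>x. \<integral>y. norm (?f (x, y)) \<partial>lborel)" by simp
    show "AE x in lborel. integrable lborel (\<lambda>y. ?f (x, y))"
    proof (rule AE_I2)
      fix x
      have "integrable lborel (\<lambda>y. u x * complex_of_real (indicator {a..b} y * \<phi> (y - x)))"
        by (intro integrable_mult_right integrable_of_real ki)
      then show "integrable lborel (\<lambda>y. ?f (x, y))" by simp
    qed
  qed
  have cc: "continuous_on {a..b} (cv u \<phi>)"
    by (intro continuous_at_imp_continuous_on ballI has_vector_derivative_continuous[OF cv_deriv[OF L2u \<phi>_smooth \<phi>_support]])
  have "integral {a..b} (cv u \<phi>) = (\<integral>y. indicator {a..b} y *\<^sub>R cv u \<phi> y \<partial>lborel)"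
    using set_borel_integral_eq_integral(2)[OF borel_integrable_atLeastAtMost'[OF cc]] by (simp add: set_lebesgue_integral_def)
  also have "\<dots> = (\<integral>y. \<integral>x. u x * of_real (indicator {a..b} y * \<phi> (y - x)) \<partial>lborel \<partial>lborel)"
    by (rule Bochner_Integration.integral_cong) (auto simp: cv_def indicator_def)
  also have "\<dots> = (\<integral>x. \<integral>y. u x * of_real (indicator {a..b} y * \<phi> (y - x)) \<partial>lborel \<partial>lborel)"
    using lborel_pair.Fubini_integral[OF int] .
  also have "\<dots> = (\<integral>x. u x * of_real (\<kappa> x) \<partial>lborel)"
    unfolding \<kappa>_def by (simp only: integral_mult_right_zero integral_complex_of_real)
  finally show "integral {a..b} (cv u \<phi>) = (\<integral>x. u x * of_real (\<kappa> x) \<partial>lborel)" .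
qed

end

text \<open>Integrals of \<open>u\<close> over intervals are limits of those of its mollifications.
  The latter tend to 0 in the L2 norm, because the commutator is controlled by the oscillation of
  \<open>V\<close> at scale \<epsilon>; on a finite interval the L1 norm follows from |v| \<le> t +
  |v|^2 / t.\<close>

lemma weak_solution_unique:
  fixes V :: "real \<Rightarrow> real"
  assumes V: "continuous_on UNIV V" and uc: "\<And>e. e > 0 \<Longrightarrow> \<exists>d>0. \<forall>x y. \<bar>x - y\<bar> < d \<longrightarrow> \<bar>V x - V y\<bar> < e"
    and z: "Im z > 0" and u: "L2 u"
    and weak: "\<And>\<psi>. test_fun \<psi> \<Longrightarrow> (\<integral>x. u x * (z * of_real (\<psi> x) + of_real ((deriv ^^ 2) \<psi> x) - of_real (V x * \<psi> x)) \<partial>lborel) = 0"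
  shows "AE x in lborel. u x = 0"
proof (rule AE_zero_if_interval_integrals_zero)
  show um: "u \<in> borel_measurable borel" using u by (simp add: L2_def)
  have ind: "norm (indicator {a..b} x :: complex) \<le> 1 * indicator {a..b} x" for a b x :: real by (auto simp: indicator_def)
  show ui: "integrable lborel (\<lambda>x. u x * indicator {a..b} x)" for a b
    by (rule L2_mult_integrable[OF u _ ind]) simp
  fix a b :: real assume ab: "a < b"
  define \<epsilon> where "\<epsilon> n = 1 / real (Suc n)" for n
  have e0: "\<epsilon> n > 0" "\<epsilon> n \<le> 1" for n by (auto simp: \<epsilon>_def)
  have epslim: "\<epsilon> \<longlonglongrightarrow> 0" unfolding \<epsilon>_def using LIMSEQ_inverse_real_of_nat by (simp add: divide_inverse)
  have "\<exists>\<phi>. mollifier (\<epsilon> n) \<phi>" for n using mollifier_exists[OF e0(1)[of n]] unfolding mollifier_def by metis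
  then obtain \<phi> where \<phi>: "\<And>n. mollifier (\<epsilon> n) (\<phi> n)" by metis
  have ml: "mollified (\<epsilon> n) (\<phi> n) u" for n using \<phi> u by (simp add: mollified_def)
  let ?I = "\<integral>x. (norm (u x))\<^sup>2 \<partial>lborel"
  let ?\<kappa> = "\<lambda>n x. \<integral>y. indicator {a..b} y * \<phi> n (y - x) \<partial>lborel"
  note ic = mollified.integral_cv[OF ml e0(1) ab]
  have 1: "(\<lambda>n. integral {a..b} (cv u (\<phi> n))) \<longlonglongrightarrow> (\<integral>x. u x * indicator {a..b} x \<partial>lborel)"
    unfolding ic(1)
  proof (rule integral_dominated_convergence[where w = "\<lambda>x. norm (u x * indicator {a-1..b+1} x)"])
    show "integrable lborel (\<lambda>x. norm (u x * indicator {a-1..b+1} x))" by (intro integrable_norm ui)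
    show "(\<lambda>x. u x * complex_of_real (?\<kappa> n x)) \<in> borel_measurable lborel" for n
      using ic(5)[of n] um by measurable
    show "AE x in lborel. norm (u x * complex_of_real (?\<kappa> n x)) \<le> norm (u x * indicator {a-1..b+1} x)" for n
    proof (rule AE_I2)
      fix x
      have "\<bar>?\<kappa> n x\<bar> \<le> indicator {a - \<epsilon> n..b + \<epsilon> n} x" using ic(2)[of n x] ic(3)[of n x] by simp
      also have "\<dots> \<le> indicator {a-1..b+1} x" using e0(2)[of n] by (auto simp: indicator_def)
      finally have "norm (u x) * \<bar>?\<kappa> n x\<bar> \<le> norm (u x) * indicator {a-1..b+1} x" by (rule mult_left_mono) simp
      moreover have "norm (indicator {a-1..b+1} x :: complex) = indicator {a-1..b+1} x" by (auto simp: indicator_def)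
      ultimately show "norm (u x * complex_of_real (?\<kappa> n x)) \<le> norm (u x * indicator {a-1..b+1} x)" by (simp only: norm_mult norm_of_real)
    qed
    show "AE x in lborel. (\<lambda>n. u x * complex_of_real (?\<kappa> n x)) \<longlonglongrightarrow> u x * indicator {a..b} x"
      using AE_lborel_singleton[of a] AE_lborel_singleton[of b]
    proof eventually_elim
      case (elim x)
      consider "a < x" "x < b" | "x < a" | "x > b" using elim by linarith
      then have "\<forall>\<^sub>F n in sequentially. ?\<kappa> n x = indicator {a..b} x"
      proof cases
        case 1
        have "\<forall>\<^sub>F n in sequentially. \<epsilon> n < min (x - a) (b - x)" by (rule order_tendstoD(2)[OF epslim]) (use 1 in auto)
        then show ?thesis by eventually_elim (use 1 ic(4)[of _ x] in auto)
      next
        case 2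
        have "\<forall>\<^sub>F n in sequentially. \<epsilon> n < a - x" by (rule order_tendstoD(2)[OF epslim]) (use 2 in auto)
        then show ?thesis
        proof eventually_elim
          case (elim n)
          then show ?case using 2 ic(2)[of n x] ic(3)[of n x] by simp
        qed
      next
        case 3
        have "\<forall>\<^sub>F n in sequentially. \<epsilon> n < x - b" by (rule order_tendstoD(2)[OF epslim]) (use 3 in auto)
        then show ?thesis
        proof eventually_elim
          case (elim n)
          then show ?case using 3 ic(2)[of n x] ic(3)[of n x] by simp
        qed
      qed
      then have "(\<lambda>n. ?\<kappa> n x) \<longlonglongrightarrow> indicator {a..b} x" by (rule tendsto_eventually)
      then have "(\<lambda>n. u x * complex_of_real (?\<kappa> n x)) \<longlonglongrightarrow> u x * complex_of_real (indicator {a..b} x)"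
        by (intro tendsto_intros)
      moreover have "complex_of_real (indicator {a..b} x) = indicator {a..b} x" by (simp add: indicator_def)
      ultimately show ?case by (simp only:)
    qed
  qed (use um in measurable)
  have 2: "(\<lambda>n. integral {a..b} (cv u (\<phi> n))) \<longlonglongrightarrow> 0"
  proof (rule LIMSEQ_I)
    fix e :: real assume e: "e > 0"
    \<comment> \<open>\<open>t\<close> makes the constant part of |v| \<le> t + |v|^2 / t contribute
      e/4; \<omega> is then chosen so that the quadratic part contributes at most e/4. The summand 1
      in I + 1 keeps its definition meaningful when I = 0.\<close>
    define t where "t = (e / 4) / (b - a)"
    have "b - a \<noteq> 0" using ab by simp
    then have t: "t > 0" "(b - a) * t = e / 4"
      using e ab unfolding t_def times_divide_eq_right by (simp, metis nonzero_mult_div_cancel_left times_divide_eq_right)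
    define I where "I = ?I"
    define \<omega> where "\<omega> = e * t * Im z / (4 * (I + 1))"
    have I0: "I \<ge> 0" by (simp add: I_def)
    then have I1: "4 * (I + 1) > 0" by simp
    have w: "\<omega> > 0" unfolding \<omega>_def by (intro divide_pos_pos mult_pos_pos e t z I1)
    have S: "\<omega> * I / Im z \<le> e * t / 4"
    proof -
      have "\<omega> * I / Im z = e * t / 4 * (I / (I + 1))" using z I0 by (simp add: \<omega>_def)
      also have "\<dots> \<le> e * t / 4 * 1" using I0 e t by (intro mult_left_mono) (auto simp: divide_le_eq)
      finally show ?thesis by simp
    qed
    obtain d where d: "d > 0" "\<And>x y. \<bar>x - y\<bar> < d \<Longrightarrow> \<bar>V x - V y\<bar> < \<omega>" using uc[OF w] by blast
    have "\<forall>\<^sub>F n in sequentially. \<epsilon> n < d" using epslim d(1) by (rule order_tendstoD(2))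
    then obtain n0 where n0: "\<And>n. n \<ge> n0 \<Longrightarrow> \<epsilon> n < d" unfolding eventually_sequentially by blast
    show "\<exists>no. \<forall>n\<ge>no. norm (integral {a..b} (cv u (\<phi> n)) - 0) < e"
    proof (intro exI[of _ n0] allI impI)
      fix n assume n: "n \<ge> n0"
      interpret mollified "\<epsilon> n" "\<phi> n" u by (rule ml)
      have osc: "\<bar>V x - V y\<bar> \<le> \<omega>" if "\<bar>x - y\<bar> \<le> \<epsilon> n" for x y using d(2)[of x y] n0[OF n] that by simp
      have eb: "integral {a..b} (\<lambda>y. (norm (cv u (\<phi> n) y))\<^sup>2) \<le> e * t / 4"
        by (rule order_trans[OF weak_energy_bound[OF V z weak less_imp_le[OF w] osc] S[unfolded I_def]])
      have cc: "continuous_on {a..b} (cv u (\<phi> n))"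
        by (intro continuous_at_imp_continuous_on ballI has_vector_derivative_continuous[OF cv_deriv[OF L2u \<phi>_smooth \<phi>_support]])
      have i: "(\<lambda>y. (norm (cv u (\<phi> n) y))\<^sup>2) integrable_on {a..b}" by (intro integrable_continuous_real continuous_intros cc)
      have "norm (integral {a..b} (cv u (\<phi> n))) \<le> integral {a..b} (\<lambda>y. t + (norm (cv u (\<phi> n) y))\<^sup>2 * (1 / t))"
      proof (rule Henstock_Kurzweil_Integration.integral_norm_bound_integral)
        fix y
        let ?v = "norm (cv u (\<phi> n) y)"
        have "0 \<le> (?v - t)\<^sup>2" by simp
        then have "2 * (t * ?v) \<le> t * t + ?v\<^sup>2" by (simp add: power2_eq_square algebra_simps)
        moreover have "0 \<le> t * ?v" by (rule mult_nonneg_nonneg[OF less_imp_le[OF t(1)] norm_ge_zero])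
        ultimately have "t * ?v \<le> t * t + ?v\<^sup>2" by linarith
        then show "?v \<le> t + ?v\<^sup>2 * (1 / t)" using t(1) by (simp add: field_simps)
      qed (use t(1) in \<open>auto intro!: integrable_continuous_real continuous_intros cc\<close>)
      also have "\<dots> = (b - a) * t + integral {a..b} (\<lambda>y. (norm (cv u (\<phi> n) y))\<^sup>2) * (1 / t)"
        unfolding Henstock_Kurzweil_Integration.integral_add[OF integrable_const_ivl integrable_on_mult_left[OF i]]
        using ab by (simp add: mult.commute)
      also have "\<dots> \<le> e / 4 + (e * t / 4) * (1 / t)" using eb t by (intro add_mono mult_right_mono) auto
      also have "\<dots> = e / 2" using t(1) by simp
      finally show "norm (integral {a..b} (cv u (\<phi> n)) - 0) < e" using e by simp
    qed
  qed
  show "(\<integral>x. u x * indicator {a..b} x \<partial>lborel) = 0" by (rule LIMSEQ_unique[OF 1 2])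
qed

section \<open>Green's function\<close>

lemma csol_repr:
  assumes V: "continuous_on UNIV V" and y: "schr_sol V z y y'"
  shows "y x = csol V (y 0) (y' 0) z x"
proof -
  note iv = ivp_solves[OF V, of z]
  have W1: "y x * ivp' V 0 1 z x - y' x * ivp V 0 1 z x = y 0"
    using wronskian_const[OF y iv[of 0 1], of x] ivp_0[OF V] by simp
  have W2: "ivp V 1 0 z x * y' x - ivp' V 1 0 z x * y x = y' 0"
    using wronskian_const[OF iv[of 1 0] y, of x] ivp_0[OF V] by simp
  have "csol V (y 0) (y' 0) z x = y x * (ivp V 1 0 z x * ivp' V 0 1 z x - ivp' V 1 0 z x * ivp V 0 1 z x)"
    unfolding csol_def W1[symmetric] W2[symmetric] by (simp add: algebra_simps)
  then show ?thesis by (simp add: ivp_wronskian[OF V])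
qed

section \<open>Classical solutions against test functions\<close>

definition Lop :: "(real \<Rightarrow> real) \<Rightarrow> complex \<Rightarrow> (real \<Rightarrow> real) \<Rightarrow> real \<Rightarrow> complex" where
  "Lop V z \<phi> x = z * of_real (\<phi> x) + of_real ((deriv ^^ 2) \<phi> x) - of_real (V x * \<phi> x)"

lemma test_fun_props:
  assumes V: "continuous_on UNIV V" and \<phi>: "test_fun \<phi>"
  obtains R M where "R > 0" "M \<ge> 0" "\<And>x. \<bar>x\<bar> \<ge> R \<Longrightarrow> \<phi> x = 0" "\<And>x. \<bar>x\<bar> \<ge> R \<Longrightarrow> deriv \<phi> x = 0"
    "\<And>x. \<bar>x\<bar> \<ge> R \<Longrightarrow> Lop V z \<phi> x = 0" "\<And>x. norm (Lop V z \<phi> x) \<le> M * indicator {-R..R} x" "continuous_on UNIV (Lop V z \<phi>)"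
proof -
  obtain r where sm: "smooth_real \<phi>" and r: "\<And>x. \<bar>x\<bar> > r \<Longrightarrow> \<phi> x = 0" using \<phi> by (auto simp: test_fun_def)
  define R where "R = \<bar>r\<bar> + 1"
  have s0: "\<phi> x = 0" if "\<bar>x\<bar> \<ge> R" for x using that by (intro r) (auto simp: R_def)
  have s1: "deriv \<phi> x = 0" if "\<bar>x\<bar> \<ge> R" for x by (rule smooth_deriv_support[OF sm s0 that])
  have s2: "deriv (deriv \<phi>) x = 0" if "\<bar>x\<bar> \<ge> R" for x by (rule smooth_deriv_support[OF smooth_real_deriv[OF sm] s1 that])
  have c2: "continuous_on UNIV ((deriv ^^ 2) \<phi>)"
    using smooth_real_continuous[OF smooth_real_deriv[OF smooth_real_deriv[OF sm]]] by (simp add: eval_nat_numeral)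
  have cL: "continuous_on UNIV (Lop V z \<phi>)"
    unfolding Lop_def[abs_def] by (intro continuous_intros V c2 smooth_real_continuous[OF sm])
  have sL: "Lop V z \<phi> x = 0" if "\<bar>x\<bar> \<ge> R" for x using s0[OF that] s2[OF that] by (simp add: Lop_def eval_nat_numeral)
  have cn: "continuous_on UNIV (\<lambda>x. norm (Lop V z \<phi> x))" by (rule continuous_on_norm[OF cL])
  obtain M where M: "M \<ge> 0" "\<And>x. \<bar>norm (Lop V z \<phi> x)\<bar> \<le> M * indicator {-R..R} x"
    using compact_support_bounded[OF cn, of R] sL by auto
  show ?thesis
  proof (rule that[of R M])
    show "R > 0" by (simp add: R_def)
    show "norm (Lop V z \<phi> x) \<le> M * indicator {-R..R} x" for x using M(2)[of x] by simp
  qed (fact s0 s1 sL M(1) cL)+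
qed

text \<open>Lagrange's identity: as \<open>y\<close> solves the homogeneous equation, y \<phi>' - y'
  \<phi> is a primitive of y times \<open>Lop V z \<phi>\<close>.\<close>

lemma parts_integral:
  assumes V: "continuous_on UNIV V" and y: "schr_sol V z y y'" and sm: "smooth_real \<phi>" and ab: "a \<le> b"
  shows "(\<integral>x. indicator {a..b} x *\<^sub>R (y x * Lop V z \<phi> x) \<partial>lborel)
     = (y b * of_real (deriv \<phi> b) - y' b * of_real (\<phi> b)) - (y a * of_real (deriv \<phi> a) - y' a * of_real (\<phi> a))"
proof -
  have d: "((\<lambda>x. complex_of_real (f x)) has_vector_derivative complex_of_real (deriv f x)) (at x)" if "smooth_real f" for f x
    using smooth_real_DERIV[OF that, of x] unfolding has_real_derivative_iff_has_vector_derivative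
    by (rule bounded_linear.has_vector_derivative[OF bounded_linear_of_real])
  have yd: "(y has_vector_derivative y' x) (at x)" "(y' has_vector_derivative (of_real (V x) - z) * y x) (at x)" for x
    using y by (auto simp: schr_sol_def)
  have D: "((\<lambda>x. y x * of_real (deriv \<phi> x) - y' x * of_real (\<phi> x)) has_vector_derivative y x * Lop V z \<phi> x) (at x)" for x
    by (rule has_vector_derivative_eq_rhs[OF has_vector_derivative_diff[OF has_vector_derivative_mult[OF yd(1) d[OF smooth_real_deriv[OF sm]]]
        has_vector_derivative_mult[OF yd(2) d[OF sm]]]]) (simp add: Lop_def eval_nat_numeral algebra_simps)
  have c: "continuous_on {a..b} (\<lambda>x. y x * Lop V z \<phi> x)"
  proof -
    have 1: "continuous_on {a..b} ((deriv ^^ 2) \<phi>)"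
      using smooth_real_continuous[OF smooth_real_deriv[OF smooth_real_deriv[OF sm]]] by (simp add: eval_nat_numeral)
    have 2: "continuous_on {a..b} V" by (rule continuous_on_subset[OF V]) simp
    show ?thesis unfolding Lop_def
      by (intro continuous_intros schr_sol_continuous[OF y] smooth_real_continuous[OF sm] 1 2)
  qed
  have "((\<lambda>x. y x * Lop V z \<phi> x) has_integral (y b * of_real (deriv \<phi> b) - y' b * of_real (\<phi> b)) - (y a * of_real (deriv \<phi> a) - y' a * of_real (\<phi> a))) {a..b}"
    by (rule fundamental_theorem_of_calculus[OF ab has_vector_derivative_at_within[OF D]])
  then show ?thesis
    using set_borel_integral_eq_integral(2)[OF borel_integrable_atLeastAtMost'[OF c]] by (simp add: set_lebesgue_integral_def integral_unique)
qed

lemma weak_of_classical: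
  assumes V: "continuous_on UNIV V" and y: "schr_sol V z y y'" and \<phi>: "test_fun \<phi>"
  shows "(\<integral>x. y x * Lop V z \<phi> x \<partial>lborel) = 0"
proof -
  obtain R M where R: "R > 0" "\<And>x. \<bar>x\<bar> \<ge> R \<Longrightarrow> \<phi> x = 0" "\<And>x. \<bar>x\<bar> \<ge> R \<Longrightarrow> deriv \<phi> x = 0" "\<And>x. \<bar>x\<bar> \<ge> R \<Longrightarrow> Lop V z \<phi> x = 0"
    by (rule test_fun_props[OF V \<phi>, where z = z]) (rule that)
  have sm: "smooth_real \<phi>" using \<phi> by (simp add: test_fun_def)
  have "(\<lambda>x. y x * Lop V z \<phi> x) = (\<lambda>x. indicator {-R..R} x *\<^sub>R (y x * Lop V z \<phi> x))"
    using R(4) by (auto simp: indicator_def fun_eq_iff)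
  then have "(\<integral>x. y x * Lop V z \<phi> x \<partial>lborel) = (\<integral>x. indicator {-R..R} x *\<^sub>R (y x * Lop V z \<phi> x) \<partial>lborel)" by simp
  also have "\<dots> = 0" using parts_integral[OF V y sm, of "-R" R] R by simp
  finally show ?thesis .
qed

lemma L2_of_sides:
  assumes y: "continuous_on UNIV y" and r: "L2_right y" "L2_right (\<lambda>x. y (- x))"
  shows "L2 y"
proof -
  have m: "y \<in> borel_measurable borel" by (rule borel_measurable_continuous_onI[OF y])
  have i1: "integrable lborel (\<lambda>x. indicator {0..} x * (norm (y x))\<^sup>2)" using r(1) by (simp add: L2_right_def)
  have "integrable lborel (\<lambda>x. indicator {0..} x * (norm (y (- x)))\<^sup>2)" using r(2) by (simp add: L2_right_def)
  from lborel_integrable_real_affine[OF this, of "-1" 0]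
  have i2: "integrable lborel (\<lambda>x. indicator {0..} (- x) * (norm (y x))\<^sup>2)" by simp
  have "integrable lborel (\<lambda>x. (norm (y x))\<^sup>2)"
  proof (rule Bochner_Integration.integrable_bound[OF Bochner_Integration.integrable_add[OF i1 i2]])
    show "AE x in lborel. norm ((norm (y x))\<^sup>2) \<le> norm (indicator {0..} x * (norm (y x))\<^sup>2 + indicator {0..} (- x) * (norm (y x))\<^sup>2)"
      by (intro AE_I2) (auto simp: indicator_def)
  qed (use m in measurable)
  then show ?thesis using m by (simp add: L2_def)
qed

lemma AE_continuous_eq_0:
  fixes y :: "real \<Rightarrow> complex"
  assumes "continuous_on UNIV y" "AE x in lborel. y x = 0"
  shows "y x = 0"
proof (rule ccontr)
  assume "y x \<noteq> 0"
  have o: "open {x. y x \<noteq> 0}" by (rule open_Collect_neq[OF assms(1) continuous_on_const])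
  then obtain e where e: "e > 0" "ball x e \<subseteq> {x. y x \<noteq> 0}" using \<open>y x \<noteq> 0\<close> open_contains_ball by blast
  have "emeasure lborel {x. y x \<noteq> 0} = 0"
    using AE_iff_measurable[of "{x. y x \<noteq> 0}" lborel "\<lambda>x. y x = 0"] assms(2) o by simp
  moreover have "{x - e / 2..x + e / 2} \<subseteq> ball x e"
    using e(1) by (auto simp: dist_real_def)
  then have "{x - e / 2..x + e / 2} \<subseteq> {x. y x \<noteq> 0}" using e(2) by blast
  then have "emeasure lborel {x - e / 2..x + e / 2} \<le> emeasure lborel {x. y x \<noteq> 0}"
    using o by (intro emeasure_mono) auto
  moreover have "emeasure lborel {x - e / 2..x + e / 2} = ennreal e" using e(1) by (simp add: emeasure_lborel_Icc)
  ultimately show False using e(1) by simp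
qed

lemma integrable_pair_product:
  fixes f g :: "real \<Rightarrow> real"
  assumes f: "integrable lborel f" and g: "integrable lborel g"
  shows "integrable (lborel \<Otimes>\<^sub>M lborel) (\<lambda>(x, y). f x * g y)"
proof (rule lborel_pair.Fubini_integrable)
  have [measurable]: "f \<in> borel_measurable borel" "g \<in> borel_measurable borel"
    using f g by (auto dest: borel_measurable_integrable)
  show "(\<lambda>(x, y). f x * g y) \<in> borel_measurable (lborel \<Otimes>\<^sub>M lborel)" by measurable
  have "(\<integral>y. norm (case (x, y) of (x, y) \<Rightarrow> f x * g y) \<partial>lborel) = \<bar>f x\<bar> * (\<integral>y. \<bar>g y\<bar> \<partial>lborel)" for x
    by (simp add: abs_mult)
  then show "integrable lborel (\<lambda>x. \<integral>y. norm (case (x, y) of (x, y) \<Rightarrow> f x * g y) \<partial>lborel)" using f by simp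
qed (use g in simp)

text \<open>\<open>(a, b)\<close> and \<open>(c, d)\<close> are the Cauchy data at 0 of nontrivial
  solutions square integrable at \<open>+\<infinity>\<close> and \<open>-\<infinity>\<close>.
  Uniform continuity of \<open>V\<close> gives access to
  \<open>weak_solution_unique\<close>.\<close>

locale green =
  fixes V :: "real \<Rightarrow> real" and z a b c d :: complex
  assumes V: "continuous_on UNIV V" and uc: "\<And>e. e > 0 \<Longrightarrow> \<exists>\<delta>>0. \<forall>x y. \<bar>x - y\<bar> < \<delta> \<longrightarrow> \<bar>V x - V y\<bar> < e"
    and z: "Im z > 0" and ab: "a \<noteq> 0 \<or> b \<noteq> 0" and cd: "c \<noteq> 0 \<or> d \<noteq> 0"
    and right: "L2_right (csol V a b z)" and left: "L2_right (\<lambda>x. csol V c d z (- x))"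
begin

abbreviation "yp \<equiv> csol V a b z"
abbreviation "ym \<equiv> csol V c d z"
abbreviation "yp' \<equiv> csol' V a b z"
abbreviation "ym' \<equiv> csol' V c d z"

definition W :: complex where "W = c * b - d * a"

lemma yp: "schr_sol V z yp yp'" and ym: "schr_sol V z ym ym'"
  by (rule schr_sol_csol[OF V])+

lemma yp_cont: "continuous_on S yp" and ym_cont: "continuous_on S ym"
  by (rule schr_sol_continuous[OF yp], rule schr_sol_continuous[OF ym])

lemma y_meas [measurable]: "yp \<in> borel_measurable borel" "ym \<in> borel_measurable borel"
  by (rule borel_measurable_continuous_onI[OF yp_cont], rule borel_measurable_continuous_onI[OF ym_cont])

lemma W_eq: "ym x * yp' x - ym' x * yp x = W"
  using wronskian_const[OF ym yp, of x] by (simp add: csol_0[OF V] W_def)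

lemma hom_unique:
  assumes "L2 v" "\<And>\<psi>. test_fun \<psi> \<Longrightarrow> (\<integral>x. v x * Lop V z \<psi> x \<partial>lborel) = 0"
  shows "AE x in lborel. v x = 0"
  by (rule weak_solution_unique[OF V uc z assms(1)]) (use assms(2) in \<open>auto simp: Lop_def\<close>)

text \<open>If the Wronskian vanished, the two solutions would be proportional and hence a square integrable
  solution on the whole line.\<close>
lemma W_nonzero: "W \<noteq> 0"
proof
  assume "W = 0"
  then have W0: "c * b = d * a" by (simp add: W_def)
  obtain t where t: "c = t * a" "d = t * b"
  proof (cases "a = 0")
    case True
    then have "b \<noteq> 0" "c = 0" using ab W0 by auto
    then show ?thesis using that[of "d / b"] True by simp
  next
    case False
    then show ?thesis using that[of "c / a"] W0 by (simp add: field_simps)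
  qed
  have t0: "t \<noteq> 0" using cd t by auto
  have "ym x = t * yp x" for x by (simp add: csol_def t algebra_simps)
  then have yt: "yp x = ym x / t" for x using t0 by simp
  have "L2_right (\<lambda>x. yp (- x))"
    using left unfolding L2_right_def yt by (simp add: norm_divide power_divide)
  then have "L2 yp" by (rule L2_of_sides[OF yp_cont right])
  then have "AE x in lborel. yp x = 0" by (rule hom_unique) (rule weak_of_classical[OF V yp])
  then have y0: "yp x = 0" for x by (rule AE_continuous_eq_0[OF yp_cont])
  have "(yp has_vector_derivative yp' 0) (at 0)" using yp by (simp add: schr_sol_def)
  moreover have "(yp has_vector_derivative 0) (at 0)"
    unfolding ext[of yp "\<lambda>x. 0", OF y0] by (rule has_vector_derivative_const)
  ultimately have "yp' 0 = 0" by (rule vector_derivative_unique_at)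
  then show False using y0[of 0] ab by (simp add: csol_0[OF V])
qed

definition K :: "real \<Rightarrow> real \<Rightarrow> complex" where "K x y = yp (max x y) * ym (min x y)"

lemma K_meas [measurable]: "(\<lambda>(x, y). K x y) \<in> borel_measurable (borel \<Otimes>\<^sub>M borel)"
  unfolding K_def by measurable

lemma K_bounded: "\<exists>B\<ge>0. \<forall>x y. \<bar>x\<bar> \<le> r \<longrightarrow> \<bar>y\<bar> \<le> s \<longrightarrow> norm (K x y) \<le> B"
proof -
  let ?m = "max \<bar>r\<bar> \<bar>s\<bar>"
  have "compact (yp ` {-?m..?m})" "compact (ym ` {-?m..?m})"
    by (intro compact_continuous_image yp_cont ym_cont compact_Icc)+
  from this[THEN compact_imp_bounded] obtain A B where A: "\<forall>v\<in>yp ` {-?m..?m}. norm v \<le> A" and B: "\<forall>v\<in>ym ` {-?m..?m}. norm v \<le> B"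
    unfolding bounded_iff by blast
  have "norm (K x y) \<le> \<bar>A\<bar> * \<bar>B\<bar>" if "\<bar>x\<bar> \<le> r" "\<bar>y\<bar> \<le> s" for x y
  proof -
    have "max x y \<in> {-?m..?m}" "min x y \<in> {-?m..?m}" using that by auto
    then have "norm (yp (max x y)) \<le> A" "norm (ym (min x y)) \<le> B" using A B by blast+
    then show ?thesis unfolding K_def norm_mult by (intro mult_mono) auto
  qed
  then show ?thesis by (intro exI[of _ "\<bar>A\<bar> * \<bar>B\<bar>"]) auto
qed

text \<open>After splitting at x = y and applying Lagrange's identity on each side, the \<phi>'
  terms cancel and the \<phi> terms combine to the Wronskian. The kernel divided by \<open>W\<close>
  is thus a fundamental solution of z - P.\<close>

lemma K_fundamental:
  assumes \<phi>: "test_fun \<phi>"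
  shows "(\<integral>x. K x y * Lop V z \<phi> x \<partial>lborel) = W * of_real (\<phi> y)"
proof -
  obtain R0 M where R0: "R0 > 0" "\<And>x. \<bar>x\<bar> \<ge> R0 \<Longrightarrow> \<phi> x = 0" "\<And>x. \<bar>x\<bar> \<ge> R0 \<Longrightarrow> deriv \<phi> x = 0" "\<And>x. \<bar>x\<bar> \<ge> R0 \<Longrightarrow> Lop V z \<phi> x = 0"
    and cL: "continuous_on UNIV (Lop V z \<phi>)"
    by (rule test_fun_props[OF V \<phi>, where z = z]) (rule that)
  \<comment> \<open>Enlarged to contain \<open>y\<close>, so that [-R, y] and [y, R] are genuine
    intervals and \<phi> vanishes at their outer ends.\<close>
  define R where "R = max R0 \<bar>y\<bar>"
  have R: "R > 0" "-R \<le> y" "y \<le> R" "\<And>x. \<bar>x\<bar> \<ge> R \<Longrightarrow> \<phi> x = 0" "\<And>x. \<bar>x\<bar> \<ge> R \<Longrightarrow> deriv \<phi> x = 0" "\<And>x. \<bar>x\<bar> > R \<Longrightarrow> Lop V z \<phi> x = 0"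
    using R0 by (auto simp: R_def)
  have sm: "smooth_real \<phi>" using \<phi> by (simp add: test_fun_def)
  have i: "integrable lborel (\<lambda>x. indicator {s..t} x *\<^sub>R (w x * Lop V z \<phi> x))" if "continuous_on UNIV w" for w s t
  proof -
    have "continuous_on {s..t} (\<lambda>x. w x * Lop V z \<phi> x)"
      by (intro continuous_intros continuous_on_subset[OF that] continuous_on_subset[OF cL]) auto
    from borel_integrable_atLeastAtMost'[OF this] show ?thesis by (simp add: set_integrable_def)
  qed
  have "(\<integral>x. K x y * Lop V z \<phi> x \<partial>lborel)
    = (\<integral>x. yp y * (indicator {-R..y} x *\<^sub>R (ym x * Lop V z \<phi> x)) + ym y * (indicator {y..R} x *\<^sub>R (yp x * Lop V z \<phi> x)) \<partial>lborel)"
  proof (rule integral_cong_AE)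
    show "AE x in lborel. K x y * Lop V z \<phi> x = yp y * (indicator {-R..y} x *\<^sub>R (ym x * Lop V z \<phi> x)) + ym y * (indicator {y..R} x *\<^sub>R (yp x * Lop V z \<phi> x))"
      using AE_lborel_singleton[of y]
    proof eventually_elim
      case (elim x)
      consider "x < -R" | "x \<ge> -R" "x < y" | "x \<le> R" "x > y" | "x > R" using elim by linarith
      then show ?case using R(2,3) by cases (auto simp: K_def max_def min_def R(6))
    qed
    have [measurable]: "Lop V z \<phi> \<in> borel_measurable borel" by (rule borel_measurable_continuous_onI[OF cL])
    show "(\<lambda>x. K x y * Lop V z \<phi> x) \<in> borel_measurable lborel" unfolding K_def by measurable
    show "(\<lambda>x. yp y * (indicator {-R..y} x *\<^sub>R (ym x * Lop V z \<phi> x)) + ym y * (indicator {y..R} x *\<^sub>R (yp x * Lop V z \<phi> x))) \<in> borel_measurable lborel"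
      by measurable
  qed
  also have "\<dots> = yp y * (\<integral>x. indicator {-R..y} x *\<^sub>R (ym x * Lop V z \<phi> x) \<partial>lborel) + ym y * (\<integral>x. indicator {y..R} x *\<^sub>R (yp x * Lop V z \<phi> x) \<partial>lborel)"
    unfolding Bochner_Integration.integral_add[OF integrable_mult_right[OF i[OF ym_cont]] integrable_mult_right[OF i[OF yp_cont]]]
      integral_mult_right_zero ..
  also have "\<dots> = yp y * (ym y * of_real (deriv \<phi> y) - ym' y * of_real (\<phi> y)) - ym y * (yp y * of_real (deriv \<phi> y) - yp' y * of_real (\<phi> y))"
    unfolding parts_integral[OF V ym sm R(2)] parts_integral[OF V yp sm R(3)]
    using R(4)[of R] R(4)[of "-R"] R(5)[of R] R(5)[of "-R"] R(1) by (simp add: algebra_simps)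
  also have "\<dots> = W * of_real (\<phi> y)" unfolding W_eq[of y, symmetric] by (simp add: algebra_simps)
  finally show ?thesis .
qed

section \<open>The resolvent on compactly supported data\<close>

context
  fixes g :: "real \<Rightarrow> complex" and r :: real
  assumes g: "L2 g" and gr: "\<And>x. \<bar>x\<bar> > r \<Longrightarrow> g x = 0" and r: "r \<ge> 0"
begin

lemma g_meas [measurable]: "g \<in> borel_measurable borel" using g by (simp add: L2_def)

lemma g_int: "integrable lborel g"
proof -
  have "integrable lborel (\<lambda>x. g x * indicator {-r..r} x)"
    by (rule L2_mult_integrable[OF g, where C = 1 and a = "-r" and b = r]) (auto simp: indicator_def)
  moreover have "(\<lambda>x. g x * indicator {-r..r} x) = g" using gr by (force simp: indicator_def)
  ultimately show ?thesis by simp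
qed

definition u :: "real \<Rightarrow> complex" where "u x = (\<integral>y. K x y * g y \<partial>lborel) / W"

lemma u_meas [measurable]: "u \<in> borel_measurable borel"
  unfolding u_def[abs_def] by measurable

lemma Kg_int: "integrable lborel (\<lambda>y. K x y * g y)"
proof -
  obtain B where B: "B \<ge> 0" "\<And>x' y. \<bar>x'\<bar> \<le> \<bar>x\<bar> \<Longrightarrow> \<bar>y\<bar> \<le> r \<Longrightarrow> norm (K x' y) \<le> B" using K_bounded[of "\<bar>x\<bar>" r] by blast
  show ?thesis
  proof (rule Bochner_Integration.integrable_bound[OF integrable_mult_right[OF integrable_norm[OF g_int], of B]])
    show "AE y in lborel. norm (K x y * g y) \<le> norm (B * norm (g y))"
    proof (rule AE_I2)
      fix y show "norm (K x y * g y) \<le> norm (B * norm (g y))"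
        using B(2)[of x y] B(1) gr[of y] by (cases "\<bar>y\<bar> \<le> r") (auto simp: norm_mult intro!: mult_right_mono)
    qed
  qed measurable
qed

lemma u_L2: "L2 u"
proof -
  obtain B0 where B0: "B0 \<ge> 0" "\<And>x y. \<bar>x\<bar> \<le> r \<Longrightarrow> \<bar>y\<bar> \<le> r \<Longrightarrow> norm (K x y) \<le> B0" using K_bounded[of r r] by blast
  have "compact (yp ` {-r..r})" "compact (ym ` {-r..r})"
    by (intro compact_continuous_image yp_cont ym_cont compact_Icc)+
  from this[THEN compact_imp_bounded] obtain B1 B2 where B1: "\<forall>v\<in>yp ` {-r..r}. norm v \<le> B1" and B2: "\<forall>v\<in>ym ` {-r..r}. norm v \<le> B2"
    unfolding bounded_iff by blast
  define C where "C = max B0 (max \<bar>B1\<bar> \<bar>B2\<bar>)"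
  have C: "C \<ge> 0" "B0 \<le> C" "\<bar>B1\<bar> \<le> C" "\<bar>B2\<bar> \<le> C" by (auto simp: C_def)
  \<comment> \<open>For |y| \<le> r the kernel is, as a function of \<open>x\<close>, a multiple of
    \<open>yp\<close> to the right of \<open>r\<close> and of \<open>ym\<close> to the left of
    \<open>-r\<close>; each is square integrable on its side.\<close>
  define h where "h x = (if x > r then norm (yp x) else if x < -r then norm (ym x) else 1)" for x
  have Kh: "norm (K x y) \<le> C * h x" if y: "\<bar>y\<bar> \<le> r" for x y
  proof -
    have yr: "y \<in> {-r..r}" using y by auto
    consider "x > r" | "x < -r" | "\<bar>x\<bar> \<le> r" by linarith
    then show ?thesis
    proof cases
      case 1
      have "norm (ym y) \<le> B2" using B2 yr by blast
      then have "norm (ym y) \<le> C" using C(4) by linarith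
      then have "norm (yp x) * norm (ym y) \<le> norm (yp x) * C" by (rule mult_left_mono) simp
      moreover have "\<not> x \<le> y" using 1 y by linarith
      ultimately show ?thesis using 1 by (simp add: K_def h_def max_def min_def norm_mult mult.commute)
    next
      case 2
      have "norm (yp y) \<le> B1" using B1 yr by blast
      then have "norm (yp y) \<le> C" using C(3) by linarith
      then have "norm (yp y) * norm (ym x) \<le> C * norm (ym x)" by (rule mult_right_mono) simp
      moreover have "x \<le> y" "\<not> x > r" using 2 y r by linarith+
      ultimately show ?thesis using 2 by (simp add: K_def h_def max_def min_def norm_mult)
    next
      case 3
      then show ?thesis using B0(2)[OF 3 y] C(2) by (auto simp: h_def)
    qed
  qed
  have h0: "h x \<ge> 0" for x by (simp add: h_def)
  let ?g1 = "\<integral>y. norm (g y) \<partial>lborel"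
  have ub: "norm (u x) \<le> C * ?g1 / norm W * h x" for x
  proof -
    have "norm (\<integral>y. K x y * g y \<partial>lborel) \<le> (\<integral>y. C * h x * norm (g y) \<partial>lborel)"
    proof (rule norm_integral_le_integral[OF Kg_int])
      show "integrable lborel (\<lambda>y. C * h x * norm (g y))" by (intro integrable_mult_right integrable_norm g_int)
      show "norm (K x y * g y) \<le> C * h x * norm (g y)" for y
        using Kh[of y x] gr[of y] by (cases "\<bar>y\<bar> \<le> r") (auto simp: norm_mult intro!: mult_right_mono)
    qed
    also have "\<dots> = C * h x * ?g1" by simp
    finally have "norm (\<integral>y. K x y * g y \<partial>lborel) / norm W \<le> C * h x * ?g1 / norm W" by (rule divide_right_mono) simp
    then show ?thesis by (simp add: u_def norm_divide mult_ac)
  qed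
  have h2: "(h x)\<^sup>2 \<le> indicator {-r..r} x + indicator {0..} x * (norm (yp x))\<^sup>2 + indicator {0..} (- x) * (norm (ym x))\<^sup>2" for x
    using r by (auto simp: h_def indicator_def)
  have "integrable lborel (\<lambda>x. indicator {0..} x * (norm (ym (- x)))\<^sup>2)" using left by (simp add: L2_right_def)
  from lborel_integrable_real_affine[OF this, of "-1" 0]
  have i2: "integrable lborel (\<lambda>x. indicator {0..} (- x) * (norm (ym x))\<^sup>2)" by simp
  have i1: "integrable lborel (\<lambda>x. indicator {0..} x * (norm (yp x))\<^sup>2)" using right by (simp add: L2_right_def)
  let ?h = "\<lambda>x. indicator {-r..r} x + indicator {0..} x * (norm (yp x))\<^sup>2 + indicator {0..} (- x) * (norm (ym x))\<^sup>2"
  have ih: "integrable lborel (\<lambda>x. (C * ?g1 / norm W)\<^sup>2 * ?h x)"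
    using i1 i2 by (intro integrable_mult_right Bochner_Integration.integrable_add) auto
  have "integrable lborel (\<lambda>x. (norm (u x))\<^sup>2)"
  proof (rule Bochner_Integration.integrable_bound[OF ih])
    show "AE x in lborel. norm ((norm (u x))\<^sup>2) \<le> norm ((C * ?g1 / norm W)\<^sup>2 * ?h x)"
    proof (rule AE_I2)
      fix x
      have "(norm (u x))\<^sup>2 \<le> (C * ?g1 / norm W * h x)\<^sup>2" by (rule power_mono[OF ub]) simp
      also have "\<dots> \<le> (C * ?g1 / norm W)\<^sup>2 * ?h x" unfolding power_mult_distrib by (rule mult_left_mono[OF h2]) simp
      also have "\<dots> \<le> norm ((C * ?g1 / norm W)\<^sup>2 * ?h x)" unfolding real_norm_def by (rule abs_ge_self)
      finally show "norm ((norm (u x))\<^sup>2) \<le> norm ((C * ?g1 / norm W)\<^sup>2 * ?h x)" by simp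
    qed
  qed measurable
  then show ?thesis by (simp add: L2_def)
qed

lemma u_weak:
  assumes \<phi>: "test_fun \<phi>"
  shows "(\<integral>x. u x * Lop V z \<phi> x \<partial>lborel) = (\<integral>x. g x * of_real (\<phi> x) \<partial>lborel)"
proof -
  obtain R M where R: "R > 0" "M \<ge> 0" "\<And>x. norm (Lop V z \<phi> x) \<le> M * indicator {-R..R} x" and cL: "continuous_on UNIV (Lop V z \<phi>)"
    by (rule test_fun_props[OF V \<phi>, where z = z]) (rule that)
  have [measurable]: "Lop V z \<phi> \<in> borel_measurable borel" by (rule borel_measurable_continuous_onI[OF cL])
  obtain B where B: "B \<ge> 0" "\<And>x y. \<bar>x\<bar> \<le> R \<Longrightarrow> \<bar>y\<bar> \<le> r \<Longrightarrow> norm (K x y) \<le> B" using K_bounded[of R r] by blast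
  let ?f = "\<lambda>(x, y). K x y * g y * Lop V z \<phi> x"
  have int: "integrable (lborel \<Otimes>\<^sub>M lborel) ?f"
  proof (rule Bochner_Integration.integrable_bound)
    show "integrable (lborel \<Otimes>\<^sub>M lborel) (\<lambda>(x, y). (B * M * indicator {-R..R} x) * norm (g y))"
      by (rule integrable_pair_product) (auto intro: g_int integrable_norm)
    show "?f \<in> borel_measurable (lborel \<Otimes>\<^sub>M lborel)" by measurable
    show "AE p in lborel \<Otimes>\<^sub>M lborel. norm (?f p) \<le> norm (case p of (x, y) \<Rightarrow> (B * M * indicator {-R..R} x) * norm (g y))"
    proof (rule AE_I2, clarify)
      fix x y
      show "norm (K x y * g y * Lop V z \<phi> x) \<le> norm ((B * M * indicator {-R..R} x) * norm (g y))"
      proof (cases "\<bar>y\<bar> \<le> r \<and> x \<in> {-R..R}")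
        case True
        then have "\<bar>x\<bar> \<le> R" "\<bar>y\<bar> \<le> r" by auto
        then have "norm (K x y) * norm (g y) * norm (Lop V z \<phi> x) \<le> B * norm (g y) * M"
          using R(3)[of x] True by (intro mult_mono B mult_nonneg_nonneg) auto
        then show ?thesis using True B(1) R(2) by (simp add: norm_mult abs_mult mult_ac)
      next
        case False
        then have "g y = 0 \<or> Lop V z \<phi> x = 0" using gr[of y] R(3)[of x] by auto
        then show ?thesis by auto
      qed
    qed
  qed
  have "(\<integral>x. u x * Lop V z \<phi> x \<partial>lborel) = (\<integral>x. (\<integral>y. K x y * g y * Lop V z \<phi> x \<partial>lborel) / W \<partial>lborel)"
    by (simp add: u_def)
  also have "\<dots> = (\<integral>x. \<integral>y. K x y * g y * Lop V z \<phi> x \<partial>lborel \<partial>lborel) / W" by simp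
  also have "(\<integral>x. \<integral>y. K x y * g y * Lop V z \<phi> x \<partial>lborel \<partial>lborel) = (\<integral>y. \<integral>x. K x y * g y * Lop V z \<phi> x \<partial>lborel \<partial>lborel)"
    using lborel_pair.Fubini_integral[OF int] by simp
  also have "\<dots> = (\<integral>y. W * (g y * of_real (\<phi> y)) \<partial>lborel)"
  proof (rule Bochner_Integration.integral_cong[OF refl])
    fix y
    have "(\<integral>x. K x y * g y * Lop V z \<phi> x \<partial>lborel) = (\<integral>x. g y * (K x y * Lop V z \<phi> x) \<partial>lborel)" by (simp add: mult_ac)
    also have "\<dots> = g y * (\<integral>x. K x y * Lop V z \<phi> x \<partial>lborel)" by (rule integral_mult_right_zero)
    finally show "(\<integral>x. K x y * g y * Lop V z \<phi> x \<partial>lborel) = W * (g y * of_real (\<phi> y))" unfolding K_fundamental[OF \<phi>] by simp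
  qed
  also have "\<dots> / W = (\<integral>y. g y * of_real (\<phi> y) \<partial>lborel)" using W_nonzero by simp
  finally show ?thesis .
qed

lemma u_sol: "resolvent_sol V z g u"
  unfolding resolvent_sol_def using u_L2 u_weak by (auto simp: Lop_def)

lemma Lop_int:
  assumes "L2 v" "test_fun \<phi>"
  shows "integrable lborel (\<lambda>x. v x * Lop V z \<phi> x)"
proof -
  obtain R M where R: "\<And>x. norm (Lop V z \<phi> x) \<le> M * indicator {-R..R} x" and cL: "continuous_on UNIV (Lop V z \<phi>)"
    by (rule test_fun_props[OF V assms(2), where z = z]) (rule that)
  show ?thesis by (rule L2_mult_integrable[OF assms(1) borel_measurable_continuous_onI[OF cL] R])
qed

lemma u_unique:
  assumes v: "resolvent_sol V z g v"
  shows "AE x in lborel. v x = u x"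
proof -
  have Lv: "L2 v" using v by (simp add: resolvent_sol_def)
  have L2d: "L2 (\<lambda>x. v x - u x)"
  proof -
    have m: "v \<in> borel_measurable borel" "integrable lborel (\<lambda>x. (norm (v x))\<^sup>2)" "integrable lborel (\<lambda>x. (norm (u x))\<^sup>2)"
      using Lv u_L2 by (auto simp: L2_def)
    have "integrable lborel (\<lambda>x. (norm (v x - u x))\<^sup>2)"
    proof (rule Bochner_Integration.integrable_bound[of _ "\<lambda>x. 2 * (norm (v x))\<^sup>2 + 2 * (norm (u x))\<^sup>2"])
      show "integrable lborel (\<lambda>x. 2 * (norm (v x))\<^sup>2 + 2 * (norm (u x))\<^sup>2)" using m by simp
      show "AE x in lborel. norm ((norm (v x - u x))\<^sup>2) \<le> norm (2 * (norm (v x))\<^sup>2 + 2 * (norm (u x))\<^sup>2)"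
      proof (rule AE_I2)
        fix x
        have "(norm (v x - u x))\<^sup>2 \<le> (norm (v x) + norm (u x))\<^sup>2" by (rule power_mono[OF norm_triangle_ineq4]) simp
        also have "\<dots> \<le> 2 * (norm (v x))\<^sup>2 + 2 * (norm (u x))\<^sup>2"
          using sum_squares_bound[of "norm (v x)" "norm (u x)"] by (simp add: power2_sum)
        finally show "norm ((norm (v x - u x))\<^sup>2) \<le> norm (2 * (norm (v x))\<^sup>2 + 2 * (norm (u x))\<^sup>2)" by simp
      qed
    qed (use m in measurable)
    then show ?thesis using m by (simp add: L2_def)
  qed
  have "AE x in lborel. v x - u x = 0"
  proof (rule hom_unique[OF L2d])
    fix \<psi> assume t: "test_fun \<psi>"
    have "(\<integral>x. v x * Lop V z \<psi> x \<partial>lborel) = (\<integral>x. g x * of_real (\<psi> x) \<partial>lborel)"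
      using v t by (auto simp: resolvent_sol_def Lop_def)
    then show "(\<integral>x. (v x - u x) * Lop V z \<psi> x \<partial>lborel) = 0"
      using u_weak[OF t] Lop_int[OF Lv t] Lop_int[OF u_L2 t] by (simp add: left_diff_distrib)
  qed
  then show ?thesis by eventually_elim simp
qed

text \<open>The description operator is resolved by \<open>u_sol\<close> and
  \<open>u_unique\<close>, since solutions agreeing almost everywhere give the same pairing. The
  numerator is written over the product measure because its holomorphy in the parameter is proved in
  that form.\<close>

lemma pairing_eq:
  assumes f: "L2 f" and fr: "\<And>x. \<bar>x\<bar> > r \<Longrightarrow> f x = 0"
  shows "resolvent_pairing V z f g = (\<integral>(x, y). cnj (f x) * g y * K x y \<partial>(lborel \<Otimes>\<^sub>M lborel)) / W"
proof -
  have fm[measurable]: "f \<in> borel_measurable borel" using f by (simp add: L2_def)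
  have [measurable]: "cnj \<in> borel_measurable borel" by (intro borel_measurable_continuous_onI continuous_intros)
  have fi: "integrable lborel f"
  proof -
    have "integrable lborel (\<lambda>x. f x * indicator {-r..r} x)"
      by (rule L2_mult_integrable[OF f, where C = 1 and a = "-r" and b = r]) (auto simp: indicator_def)
    moreover have "(\<lambda>x. f x * indicator {-r..r} x) = f" using fr by (force simp: indicator_def)
    ultimately show ?thesis by simp
  qed
  have "resolvent_pairing V z f g = (\<integral>x. cnj (f x) * u x \<partial>lborel)"
    unfolding resolvent_pairing_def
  proof (rule the_equality)
    show "\<exists>v. resolvent_sol V z g v \<and> (\<integral>x. cnj (f x) * u x \<partial>lborel) = (\<integral>x. cnj (f x) * v x \<partial>lborel)" using u_sol by blast
    fix e assume "\<exists>v. resolvent_sol V z g v \<and> e = (\<integral>x. cnj (f x) * v x \<partial>lborel)"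
    then obtain v where v: "resolvent_sol V z g v" "e = (\<integral>x. cnj (f x) * v x \<partial>lborel)" by blast
    have [measurable]: "v \<in> borel_measurable borel" using v by (simp add: resolvent_sol_def L2_def)
    show "e = (\<integral>x. cnj (f x) * u x \<partial>lborel)" unfolding v(2)
    proof (rule integral_cong_AE)
      show "AE x in lborel. cnj (f x) * v x = cnj (f x) * u x" using u_unique[OF v(1)] by eventually_elim simp
    qed measurable
  qed
  also have "\<dots> = (\<integral>x. (\<integral>y. cnj (f x) * g y * K x y \<partial>lborel) / W \<partial>lborel)"
  proof (rule Bochner_Integration.integral_cong[OF refl])
    fix x
    have "cnj (f x) * (\<integral>y. K x y * g y \<partial>lborel) = (\<integral>y. cnj (f x) * (K x y * g y) \<partial>lborel)" by (rule integral_mult_right_zero[symmetric])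
    then show "cnj (f x) * u x = (\<integral>y. cnj (f x) * g y * K x y \<partial>lborel) / W" by (simp add: u_def mult_ac)
  qed
  also have "\<dots> = (\<integral>x. \<integral>y. cnj (f x) * g y * K x y \<partial>lborel \<partial>lborel) / W" by simp
  also have "(\<integral>x. \<integral>y. cnj (f x) * g y * K x y \<partial>lborel \<partial>lborel) = (\<integral>(x, y). cnj (f x) * g y * K x y \<partial>(lborel \<Otimes>\<^sub>M lborel))"
  proof -
    obtain B where B: "B \<ge> 0" "\<And>x y. \<bar>x\<bar> \<le> r \<Longrightarrow> \<bar>y\<bar> \<le> r \<Longrightarrow> norm (K x y) \<le> B" using K_bounded[of r r] by blast
    have int: "integrable (lborel \<Otimes>\<^sub>M lborel) (\<lambda>(x, y). cnj (f x) * g y * K x y)"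
    proof (rule Bochner_Integration.integrable_bound)
      show "integrable (lborel \<Otimes>\<^sub>M lborel) (\<lambda>(x, y). (B * norm (f x)) * norm (g y))"
        by (rule integrable_pair_product) (auto intro: g_int fi integrable_norm)
      show "(\<lambda>(x, y). cnj (f x) * g y * K x y) \<in> borel_measurable (lborel \<Otimes>\<^sub>M lborel)" by measurable
      show "AE p in lborel \<Otimes>\<^sub>M lborel. norm (case p of (x, y) \<Rightarrow> cnj (f x) * g y * K x y) \<le> norm (case p of (x, y) \<Rightarrow> (B * norm (f x)) * norm (g y))"
      proof (rule AE_I2, clarify)
        fix x y
        show "norm (cnj (f x) * g y * K x y) \<le> norm ((B * norm (f x)) * norm (g y))"
        proof (cases "\<bar>x\<bar> \<le> r \<and> \<bar>y\<bar> \<le> r")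
          case True
          then have "norm (f x) * norm (g y) * norm (K x y) \<le> norm (f x) * norm (g y) * B" by (intro mult_left_mono B) auto
          then show ?thesis using B(1) by (simp add: norm_mult mult_ac)
        next
          case False
          then have "f x = 0 \<or> g y = 0" using fr[of x] gr[of y] by auto
          then show ?thesis by auto
        qed
      qed
    qed
    show ?thesis using lborel_pair.integral_fst'[OF int] by simp
  qed
  finally show ?thesis .
qed

end
end

section \<open>Meromorphic continuation\<close>

text \<open>Agreement is given only above height r/2. In the form N = P W the identity theorem
  extends it to the upper half of the ball without dividing by zeros of W. The value of a quotient
  at a zero of its denominator is a convention, so \<open>remove_sings\<close> is applied to make
  the local functions match at every point.\<close>

lemma meromorphic_glue:
  fixes P :: "complex \<Rightarrow> complex" and \<Lambda> :: "real set" and r :: "real \<Rightarrow> real" and N W :: "real \<Rightarrow> complex \<Rightarrow> complex"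
  assumes P: "P holomorphic_on {z. Im z > 0}" and r: "\<And>l. l \<in> \<Lambda> \<Longrightarrow> r l > 0"
    and N: "\<And>l. l \<in> \<Lambda> \<Longrightarrow> N l holomorphic_on ball (of_real l) (r l)"
    and W: "\<And>l. l \<in> \<Lambda> \<Longrightarrow> W l holomorphic_on ball (of_real l) (r l)"
    and eq: "\<And>l z. l \<in> \<Lambda> \<Longrightarrow> z \<in> ball (of_real l) (r l) \<Longrightarrow> Im z > r l / 2 \<Longrightarrow> W l z \<noteq> 0 \<and> P z = N l z / W l z"
  shows "\<exists>G. G meromorphic_on ((\<Union>l\<in>\<Lambda>. ball (of_real l) (r l)) \<union> {z. Im z > 0}) \<and> (\<forall>z. Im z > 0 \<longrightarrow> G z = P z)"
proof -
  let ?H = "{z. Im z > 0}"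
  have oH: "open ?H" by (rule open_halfspace_Im_gt)
  have cH: "convex ?H" by (rule convex_halfspace_Im_gt)
  define F where "F l z = N l z / W l z" for l z
  define B where "B l = ball (complex_of_real l) (r l)" for l
  \<comment> \<open>A point inside the ball but above height r/2, so W is nonzero there; as the ball
    is connected, the zeros of W are isolated.\<close>
  define top where "top l = Complex l (3 * r l / 4)" for l
  have top: "top l \<in> B l" "Im (top l) > r l / 2" "top l \<in> ?H" "W l (top l) \<noteq> 0" if l: "l \<in> \<Lambda>" for l
  proof -
    have "dist (of_real l) (top l) = 3 * r l / 4"
      using r[OF l] by (simp add: top_def dist_norm cmod_def)
    then show t: "top l \<in> B l" using r[OF l] by (simp add: B_def)
    show i: "Im (top l) > r l / 2" "top l \<in> ?H" using r[OF l] by (auto simp: top_def)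
    show "W l (top l) \<noteq> 0" using eq[OF l t[unfolded B_def] i(1)] by simp
  qed
  have oB: "open (B l)" "convex (B l)" for l by (auto simp: B_def)
  note NB = N[folded B_def] and WB = W[folded B_def] and eqB = eq[folded B_def]
  have Wnz: "\<forall>\<^sub>F w in at z. W l w \<noteq> 0" if l: "l \<in> \<Lambda>" and z: "z \<in> B l" for l z
    using non_zero_neighbour_alt[OF WB[OF l] oB(1) convex_connected[OF oB(2)] z top(1)[OF l] top(4)[OF l]]
    by eventually_elim simp
  have NPW: "N l z = P z * W l z" if l: "l \<in> \<Lambda>" and z: "z \<in> B l \<inter> ?H" for l z
  proof (rule analytic_continuation_open[of "B l \<inter> {z. Im z > r l / 2}" "B l \<inter> ?H" "N l" "\<lambda>z. P z * W l z" z])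
    show "open (B l \<inter> {z. Im z > r l / 2})" "open (B l \<inter> ?H)" using oB oH open_halfspace_Im_gt by blast+
    show "B l \<inter> {z. Im z > r l / 2} \<noteq> {}" using top[OF l] by auto
    show "connected (B l \<inter> ?H)" by (intro convex_connected convex_Int oB cH)
    show "B l \<inter> {z. Im z > r l / 2} \<subseteq> B l \<inter> ?H" using r[OF l] by auto
    show "N l holomorphic_on B l \<inter> ?H" by (rule holomorphic_on_subset[OF NB[OF l]]) auto
    show "(\<lambda>z. P z * W l z) holomorphic_on B l \<inter> ?H"
      by (intro holomorphic_on_mult holomorphic_on_subset[OF WB[OF l]] holomorphic_on_subset[OF P]) auto
    show "N l w = P w * W l w" if "w \<in> B l \<inter> {z. Im z > r l / 2}" for w using eqB[OF l, of w] that by auto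
  qed (rule z)
  have A: "remove_sings (F l) z = P z" if l: "l \<in> \<Lambda>" and z: "z \<in> B l \<inter> ?H" for l z
  proof -
    have "\<forall>\<^sub>F w in at z. w \<in> B l \<inter> ?H" using z oB oH by (intro eventually_at_in_open') auto
    then have "\<forall>\<^sub>F w in at z. F l w = P w"
      using Wnz[OF l IntD1[OF z]]
    proof eventually_elim
      case (elim w)
      then show ?case using NPW[OF l elim(1)] by (simp add: F_def)
    qed
    then have "remove_sings (F l) z = remove_sings P z" by (rule remove_sings_cong) simp
    also have "\<dots> = P z"
      by (rule remove_sings_at_analytic, rule holomorphic_on_imp_analytic_at[OF P oH]) (use z in auto)
    finally show ?thesis .
  qed
  have C: "remove_sings (F l) z = remove_sings (F k) z" if l: "l \<in> \<Lambda>" and k: "k \<in> \<Lambda>" and z: "z \<in> B l" "z \<in> B k" for l k z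
  proof -
    let ?D = "B l \<inter> B k"
    have oD: "open ?D" using oB by blast
    \<comment> \<open>Balls centred on the real axis contain the real projection of each of their
      points, so two overlapping ones also meet in the upper half plane.\<close>
    have x: "complex_of_real (Re z) \<in> ?D"
    proof -
      have "dist (of_real m) (complex_of_real (Re z)) \<le> dist (of_real m) z" for m
        using abs_Re_le_cmod[of "of_real m - z"] by (simp add: dist_norm flip: of_real_diff)
      then show ?thesis using z unfolding B_def by (auto intro: order.strict_trans1)
    qed
    then obtain e where e: "e > 0" "ball (complex_of_real (Re z)) e \<subseteq> ?D" using oD open_contains_ball by blast
    have "Complex (Re z) (e / 2) \<in> ball (complex_of_real (Re z)) e" using e(1) by (simp add: dist_norm cmod_def)
    then have "Complex (Re z) (e / 2) \<in> ?D \<inter> ?H" using e by auto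
    then have ne: "?D \<inter> ?H \<noteq> {}" by blast
    have cross: "N l w * W k w = N k w * W l w" if w: "w \<in> ?D" for w
    proof (rule analytic_continuation_open[of "?D \<inter> ?H" ?D "\<lambda>z. N l z * W k z" "\<lambda>z. N k z * W l z" w])
      show "open (?D \<inter> ?H)" using oD oH by blast
      show "connected ?D" by (intro convex_connected convex_Int oB)
      show "(\<lambda>z. N l z * W k z) holomorphic_on ?D"
        by (intro holomorphic_on_mult holomorphic_on_subset[OF WB[OF k]] holomorphic_on_subset[OF NB[OF l]]) auto
      show "(\<lambda>z. N k z * W l z) holomorphic_on ?D"
        by (intro holomorphic_on_mult holomorphic_on_subset[OF WB[OF l]] holomorphic_on_subset[OF NB[OF k]]) auto
      show "N l v * W k v = N k v * W l v" if "v \<in> ?D \<inter> ?H" for v using NPW[OF l, of v] NPW[OF k, of v] that by auto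
    qed (use oD ne w in auto)
    have "\<forall>\<^sub>F w in at z. w \<in> ?D" using z oD by (intro eventually_at_in_open') auto
    then have "\<forall>\<^sub>F w in at z. F l w = F k w"
      using Wnz[OF l z(1)] Wnz[OF k z(2)]
    proof eventually_elim
      case (elim w)
      then show ?case using cross[of w] by (simp add: F_def frac_eq_eq)
    qed
    then show ?thesis by (rule remove_sings_cong) simp
  qed
  \<comment> \<open>An arbitrary choice; by \<open>C\<close> the value obtained does not depend on
    it.\<close>
  define pick where "pick z = (SOME l. l \<in> \<Lambda> \<and> z \<in> B l)" for z
  have pick: "pick z \<in> \<Lambda> \<and> z \<in> B (pick z)" if "l \<in> \<Lambda>" "z \<in> B l" for l z
    unfolding pick_def by (rule someI[of _ l]) (use that in simp)
  define G where "G z = (if Im z > 0 then P z else remove_sings (F (pick z)) z)" for z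
  have GB: "G z = remove_sings (F l) z" if l: "l \<in> \<Lambda>" and z: "z \<in> B l" for l z
  proof (cases "Im z > 0")
    case True
    then show ?thesis using A[OF l, of z] z by (simp add: G_def)
  next
    case False
    then show ?thesis using C[of "pick z" l z] pick[OF l z] l z by (simp add: G_def)
  qed
  have mB: "G meromorphic_on B l" if l: "l \<in> \<Lambda>" for l
  proof -
    have "N l analytic_on B l" "W l analytic_on B l" using NB[OF l] WB[OF l] oB analytic_on_open by blast+
    then have "F l meromorphic_on B l" unfolding F_def[abs_def]
      by (intro meromorphic_intros analytic_on_imp_meromorphic_on)
    then have m: "remove_sings (F l) meromorphic_on B l" by (rule remove_sings_meromorphic)
    have ev: "\<forall>\<^sub>F w in at z. remove_sings (F l) w = G w" if z: "z \<in> B l" for z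
    proof -
      have "\<forall>\<^sub>F w in at z. w \<in> B l" using z oB by (intro eventually_at_in_open') auto
      then show ?thesis by eventually_elim (simp add: GB[OF l])
    qed
    show ?thesis using m meromorphic_on_cong[of "B l" "remove_sings (F l)" G "B l"] ev by simp
  qed
  have mH: "G meromorphic_on ?H"
  proof -
    have "P analytic_on ?H" using P oH analytic_on_open by blast
    then have m: "P meromorphic_on ?H" by (rule analytic_on_imp_meromorphic_on)
    have ev: "\<forall>\<^sub>F w in at z. P w = G w" if z: "z \<in> ?H" for z
    proof -
      have "\<forall>\<^sub>F w in at z. w \<in> ?H" using z oH by (intro eventually_at_in_open') auto
      then show ?thesis by eventually_elim (simp add: G_def)
    qed
    show ?thesis using m meromorphic_on_cong[of ?H P G ?H] ev by simp
  qed
  have "G meromorphic_on ((\<Union>l\<in>\<Lambda>. B l) \<union> ?H)"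
    using mB mH unfolding meromorphic_on_def by blast
  moreover have "\<forall>z. Im z > 0 \<longrightarrow> G z = P z" by (simp add: G_def)
  ultimately show ?thesis unfolding B_def by blast
qed

text \<open>Reflection maps solutions for the reflected potential to solutions for \<open>V\<close>
  and reverses the sign of the derivative at 0. It turns results at \<open>+\<infinity>\<close> into
  results at \<open>-\<infinity>\<close>.\<close>

lemma csol_reflect:
  assumes V: "continuous_on UNIV V"
  shows "csol V a (- b) z (- x) = csol (\<lambda>x. V (- x)) a b z x"
proof -
  have V': "continuous_on UNIV (\<lambda>x. V (- x))" by (rule continuous_on_compose2[OF V]) (auto intro!: continuous_intros)
  let ?y = "csol (\<lambda>x. V (- x)) a b z" and ?y' = "csol' (\<lambda>x. V (- x)) a b z"
  have y: "schr_sol (\<lambda>x. V (- x)) z ?y ?y'" by (rule schr_sol_csol[OF V'])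
  have neg: "((\<lambda>x. h (- x)) has_vector_derivative - h') (at x)" if "(h has_vector_derivative h') (at (- x))" for h :: "real \<Rightarrow> complex" and h' x
  proof -
    have "((\<lambda>x::real. - x) has_vector_derivative (-1)) (at x)"
      using has_vector_derivative_minus[OF has_vector_derivative_id[of "at x"]] by simp
    from vector_diff_chain_at[OF this that] show ?thesis by (simp add: comp_def)
  qed
  have s: "schr_sol V z (\<lambda>x. ?y (- x)) (\<lambda>x. - ?y' (- x))"
    unfolding schr_sol_def
  proof (intro allI conjI)
    fix x
    have 1: "(?y has_vector_derivative ?y' (- x)) (at (- x))" "(?y' has_vector_derivative (of_real (V (- (- x))) - z) * ?y (- x)) (at (- x))"
      using y unfolding schr_sol_def by blast+
    show "((\<lambda>x. ?y (- x)) has_vector_derivative - ?y' (- x)) (at x)" by (rule neg[OF 1(1)])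
    show "((\<lambda>x. - ?y' (- x)) has_vector_derivative (of_real (V x) - z) * ?y (- x)) (at x)"
      using has_vector_derivative_minus[OF neg[OF 1(2)]] by simp
  qed
  have "?y (- (- x)) = csol V (?y (- 0)) (- ?y' (- 0)) z (- x)" by (rule csol_repr[OF V s])
  then show ?thesis by (simp add: csol_0[OF V'])
qed

text \<open>The data are bounded on closed discs in \<open>D\<close>, and the standard solutions are
  bounded for |x| \<le> r and bounded z. Near each point of \<open>D\<close> the integrand is
  therefore dominated by a constant times |f(x)| |g(y)|.\<close>

lemma green_numerator_holomorphic:
  assumes V: "continuous_on UNIV V" and D: "open D" and hol: "p holomorphic_on D" "q holomorphic_on D" "c holomorphic_on D" "d holomorphic_on D"
    and f: "L2 f" "\<And>x. \<bar>x\<bar> > r \<Longrightarrow> f x = 0" and g: "L2 g" "\<And>x. \<bar>x\<bar> > r \<Longrightarrow> g x = 0"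
  shows "(\<lambda>z. \<integral>(x, y). cnj (f x) * g y * (csol V (p z) (q z) z (max x y) * csol V (c z) (d z) z (min x y)) \<partial>(lborel \<Otimes>\<^sub>M lborel)) holomorphic_on D"
proof -
  define K where "K z x y = csol V (p z) (q z) z (max x y) * csol V (c z) (d z) z (min x y)" for z x y
  have m[measurable]: "f \<in> borel_measurable borel" "g \<in> borel_measurable borel" "cnj \<in> borel_measurable borel"
    using f(1) g(1) by (auto simp: L2_def intro!: borel_measurable_continuous_onI continuous_intros)
  have cm[measurable]: "csol V a b z \<in> borel_measurable borel" for a b z
    by (rule borel_measurable_continuous_onI[OF schr_sol_continuous(1)[OF schr_sol_csol[OF V]]])
  have int: "integrable lborel h" if "L2 h" "\<And>x. \<bar>x\<bar> > r \<Longrightarrow> h x = 0" for h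
  proof -
    have "integrable lborel (\<lambda>x. h x * indicator {-r..r} x)"
      by (rule L2_mult_integrable[OF that(1), where C = 1 and a = "-r" and b = r]) (auto simp: indicator_def)
    moreover have "(\<lambda>x. h x * indicator {-r..r} x) = h" using that(2) by (force simp: indicator_def)
    ultimately show ?thesis by simp
  qed
  have iv: "(\<lambda>z. ivp V a b z x) holomorphic_on D" for a b x
    by (rule holomorphic_on_subset[OF ivp_holomorphic(1)[OF V]]) simp
  have "(\<lambda>z. \<integral>t. (case t of (x, y) \<Rightarrow> cnj (f x) * g y * K z x y) \<partial>(lborel \<Otimes>\<^sub>M lborel)) holomorphic_on D"
  proof (rule holomorphic_on_lebesgue_integral_local[OF D])
    show "(\<lambda>(x, y). cnj (f x) * g y * K z x y) \<in> borel_measurable (lborel \<Otimes>\<^sub>M lborel)" for z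
      unfolding K_def by measurable
    show "(\<lambda>z. case t of (x, y) \<Rightarrow> cnj (f x) * g y * K z x y) holomorphic_on D" for t
      unfolding K_def csol_def by (cases t) (auto intro!: holomorphic_intros hol iv)
    fix z0 assume z0: "z0 \<in> D"
    obtain e where e: "e > 0" "cball z0 e \<subseteq> D" using D z0 open_contains_cball by blast
    have bd: "\<exists>B. \<forall>z\<in>cball z0 e. norm (h z) \<le> B" if "h holomorphic_on D" for h
    proof -
      have "continuous_on (cball z0 e) h" using that e(2) holomorphic_on_imp_continuous_on holomorphic_on_subset by blast
      from compact_continuous_image[OF this compact_cball] have "bounded (h ` cball z0 e)" by (rule compact_imp_bounded)
      then show ?thesis unfolding bounded_iff by blast
    qed
    obtain B1 B2 B3 B4 where B: "\<And>z. z \<in> cball z0 e \<Longrightarrow> norm (p z) \<le> B1" "\<And>z. z \<in> cball z0 e \<Longrightarrow> norm (q z) \<le> B2"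
      "\<And>z. z \<in> cball z0 e \<Longrightarrow> norm (c z) \<le> B3" "\<And>z. z \<in> cball z0 e \<Longrightarrow> norm (d z) \<le> B4"
      using bd[OF hol(1)] bd[OF hol(2)] bd[OF hol(3)] bd[OF hol(4)] by blast
    have zb: "norm z \<le> norm z0 + e" if "z \<in> cball z0 e" for z
      using that norm_triangle_ineq2[of z z0] by (simp add: dist_norm norm_minus_commute)
    obtain M1 where M1: "\<And>x z. \<bar>x\<bar> \<le> r \<Longrightarrow> norm z \<le> norm z0 + e \<Longrightarrow> norm (ivp V 1 0 z x) \<le> M1"
      using ivp_bounded[OF V, of r "norm z0 + e" 1 0] by blast
    obtain M2 where M2: "\<And>x z. \<bar>x\<bar> \<le> r \<Longrightarrow> norm z \<le> norm z0 + e \<Longrightarrow> norm (ivp V 0 1 z x) \<le> M2"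
      using ivp_bounded[OF V, of r "norm z0 + e" 0 1] by blast
    have cs: "norm (csol V a b z x) \<le> \<bar>A\<bar> * \<bar>M1\<bar> + \<bar>B\<bar> * \<bar>M2\<bar>"
      if "norm a \<le> A" "norm b \<le> B" "z \<in> cball z0 e" "\<bar>x\<bar> \<le> r" for a b A B z x
    proof -
      have "norm (ivp V 1 0 z x) \<le> \<bar>M1\<bar>" "norm (ivp V 0 1 z x) \<le> \<bar>M2\<bar>"
        using M1[OF that(4) zb[OF that(3)]] M2[OF that(4) zb[OF that(3)]] by linarith+
      moreover have "norm a \<le> \<bar>A\<bar>" "norm b \<le> \<bar>B\<bar>" using that(1,2) by linarith+
      ultimately show ?thesis unfolding csol_def
        by (intro order_trans[OF norm_triangle_ineq] add_mono) (auto simp: norm_mult intro!: mult_mono)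
    qed
    define C where "C = (\<bar>B1\<bar> * \<bar>M1\<bar> + \<bar>B2\<bar> * \<bar>M2\<bar>) * (\<bar>B3\<bar> * \<bar>M1\<bar> + \<bar>B4\<bar> * \<bar>M2\<bar>)"
    have KC: "norm (K z x y) \<le> C" if "z \<in> cball z0 e" "\<bar>x\<bar> \<le> r" "\<bar>y\<bar> \<le> r" for z x y
      unfolding K_def C_def norm_mult
      by (intro mult_mono cs[OF B(1)[OF that(1)] B(2)[OF that(1)] that(1)] cs[OF B(3)[OF that(1)] B(4)[OF that(1)] that(1)])
         (use that in auto)
    show "\<exists>e>0. \<exists>B. integrable (lborel \<Otimes>\<^sub>M lborel) B \<and>
      (\<forall>z\<in>ball z0 e \<inter> D. \<forall>t\<in>space (lborel \<Otimes>\<^sub>M lborel). norm (case t of (x, y) \<Rightarrow> cnj (f x) * g y * K z x y) \<le> B t)"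
    proof (intro exI[of _ e] exI[of _ "\<lambda>(x, y). (\<bar>C\<bar> * norm (f x)) * norm (g y)"] conjI ballI)
      show "integrable (lborel \<Otimes>\<^sub>M lborel) (\<lambda>(x, y). (\<bar>C\<bar> * norm (f x)) * norm (g y))"
        by (rule integrable_pair_product) (auto intro: int f g integrable_norm)
      fix z and t :: "real \<times> real" assume z: "z \<in> ball z0 e \<inter> D"
      then have zc: "z \<in> cball z0 e" by simp
      obtain x y where t: "t = (x, y)" by (cases t)
      show "norm (case t of (x, y) \<Rightarrow> cnj (f x) * g y * K z x y) \<le> (case t of (x, y) \<Rightarrow> (\<bar>C\<bar> * norm (f x)) * norm (g y))"
      proof (cases "\<bar>x\<bar> \<le> r \<and> \<bar>y\<bar> \<le> r")
        case True
        then have "norm (K z x y) \<le> \<bar>C\<bar>" using KC[OF zc, of x y] by linarith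
        then have "norm (f x) * norm (g y) * norm (K z x y) \<le> norm (f x) * norm (g y) * \<bar>C\<bar>" by (intro mult_left_mono) auto
        then show ?thesis by (simp add: t norm_mult mult_ac)
      next
        case False
        then have "f x = 0 \<or> g y = 0" using f(2)[of x] g(2)[of y] by auto
        then show ?thesis by (auto simp: t)
      qed
    qed (rule e)
  qed
  then show ?thesis by (simp add: K_def)
qed

text \<open>The support is controlled only almost everywhere, so a representative vanishing
  identically outside an interval is produced. Every larger radius works too, which allows a common
  one for \<open>f\<close> and \<open>g\<close>.\<close>

lemma L2_comp_truncate:
  assumes "L2_comp f"
  obtains r where "\<And>s. s \<ge> r \<Longrightarrow> L2 (\<lambda>x. indicator {-s..s} x * f x) \<and> (AE x in lborel. indicator {-s..s} x * f x = f x)"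
proof -
  obtain r where f: "f \<in> borel_measurable lborel" "integrable lborel (\<lambda>x. (norm (f x))\<^sup>2)" and r: "AE x in lborel. \<bar>x\<bar> > r \<longrightarrow> f x = 0"
    using assms by (auto simp: L2_comp_def)
  have [measurable]: "f \<in> borel_measurable borel" using f by simp
  show ?thesis
  proof (rule that[of r], intro conjI)
    fix s assume s: "s \<ge> r"
    have "integrable lborel (\<lambda>x. (norm (indicator {-s..s} x * f x))\<^sup>2)"
      by (rule Bochner_Integration.integrable_bound[OF f(2)]) (auto simp: indicator_def)
    then show "L2 (\<lambda>x. indicator {-s..s} x * f x)" by (simp add: L2_def)
    show "AE x in lborel. indicator {-s..s} x * f x = f x" using r
      by eventually_elim (use s in \<open>auto simp: indicator_def\<close>)
  qed
qed

lemma resolvent_pairing_cong_AE: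
  assumes f: "f \<in> borel_measurable borel" "f' \<in> borel_measurable borel" "AE x in lborel. f' x = f x"
    and g: "g \<in> borel_measurable borel" "g' \<in> borel_measurable borel" "AE x in lborel. g' x = g x"
  shows "resolvent_pairing V z f g = resolvent_pairing V z f' g'"
proof -
  note [measurable] = f(1,2) g(1,2)
  have [measurable]: "cnj \<in> borel_measurable borel" by (intro borel_measurable_continuous_onI continuous_intros)
  have eq: "(\<integral>x. g x * of_real (\<phi> x) \<partial>lborel) = (\<integral>x. g' x * of_real (\<phi> x) \<partial>lborel)" if "test_fun \<phi>" for \<phi>
  proof (rule integral_cong_AE)
    have [measurable]: "\<phi> \<in> borel_measurable borel"
      using that by (auto simp: test_fun_def intro!: borel_measurable_continuous_onI smooth_real_continuous)
    show "(\<lambda>x. g x * of_real (\<phi> x)) \<in> borel_measurable lborel" "(\<lambda>x. g' x * of_real (\<phi> x)) \<in> borel_measurable lborel" by measurable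
    show "AE x in lborel. g x * of_real (\<phi> x) = g' x * of_real (\<phi> x)" using g(3) by eventually_elim simp
  qed
  have s: "resolvent_sol V z g u \<longleftrightarrow> resolvent_sol V z g' u" for u
    unfolding resolvent_sol_def by (intro conj_cong refl all_cong1 imp_cong) (simp only: eq)
  have c: "(\<integral>x. cnj (f x) * u x \<partial>lborel) = (\<integral>x. cnj (f' x) * u x \<partial>lborel)" if "resolvent_sol V z g' u" for u
  proof (rule integral_cong_AE)
    have [measurable]: "u \<in> borel_measurable borel" using that by (simp add: resolvent_sol_def L2_def)
    show "(\<lambda>x. cnj (f x) * u x) \<in> borel_measurable lborel" "(\<lambda>x. cnj (f' x) * u x) \<in> borel_measurable lborel" by measurable
    show "AE x in lborel. cnj (f x) * u x = cnj (f' x) * u x" using f(3) by eventually_elim simp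
  qed
  have "(\<exists>u. resolvent_sol V z g u \<and> e = (\<integral>x. cnj (f x) * u x \<partial>lborel))
    \<longleftrightarrow> (\<exists>u. resolvent_sol V z g' u \<and> e = (\<integral>x. cnj (f' x) * u x \<partial>lborel))" for e
    by (intro ex_cong1 conj_cong s) (simp only: c)
  then show ?thesis unfolding resolvent_pairing_def by simp
qed

text \<open>Numerator and denominator live on all of \<open>D\<close>, while the pairing is
  represented only on \<open>U\<close>, where the solutions are known to be square integrable. This
  gap is what the continuation bridges.\<close>

lemma pairing_quotient:
  assumes V: "continuous_on UNIV V" and D: "open D" "U \<subseteq> D" and hol: "p holomorphic_on D" "q holomorphic_on D" "c holomorphic_on D" "d holomorphic_on D"
    and gr: "\<And>z. z \<in> U \<Longrightarrow> green V z (p z) (q z) (c z) (d z)" and f: "L2_comp f" and g: "L2_comp g"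
  shows "\<exists>N W. N holomorphic_on D \<and> W holomorphic_on D \<and> (\<forall>z\<in>U. W z \<noteq> 0 \<and> resolvent_pairing V z f g = N z / W z)"
proof -
  obtain r1 where r1: "\<And>s. s \<ge> r1 \<Longrightarrow> L2 (\<lambda>x. indicator {-s..s} x * f x) \<and> (AE x in lborel. indicator {-s..s} x * f x = f x)"
    using L2_comp_truncate[OF f] by metis
  obtain r2 where r2: "\<And>s. s \<ge> r2 \<Longrightarrow> L2 (\<lambda>x. indicator {-s..s} x * g x) \<and> (AE x in lborel. indicator {-s..s} x * g x = g x)"
    using L2_comp_truncate[OF g] by metis
  define r where "r = max 0 (max r1 r2)"
  have r_ge: "r \<ge> r1" "r \<ge> r2" "r \<ge> 0" by (auto simp: r_def)
  define f' where "f' x = indicator {-r..r} x * f x" for x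
  define g' where "g' x = indicator {-r..r} x * g x" for x
  have f': "L2 f'" "AE x in lborel. f' x = f x" "\<And>x. \<bar>x\<bar> > r \<Longrightarrow> f' x = 0"
    using r1[OF r_ge(1)] unfolding f'_def[abs_def] by (auto simp: indicator_def)
  have g': "L2 g'" "AE x in lborel. g' x = g x" "\<And>x. \<bar>x\<bar> > r \<Longrightarrow> g' x = 0"
    using r2[OF r_ge(2)] unfolding g'_def[abs_def] by (auto simp: indicator_def)
  have eq: "resolvent_pairing V z f g = resolvent_pairing V z f' g'" for z
  proof (rule resolvent_pairing_cong_AE)
    show "f \<in> borel_measurable borel" "g \<in> borel_measurable borel" using f g by (auto simp: L2_comp_def)
    show "f' \<in> borel_measurable borel" "g' \<in> borel_measurable borel" using f'(1) g'(1) by (auto simp: L2_def)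
  qed (rule f'(2) g'(2))+
  let ?N = "\<lambda>z. \<integral>(x, y). cnj (f' x) * g' y * (csol V (p z) (q z) z (max x y) * csol V (c z) (d z) z (min x y)) \<partial>(lborel \<Otimes>\<^sub>M lborel)"
  let ?W = "\<lambda>z. c z * q z - d z * p z"
  have "resolvent_pairing V z f g = ?N z / ?W z \<and> ?W z \<noteq> 0" if z: "z \<in> U" for z
  proof -
    interpret green V z "p z" "q z" "c z" "d z" by (rule gr[OF z])
    from pairing_eq[OF g'(1) g'(3) r_ge(3) f'(1) f'(3)] show ?thesis
      unfolding eq using W_nonzero by (simp add: W_def K_def)
  qed
  moreover have "?N holomorphic_on D"
    by (rule green_numerator_holomorphic[OF V D(1) hol f'(1) f'(3) g'(1) g'(3)])
  moreover have "?W holomorphic_on D" by (intro holomorphic_intros hol)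
  ultimately have "?N holomorphic_on D \<and> ?W holomorphic_on D \<and> (\<forall>z\<in>U. ?W z \<noteq> 0 \<and> resolvent_pairing V z f g = ?N z / ?W z)"
    by blast
  then show ?thesis by (intro exI)
qed

theorem theorem1:
  fixes J :: nat and s W :: "nat \<Rightarrow> real \<Rightarrow> real" and V :: "real \<Rightarrow> real"
  assumes "\<forall>j\<in>{1..J}. periodic_factor (s j)"
    and "\<forall>j\<in>{1..J}. decaying_factor (W j)"
    and "\<forall>x. V x = (\<Sum>j=1..J. s j x * W j x)"
  shows "\<exists>\<Omega>::complex set. open \<Omega> \<and> complex_of_real ` ({0..} - thresholds) \<subseteq> \<Omega> \<and>
    (\<forall>f g. L2_comp f \<and> L2_comp g \<longrightarrow>
       (\<exists>G. G meromorphic_on (\<Omega> \<union> {z. Im z > 0}) \<and>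
            (\<forall>z. Im z > 0 \<longrightarrow> G z = resolvent_pairing V z f g)))"
proof -
  have Veq: "V = (\<lambda>x. \<Sum>j=1..J. s j x * W j x)" using assms(3) by auto
  define V' where "V' x = V (- x)" for x
  have V: "continuous_on UNIV V" unfolding Veq
    using assms(1,2) by (intro continuous_intros) (auto simp: periodic_factor_def decaying_factor_def intro: smooth_real_continuous)
  have V': "continuous_on UNIV V'" unfolding V'_def[abs_def] by (rule continuous_on_compose2[OF V]) (auto intro!: continuous_intros)
  have se: "sector_expansion V" unfolding Veq
    by (rule sector_expansion_sum) (use assms(1,2) sector_expansion_factor(1) in auto)
  have se': "sector_expansion V'" unfolding V'_def[abs_def] Veq
    by (rule sector_expansion_sum) (use assms(1,2) sector_expansion_factor(2) in auto)
  have uc: "\<exists>d>0. \<forall>x y. \<bar>x - y\<bar> < d \<longrightarrow> \<bar>V x - V y\<bar> < e" if "e > 0" for e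
    by (rule vanishing_bounded_uniformly_continuous(2)[OF V sector_expansion_tendsto_0[OF se] _ that])
       (use sector_expansion_tendsto_0[OF se'] in \<open>simp add: V'_def[abs_def]\<close>)
  \<comment> \<open>\<open>c\<close> and \<open>d\<close> are data for the reflected potential; the
    change of sign of \<open>d\<close> is that of \<open>csol_reflect\<close>.\<close>
  have greenI: "green V z a b c (- d)"
    if "Im z > 0" "a \<noteq> 0 \<or> b \<noteq> 0" "c \<noteq> 0 \<or> d \<noteq> 0" "L2_right (csol V a b z)" "L2_right (csol V' c d z)" for z a b c d
  proof (rule green.intro)
    show "L2_right (\<lambda>x. csol V c (- d) z (- x))" unfolding csol_reflect[OF V] using that(5) by (simp add: V'_def[abs_def])
    show "c \<noteq> 0 \<or> - d \<noteq> 0" using that(3) by simp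
  qed (use V uc that in auto)
  define \<Lambda> where "\<Lambda> = {0..} - thresholds"
  \<comment> \<open>Removing the squares of the naturals removes 0 and precisely the energies whose
    square root is an integer.\<close>
  have \<Lambda>: "l > 0 \<and> sqrt l \<notin> \<int>" if "l \<in> \<Lambda>" for l
  proof -
    have l: "l \<ge> 0" "l \<notin> thresholds" using that by (auto simp: \<Lambda>_def)
    have nt: "l \<noteq> real (n^2)" for n using l(2) by (auto simp: thresholds_def)
    have "sqrt l \<notin> \<int>"
    proof
      assume "sqrt l \<in> \<int>"
      then obtain m where m: "sqrt l = of_int m" by (auto elim: Ints_cases)
      have "l = (sqrt l)\<^sup>2" using l(1) by simp
      also have "\<dots> = real ((nat \<bar>m\<bar>)^2)" by (simp add: m)
      finally show False using nt by blast
    qed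
    moreover have "l \<noteq> 0" using nt[of 0] by simp
    ultimately show ?thesis using l(1) by simp
  qed
  have "\<exists>r p q c d. r > 0 \<and> p holomorphic_on ball (of_real l) r \<and> q holomorphic_on ball (of_real l) r \<and>
      c holomorphic_on ball (of_real l) r \<and> d holomorphic_on ball (of_real l) r \<and>
      (\<forall>z\<in>ball (of_real l) r. Im z > r / 2 \<longrightarrow> green V z (p z) (q z) (c z) (d z))" if l: "l \<in> \<Lambda>" for l
  proof -
    note ll = \<Lambda>[OF l]
    obtain r1 where r1: "r1 > 0" "\<And>r. 0 < r \<Longrightarrow> r < r1 \<Longrightarrow> \<exists>p s. p holomorphic_on ball (complex_of_real l) r \<and>
       s holomorphic_on ball (complex_of_real l) r \<and>
       (\<forall>z\<in>ball (complex_of_real l) r. Im z > r / 2 \<longrightarrow> (p z \<noteq> 0 \<or> s z \<noteq> 0) \<and> L2_right (csol V (p z) (s z) z))"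
      using local_jost_solution[OF V se ll[THEN conjunct1] ll[THEN conjunct2]] by blast
    obtain r2 where r2: "r2 > 0" "\<And>r. 0 < r \<Longrightarrow> r < r2 \<Longrightarrow> \<exists>p s. p holomorphic_on ball (complex_of_real l) r \<and>
       s holomorphic_on ball (complex_of_real l) r \<and>
       (\<forall>z\<in>ball (complex_of_real l) r. Im z > r / 2 \<longrightarrow> (p z \<noteq> 0 \<or> s z \<noteq> 0) \<and> L2_right (csol V' (p z) (s z) z))"
      using local_jost_solution[OF V' se' ll[THEN conjunct1] ll[THEN conjunct2]] by blast
    \<comment> \<open>Strictly below both radii, so that the right and the left solution share one
      disc.\<close>
    define r where "r = min r1 r2 / 2"
    have r: "r > 0" "r < r1" "r < r2" using r1(1) r2(1) by (auto simp: r_def)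
    obtain p q where pq: "p holomorphic_on ball (complex_of_real l) r" "q holomorphic_on ball (complex_of_real l) r"
      "\<And>z. z \<in> ball (complex_of_real l) r \<Longrightarrow> Im z > r / 2 \<Longrightarrow> (p z \<noteq> 0 \<or> q z \<noteq> 0) \<and> L2_right (csol V (p z) (q z) z)"
      using r1(2)[OF r(1,2)] by blast
    obtain c d where cd: "c holomorphic_on ball (complex_of_real l) r" "d holomorphic_on ball (complex_of_real l) r"
      "\<And>z. z \<in> ball (complex_of_real l) r \<Longrightarrow> Im z > r / 2 \<Longrightarrow> (c z \<noteq> 0 \<or> d z \<noteq> 0) \<and> L2_right (csol V' (c z) (d z) z)"
      using r2(2)[OF r(1,3)] by blast
    show ?thesis
    proof (rule exI[of _ r], rule exI[of _ p], rule exI[of _ q], rule exI[of _ c], rule exI[of _ "\<lambda>z. - d z"], intro conjI ballI impI)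
      fix z assume z: "z \<in> ball (complex_of_real l) r" "Im z > r / 2"
      show "green V z (p z) (q z) (c z) (- d z)"
        by (rule greenI) (use pq(3)[OF z] cd(3)[OF z] z(2) r(1) in auto)
    qed (use r pq cd in \<open>auto intro!: holomorphic_intros\<close>)
  qed
  then obtain r p q c d where loc: "\<And>l. l \<in> \<Lambda> \<Longrightarrow> r l > 0 \<and> p l holomorphic_on ball (of_real l) (r l) \<and> q l holomorphic_on ball (of_real l) (r l) \<and>
      c l holomorphic_on ball (of_real l) (r l) \<and> d l holomorphic_on ball (of_real l) (r l) \<and>
      (\<forall>z\<in>ball (of_real l) (r l). Im z > r l / 2 \<longrightarrow> green V z (p l z) (q l z) (c l z) (d l z))"
    by metis
  define \<Omega> where "\<Omega> = (\<Union>l\<in>\<Lambda>. ball (complex_of_real l) (r l))"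
  \<comment> \<open>The discs cover only a neighbourhood of the real energies; the Weyl solutions
    give holomorphy of the pairing on the whole upper half plane.\<close>
  obtain wp wq where w: "wp holomorphic_on {z. Im z > 0}" "wq holomorphic_on {z. Im z > 0}"
    "\<And>z. Im z > 0 \<Longrightarrow> wp z \<noteq> 0 \<or> wq z \<noteq> 0" "\<And>z. Im z > 0 \<Longrightarrow> L2_right (csol V (wp z) (wq z) z)"
    using weyl_solution[OF V] by metis
  obtain wc wd where w': "wc holomorphic_on {z. Im z > 0}" "wd holomorphic_on {z. Im z > 0}"
    "\<And>z. Im z > 0 \<Longrightarrow> wc z \<noteq> 0 \<or> wd z \<noteq> 0" "\<And>z. Im z > 0 \<Longrightarrow> L2_right (csol V' (wc z) (wd z) z)"
    using weyl_solution[OF V'] by metis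
  have oH: "open {z. Im z > 0}" by (rule open_halfspace_Im_gt)
  show ?thesis
  proof (intro exI[of _ \<Omega>] conjI allI impI)
    show "open \<Omega>" by (simp add: \<Omega>_def open_UN)
    show "complex_of_real ` ({0..} - thresholds) \<subseteq> \<Omega>"
    proof
      fix w assume "w \<in> complex_of_real ` ({0..} - thresholds)"
      then obtain l where "l \<in> \<Lambda>" "w = of_real l" by (auto simp: \<Lambda>_def)
      then show "w \<in> \<Omega>" using loc[of l] by (auto simp: \<Omega>_def intro!: bexI[of _ l])
    qed
    fix f g assume fg: "L2_comp f \<and> L2_comp g"
    let ?P = "\<lambda>z. resolvent_pairing V z f g"
    have hd: "(\<lambda>z. - wd z) holomorphic_on {z. Im z > 0}" by (intro holomorphic_intros w')
    have "\<exists>N W. N holomorphic_on {z. Im z > 0} \<and> W holomorphic_on {z. Im z > 0} \<and> (\<forall>z\<in>{z. Im z > 0}. W z \<noteq> 0 \<and> ?P z = N z / W z)"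
      by (rule pairing_quotient[OF V oH subset_refl w(1,2) w'(1) hd greenI]) (use w w' fg in auto)
    then obtain N W where NW: "N holomorphic_on {z. Im z > 0}" "W holomorphic_on {z. Im z > 0}"
      "\<And>z. Im z > 0 \<Longrightarrow> W z \<noteq> 0 \<and> ?P z = N z / W z" by blast
    have "(\<lambda>z. N z / W z) holomorphic_on {z. Im z > 0}" using NW by (intro holomorphic_on_divide) auto
    then have P: "?P holomorphic_on {z. Im z > 0}" by (rule holomorphic_transform) (use NW(3) in auto)
    have "\<exists>N W. N holomorphic_on ball (of_real l) (r l) \<and> W holomorphic_on ball (of_real l) (r l) \<and>
       (\<forall>z\<in>ball (of_real l) (r l) \<inter> {z. Im z > r l / 2}. W z \<noteq> 0 \<and> ?P z = N z / W z)" if l: "l \<in> \<Lambda>" for l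
      by (rule pairing_quotient[OF V open_ball Int_lower1, where p = "p l" and q = "q l" and c = "c l" and d = "d l"]) (use loc[OF l] fg in auto)
    then obtain NL WL where L: "\<And>l. l \<in> \<Lambda> \<Longrightarrow> NL l holomorphic_on ball (of_real l) (r l) \<and> WL l holomorphic_on ball (of_real l) (r l) \<and>
       (\<forall>z\<in>ball (of_real l) (r l) \<inter> {z. Im z > r l / 2}. WL l z \<noteq> 0 \<and> ?P z = NL l z / WL l z)" by metis
    show "\<exists>G. G meromorphic_on (\<Omega> \<union> {z. Im z > 0}) \<and> (\<forall>z. Im z > 0 \<longrightarrow> G z = ?P z)"
      unfolding \<Omega>_def by (rule meromorphic_glue[OF P, of \<Lambda> r NL WL]) (use loc L in auto)
  qed
qed

end
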